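(* Consider the Gaussian model. Let $d\in\mathbb{N}$ be fixed and take $r=n-d$, where $n\to\infty$. Let $X_1,\ldots,X_{r+1}$ be i.i.d. standard Gaussian points in $\mathbb{R}^n$, let $\mathcal V_{n,r}$ be the $r$-dimensional volume of the simplex with these vertices, $\mathcal L_{n,r}=\log(r!\,\mathcal V_{n,r})$, and let $m_n=\frac12\big(n\log n-n+\frac12\log n+\log(2^{3/2}\pi)\big)$. Then $\mathcal L_{n,r}-m_n$ converges in the mod-Gaussian sense (meaning mod-$\phi$ convergence with $\eta(t)=\frac12t^2$) with parameters $w_n=\frac12\log\frac n2$, namely $$\lim_{n\to\infty}\frac{\mathbb{E}e^{t(\mathcal L_{n,r}-m_n)}}{e^{\frac14t^2\log\frac n2}}=\frac{G\left(\frac{d+1}2\right)G\left(\frac{d+2}2\right)}{2^{\frac{td}2}\,G\left(\frac{d+1}2+\frac t2\right)G\left(\frac{d+2}2+\frac t2\right)}.$$ The convergence is uniform as long as $t$ stays in any compact subset of $\mathbb{C}\setminus\{-d-1,-d-2,\ldots\}$.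
   Context: $G$ is the Barnes $G$-function, the entire function $G(z+1)=(2\pi)^{z/2}e^{-\frac12(z+(1+\gamma)z^2)}\prod_{k=1}^\infty(1+\frac zk)^ke^{\frac{z^2}{2k}-z}$ ($\gamma$ the Euler constant), satisfying $G(z+1)=\Gamma(z)G(z)$ and $G(1)=1$. Mod-$\phi$ convergence: real random variables $Y_n$ converge in the mod-$\phi$ sense with $\eta$ and parameters $w_n\to+\infty$ if $\phi$ is an infinitely divisible distribution with $\int e^{tx}\phi(dx)=e^{\eta(t)}$ on an open strip $S=\{c_-<\operatorname{Re}t<c_+\}$ of the complex plane, and $\mathbb{E}e^{tY_n}/e^{w_n\eta(t)}$ converges, locally uniformly on $S$, to an analytic limit function. For complex $t$ at which the expectation does not converge absolutely, $\mathbb{E}e^{tY_n}$ is understood as the meromorphic continuation in $t$ of the moment generating function. *)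

theory Defs
  imports "HOL-Probability.Probability" "HOL-Complex_Analysis.Complex_Analysis"
begin

text \<open>The factor with index \<open>k\<close> below is the one with index \<open>k + 1\<close> in the usual product over
  \<open>k \<ge> 1\<close>, and \<open>w = z - 1\<close> since the classical formula is for \<open>G(w + 1)\<close>.\<close>

definition barnes_G :: "complex \<Rightarrow> complex" where
  "barnes_G z = (let w = z - 1 in
     of_real (2 * pi) powr (w / 2) * exp (- (w + (1 + euler_mascheroni) * w\<^sup>2) / 2) *
     (\<Prod>k. (1 + w / of_nat (Suc k)) ^ Suc k * exp (w\<^sup>2 / (2 * of_nat (Suc k)) - w)))"


subsection \<open>Simplices in Euclidean space of variable dimension\<close>

text \<open>Since the dimension \<open>n\<close> varies within the statement, a point of Euclidean \<open>n\<close>-space is a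
  function in \<^term>\<open>extensional {..<n} :: (nat \<Rightarrow> real) set\<close>, the carrier of the product
  measure spaces over \<^term>\<open>{..<n}\<close>.\<close>

definition std_gaussian :: "nat \<Rightarrow> (nat \<Rightarrow> real) measure" where
  "std_gaussian n = PiM {..<n} (\<lambda>_. std_normal_distribution)"

definition gaussian_points ::
    "'a measure \<Rightarrow> nat \<Rightarrow> nat \<Rightarrow> (nat \<Rightarrow> 'a \<Rightarrow> nat \<Rightarrow> real) \<Rightarrow> bool" where
  "gaussian_points M n r X \<longleftrightarrow>
     prob_space M \<and>
     prob_space.indep_vars M (\<lambda>_. PiM {..<n} (\<lambda>_. borel)) X {..r} \<and>
     (\<forall>i\<le>r. distr M (PiM {..<n} (\<lambda>_. borel)) (X i) = std_gaussian n)"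

definition simplex_hull :: "nat \<Rightarrow> nat \<Rightarrow> (nat \<Rightarrow> nat \<Rightarrow> real) \<Rightarrow> (nat \<Rightarrow> real) set" where
  "simplex_hull n r x =
     {(\<lambda>k\<in>{..<n}. \<Sum>i\<le>r. c i * x i k) | c. (\<forall>i\<le>r. c i \<ge> 0) \<and> (\<Sum>i\<le>r. c i) = 1}"

definition orthonormal_frame :: "nat \<Rightarrow> nat \<Rightarrow> (nat \<Rightarrow> nat \<Rightarrow> real) \<Rightarrow> bool" where
  "orthonormal_frame n r u \<longleftrightarrow>
     (\<forall>i<r. \<forall>j<r. (\<Sum>k<n. u i k * u j k) = (if i = j then 1 else 0))"

definition flat_chart ::
    "nat \<Rightarrow> nat \<Rightarrow> (nat \<Rightarrow> real) \<Rightarrow> (nat \<Rightarrow> nat \<Rightarrow> real) \<Rightarrow> (nat \<Rightarrow> real) \<Rightarrow> (nat \<Rightarrow> real)" where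
  "flat_chart n r p u a = (\<lambda>k\<in>{..<n}. p k + (\<Sum>j<r. a j * u j k))"

text \<open>The \<open>r\<close>-dimensional volume of a Borel set \<open>S\<close> contained in an \<open>r\<close>-dimensional affine
  subspace of \<open>n\<close>-space: the \<open>r\<close>-dimensional Lebesgue measure of \<open>S\<close> in Cartesian coordinates on
  such a subspace. By invariance of Lebesgue measure under isometries the value does not depend on
  the coordinates, nor on the subspace if several are possible (it is then 0).\<close>

definition flat_volume :: "nat \<Rightarrow> nat \<Rightarrow> (nat \<Rightarrow> real) set \<Rightarrow> real" where
  "flat_volume n r S =
     (THE v. \<exists>p u. orthonormal_frame n r u \<and> S \<subseteq> flat_chart n r p u ` extensional {..<r} \<and>
        v = measure (PiM {..<r} (\<lambda>_. lborel)) {a \<in> extensional {..<r}. flat_chart n r p u a \<in> S})"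

text \<open>Degenerate simplices, where the logarithm is \<^term>\<open>ln 0 = (0 :: real)\<close> instead of minus
  infinity, occur with probability 0 in the Gaussian model.\<close>

definition log_simplex_volume :: "nat \<Rightarrow> nat \<Rightarrow> (nat \<Rightarrow> nat \<Rightarrow> real) \<Rightarrow> real" where
  "log_simplex_volume n r x = ln (fact r * flat_volume n r (simplex_hull n r x))"

definition log_volume_centering :: "nat \<Rightarrow> real" where
  "log_volume_centering n =
     (1/2) * (real n * ln (real n) - real n + (1/2) * ln (real n) + ln (2 powr (3/2) * pi))"


subsection \<open>Moment generating functions and mod-phi convergence\<close>

text \<open>For every real random variable there is at most one such \<open>F\<close>: the expectation converges at
  least on the imaginary axis, and \<open>nicely_meromorphic_on\<close> fixes the values at singularities.\<close>

definition mgf_continuation :: "'a measure \<Rightarrow> ('a \<Rightarrow> real) \<Rightarrow> (complex \<Rightarrow> complex) \<Rightarrow> bool" where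
  "mgf_continuation M Y F \<longleftrightarrow>
     F nicely_meromorphic_on UNIV \<and>
     (\<forall>t. integrable M (\<lambda>\<omega>. exp (t * of_real (Y \<omega>))) \<longrightarrow>
            F t = (\<integral>\<omega>. exp (t * of_real (Y \<omega>)) \<partial>M))"

definition cmgf :: "'a measure \<Rightarrow> ('a \<Rightarrow> real) \<Rightarrow> complex \<Rightarrow> complex" where
  "cmgf M Y t =
     (if integrable M (\<lambda>\<omega>. exp (t * of_real (Y \<omega>)))
      then (\<integral>\<omega>. exp (t * of_real (Y \<omega>)) \<partial>M)
      else (THE F. mgf_continuation M Y F) t)"

definition infinitely_divisible :: "real measure \<Rightarrow> bool" where
  "infinitely_divisible \<phi> \<longleftrightarrow>
     real_distribution \<phi> \<and>
     (\<forall>k::nat. k \<ge> 1 \<longrightarrow> (\<exists>\<nu>. real_distribution \<nu> \<and>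
        \<phi> = distr (PiM {..<k} (\<lambda>_. \<nu>)) borel (\<lambda>x. \<Sum>i<k. x i)))"

text \<open>The bounds \<open>a\<close>, \<open>b\<close> of the strip may be infinite. Finitely many indices are disregarded, since
  for given codimension \<open>d\<close> the model only exists in dimensions larger than \<open>d\<close>.\<close>

definition mod_phi_convergent ::
    "(nat \<Rightarrow> 'a measure) \<Rightarrow> (nat \<Rightarrow> 'a \<Rightarrow> real) \<Rightarrow> real measure \<Rightarrow> (complex \<Rightarrow> complex) \<Rightarrow>
     (nat \<Rightarrow> real) \<Rightarrow> ereal \<Rightarrow> ereal \<Rightarrow> (complex \<Rightarrow> complex) \<Rightarrow> bool" where
  "mod_phi_convergent M Y \<phi> \<eta> w a b \<psi> \<longleftrightarrow>
     (let S = {t. a < ereal (Re t) \<and> ereal (Re t) < b} in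
       a < b \<and>
       (\<forall>\<^sub>F n in sequentially. prob_space (M n) \<and> Y n \<in> borel_measurable (M n)) \<and>
       filterlim w at_top sequentially \<and>
       infinitely_divisible \<phi> \<and>
       (\<forall>t\<in>S. integrable \<phi> (\<lambda>x. exp (t * of_real x)) \<and>
               (\<integral>x. exp (t * of_real x) \<partial>\<phi>) = exp (\<eta> t)) \<and>
       \<psi> analytic_on S \<and>
       (\<forall>K. compact K \<and> K \<subseteq> S \<longrightarrow>
          uniform_limit K (\<lambda>n t. cmgf (M n) (Y n) t / exp (of_real (w n) * \<eta> t)) \<psi> sequentially))"

definition gaussian_volume_limit :: "nat \<Rightarrow> complex \<Rightarrow> complex" where
  "gaussian_volume_limit d t =
     barnes_G ((of_nat d + 1) / 2) * barnes_G ((of_nat d + 2) / 2) /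
     (2 powr (t * of_nat d / 2) *
      barnes_G ((of_nat d + 1) / 2 + t / 2) * barnes_G ((of_nat d + 2) / 2 + t / 2))"

end

theory Submission
  imports Defs "HOL-Real_Asymp.Real_Asymp"
begin

text \<open>Conditioning on one of the Gaussian points and rotating it into a coordinate axis splits the
  squared volume of the simplex into a chi-square factor and the squared volume of a Gaussian simplex
  of one vertex less in one dimension less. Hence \<open>(r! V)\<^sup>2\<close> is distributed as
  \<open>(r + 1) \<Prod>\<^sub>j 2 \<gamma>\<^sub>j\<close> with independent Gamma variables \<open>\<gamma>\<^sub>j\<close> of parameters \<open>(d + j) / 2\<close>,
  \<open>1 \<le> j \<le> r\<close>, and the moment generating function of the logarithm is an explicit product of the
  quotients \<open>\<Gamma>((d + j + t) / 2) / \<Gamma>((d + j) / 2)\<close>, which is meromorphic in \<open>t\<close>. Separating odd from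
  even \<open>j\<close> gives two products of the form \<open>\<Prod>\<^sub>k \<Gamma>(w + k)\<close> over consecutive \<open>k\<close>; each of them, after
  division by its Stirling asymptotics, converges to \<open>1 / G(w + 1)\<close> by the Weierstrass product.\<close>

section \<open>Gram determinants and plane rotations\<close>

text \<open>The edges at a common vertex are dependent, so peeling off one Gaussian vector does not
  leave a family of the same kind. The parameter \<alpha> of \<open>centered\<close> absorbs this
  dependence, and the factor r + 1 is what it accumulates. The volume is defined by charts of affine
  subspaces. It first has to be recognised as a Gram determinant, which depends on inner products
  only and hence is the same in every chart. For a_k = \<Gamma>(w + k + 1) / k! the quotients of
  consecutive terms are 1 + w / (k + 1). Summation by parts therefore gives a_0 ... a_(N-1) (1 + w)
  (1 + w/2)^2 ... (1 + w/N)^N = a_N^N, which brings in the Weierstrass product. The N-th power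
  demands a_N up to a relative error o(1/N), uniformly on compact sets: one order beyond the leading
  N^w. On and left of the line Re t = -d - 1 the expectation diverges. There the claim concerns the
  explicit product of Gamma quotients, which the identity theorem shows to be the continuation; the
  asymptotics hold for all parameters away from the poles at once.\<close>

definition ip :: "nat \<Rightarrow> (nat \<Rightarrow> real) \<Rightarrow> (nat \<Rightarrow> real) \<Rightarrow> real" where
  "ip n u v = (\<Sum>k<n. u k * v k)"

text \<open>By Gram--Schmidt. The junk value of the quotients for \<open>ip n v v = 0\<close> is harmless, since the whole
  product is then 0.\<close>

function gram_det :: "nat \<Rightarrow> (nat \<Rightarrow> real) list \<Rightarrow> real" where
  "gram_det n [] = 1"
| "gram_det n (v # vs) =
     ip n v v * gram_det n (map (\<lambda>w k. w k - ip n w v / ip n v v * v k) vs)"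
  by pat_completeness auto
termination by (relation "Wellfounded.measure (\<lambda>(n, vs). length vs)") auto

lemma ip_commute: "ip n u v = ip n v u"
  by (simp add: ip_def mult.commute)

lemma ip_diff_left: "ip n (\<lambda>k. u k - a * v k) w = ip n u w - a * ip n v w"
  by (simp add: ip_def algebra_simps sum_subtractf sum_distrib_left)

lemma ip_diff_right: "ip n w (\<lambda>k. u k - a * v k) = ip n w u - a * ip n w v"
  by (simp add: ip_diff_left ip_commute[of n w])

lemma ip_Suc: "ip (Suc n) u v = ip n u v + u n * v n"
  by (simp add: ip_def)

lemma ip_self_nonneg: "ip n v v \<ge> 0"
  by (auto simp: ip_def intro: sum_nonneg)

lemma ip_self_eq_0_iff: "ip n v v = 0 \<longleftrightarrow> (\<forall>k<n. v k = 0)"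
  by (auto simp: ip_def sum_nonneg_eq_0_iff)

lemma gram_det_nonneg: "gram_det n vs \<ge> 0"
  by (induction n vs rule: gram_det.induct) (auto simp: ip_self_nonneg)

text \<open>The recursion sees inner products only: those of the orthogonalised vectors are rational
  expressions in the old ones. The dimensions \<open>n\<close> and \<open>m\<close> may differ,
  which allows the passage from ambient coordinates to coordinates in a chart.\<close>

lemma gram_det_cong:
  assumes "length vs = length ws"
    and "\<And>i j. i < length vs \<Longrightarrow> j < length vs \<Longrightarrow> ip n (vs ! i) (vs ! j) = ip m (ws ! i) (ws ! j)"
  shows "gram_det n vs = gram_det m ws"
  using assms
proof (induction "length vs" arbitrary: vs ws)
  case 0
  then show ?case by simp
next
  case (Suc l)
  obtain v vs' where vs: "vs = v # vs'" using Suc.hyps by (cases vs) auto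
  obtain w ws' where ws: "ws = w # ws'" using Suc.hyps Suc.prems by (cases ws) auto
  have l: "length vs' = l" "length ws' = l" using Suc vs ws by auto
  have vw: "ip n v v = ip m w w" using Suc.prems(2)[of 0 0] vs ws by simp
  have iw: "ip n (vs' ! i) v = ip m (ws' ! i) w" if "i < l" for i
    using Suc.prems(2)[of "Suc i" 0] vs ws l that by simp
  have iw': "ip n v (vs' ! i) = ip m w (ws' ! i)" if "i < l" for i
    using iw[OF that] by (simp add: ip_commute)
  have ij: "ip n (vs' ! i) (vs' ! j) = ip m (ws' ! i) (ws' ! j)" if "i < l" "j < l" for i j
    using Suc.prems(2)[of "Suc i" "Suc j"] vs ws l that by simp
  have "gram_det n (map (\<lambda>w k. w k - ip n w v / ip n v v * v k) vs') =
        gram_det m (map (\<lambda>v k. v k - ip m v w / ip m w w * w k) ws')"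
  proof (rule Suc.hyps(1))
    fix i j assume "i < length (map (\<lambda>w k. w k - ip n w v / ip n v v * v k) vs')"
      "j < length (map (\<lambda>w k. w k - ip n w v / ip n v v * v k) vs')"
    then have "i < l" "j < l" using l by auto
    then show "ip n (map (\<lambda>w k. w k - ip n w v / ip n v v * v k) vs' ! i)
                 (map (\<lambda>w k. w k - ip n w v / ip n v v * v k) vs' ! j) =
               ip m (map (\<lambda>v k. v k - ip m v w / ip m w w * w k) ws' ! i)
                 (map (\<lambda>v k. v k - ip m v w / ip m w w * w k) ws' ! j)"
      by (simp add: l ip_diff_left ip_diff_right iw iw' ij vw del: times_divide_eq_left)
  qed (use l in auto)
  then show ?case by (simp add: vs ws vw)
qed

lemma gram_det_coord_cong:
  assumes "length vs = length ws"
    and "\<And>i k. i < length vs \<Longrightarrow> k < n \<Longrightarrow> (vs ! i) k = (ws ! i) k"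
  shows "gram_det n vs = gram_det n ws"
  by (rule gram_det_cong) (use assms in \<open>auto simp: ip_def intro!: sum.cong\<close>)

text \<open>Orthogonalising against a vector on the last axis erases the last coordinate and keeps
  all others, which leaves a Gram determinant in one dimension less. For \<open>v n = 0\<close> both
  sides vanish.\<close>

lemma gram_det_Suc_axis:
  assumes "\<And>k. k < n \<Longrightarrow> v k = 0"
  shows "gram_det (Suc n) (v # vs) = (v n)\<^sup>2 * gram_det n vs"
proof (cases "v n = 0")
  case True
  then show ?thesis using assms by (simp add: ip_def)
next
  case False
  have v: "ip n w v = 0" for w using assms by (simp add: ip_def)
  have "gram_det (Suc n) (map (\<lambda>w k. w k - ip (Suc n) w v / ip (Suc n) v v * v k) vs) = gram_det n vs"
    by (rule gram_det_cong) (use False assms in \<open>auto simp: ip_Suc v ip_def intro!: sum.cong\<close>)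
  then show ?thesis by (simp add: ip_Suc v power2_eq_square)
qed

text \<open>Products of plane rotations take the place of orthogonal matrices: a product measure is invariant
  under them as soon as its square in the plane is rotation invariant.\<close>

definition givens :: "nat \<Rightarrow> nat \<Rightarrow> real \<Rightarrow> real \<Rightarrow> (nat \<Rightarrow> real) \<Rightarrow> nat \<Rightarrow> real" where
  "givens i j c s v = v(i := c * v i + s * v j, j := c * v j - s * v i)"

inductive_set rots :: "nat \<Rightarrow> ((nat \<Rightarrow> real) \<Rightarrow> nat \<Rightarrow> real) set" for n where
  rots_id: "(\<lambda>v. v) \<in> rots n"
| rots_givens: "\<lbrakk>g \<in> rots n; i < n; j < n; i \<noteq> j; c\<^sup>2 + s\<^sup>2 = 1\<rbrakk> \<Longrightarrow>
     (\<lambda>v. givens i j c s (g v)) \<in> rots n"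

lemma rots_comp: "g \<in> rots n \<Longrightarrow> h \<in> rots n \<Longrightarrow> (\<lambda>v. g (h v)) \<in> rots n"
  by (induction rule: rots.induct) (auto intro: rots.intros)

lemma rots_mono: "g \<in> rots m \<Longrightarrow> m \<le> n \<Longrightarrow> g \<in> rots n"
  by (induction rule: rots.induct) (auto intro: rots.intros)

lemma givens_rots: "i < n \<Longrightarrow> j < n \<Longrightarrow> i \<noteq> j \<Longrightarrow> c\<^sup>2 + s\<^sup>2 = 1 \<Longrightarrow> givens i j c s \<in> rots n"
  using rots_givens[OF rots_id, of i n j c s] by simp

lemma rots_outside: "g \<in> rots n \<Longrightarrow> k \<ge> n \<Longrightarrow> g v k = v k"
  by (induction rule: rots.induct) (auto simp: givens_def)

lemma rots_extensional: "g \<in> rots n \<Longrightarrow> v \<in> extensional {..<n} \<Longrightarrow> g v \<in> extensional {..<n}"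
  by (auto simp: extensional_def rots_outside)

lemma rots_linear: "g \<in> rots n \<Longrightarrow> g (\<lambda>k. a * u k + b * v k) k = a * g u k + b * g v k"
  by (induction arbitrary: k rule: rots.induct) (auto simp: givens_def algebra_simps)

lemma rots_zero: "g \<in> rots n \<Longrightarrow> g (\<lambda>_. 0) k = 0"
  using rots_linear[of g n 0 _ 0 _ k] by simp

lemma rots_cong: "g \<in> rots n \<Longrightarrow> (\<And>k. k < n \<Longrightarrow> u k = v k) \<Longrightarrow> k < n \<Longrightarrow> g u k = g v k"
  by (induction arbitrary: k rule: rots.induct) (auto simp: givens_def)

lemma rots_sum:
  assumes "g \<in> rots n"
  shows "g (\<lambda>k. \<Sum>i\<in>I. a i * u i k) k = (\<Sum>i\<in>I. a i * g (u i) k)"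
proof (cases "finite I")
  case True
  then show ?thesis
  proof (induction I)
    case (insert i I)
    then show ?case using rots_linear[OF assms, of "a i" "u i" 1 "\<lambda>k. \<Sum>i\<in>I. a i * u i k" k]
      by simp
  qed (simp add: rots_zero[OF assms])
qed (simp add: rots_zero[OF assms])

lemma ip_givens:
  assumes "i < n" "j < n" "i \<noteq> j" "c\<^sup>2 + s\<^sup>2 = 1"
  shows "ip n (givens i j c s u) (givens i j c s v) = ip n u v"
proof -
  have A: "ip n u v = u i * v i + u j * v j + (\<Sum>k\<in>{..<n} - {i} - {j}. u k * v k)" for u v
    unfolding ip_def using assms by (simp add: sum.remove[of "{..<n}" i] sum.remove[of "{..<n} - {i}" j])
  have B: "(\<Sum>k\<in>{..<n} - {i} - {j}. givens i j c s u k * givens i j c s v k) =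
      (\<Sum>k\<in>{..<n} - {i} - {j}. u k * v k)"
    by (rule sum.cong) (auto simp: givens_def)
  have "(c * u i + s * u j) * (c * v i + s * v j) + (c * u j - s * u i) * (c * v j - s * v i) =
     (c\<^sup>2 + s\<^sup>2) * (u i * v i + u j * v j)" by algebra
  then show ?thesis unfolding A B using assms(3,4) by (auto simp: givens_def)
qed

lemma rots_ip: "g \<in> rots n \<Longrightarrow> ip n (g u) (g v) = ip n u v"
  by (induction rule: rots.induct) (auto simp: ip_givens)

lemma gram_det_rots: "g \<in> rots n \<Longrightarrow> gram_det n (map g vs) = gram_det n vs"
  by (rule gram_det_cong) (auto simp: rots_ip)

section \<open>Inverses of rotations and normal forms of vector families under rotations\<close>

lemma rots_inverse: "g \<in> rots n \<Longrightarrow> \<exists>h\<in>rots n. (\<forall>v. g (h v) = v) \<and> (\<forall>v. h (g v) = v)"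
proof (induction rule: rots.induct)
  case rots_id
  show ?case using rots.rots_id by fastforce
next
  case (rots_givens g i j c s)
  then obtain h where h: "h \<in> rots n" "\<And>v. g (h v) = v" "\<And>v. h (g v) = v" by auto
  have *: "c * (c * x + s * y) - s * (c * y - s * x) = x"
    "c * (c * y - s * x) + s * (c * x + s * y) = y" for x y
  proof -
    have "c * (c * x + s * y) - s * (c * y - s * x) = (c\<^sup>2 + s\<^sup>2) * x"
      "c * (c * y - s * x) + s * (c * x + s * y) = (c\<^sup>2 + s\<^sup>2) * y" by algebra+
    then show "c * (c * x + s * y) - s * (c * y - s * x) = x"
      "c * (c * y - s * x) + s * (c * x + s * y) = y" using rots_givens.hyps by simp_all
  qed
  have **: "c * (c * x - s * y) + s * (c * y + s * x) = x"
    "c * (c * y + s * x) - s * (c * x - s * y) = y" for x y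
    using *[of x y] *[of y x] by argo+
  show ?case
  proof (intro bexI[of _ "\<lambda>v. h (givens i j c (-s) v)"] conjI allI)
    show "(\<lambda>v. h (givens i j c (-s) v)) \<in> rots n"
      using rots_comp[OF h(1) givens_rots[of i n j c "-s"]] rots_givens by simp
    show "givens i j c s (g (h (givens i j c (- s) v))) = v" for v
      using rots_givens.hyps ** by (auto simp: h givens_def fun_eq_iff)
    show "h (givens i j c (- s) (givens i j c s (g v))) = v" for v
    proof -
      have "givens i j c (- s) (givens i j c s (g v)) = g v"
        using rots_givens.hyps * by (auto simp: givens_def fun_eq_iff)
      then show ?thesis by (simp add: h)
    qed
  qed
qed

text \<open>The coordinates in front of the last are cleared one after the other, each by a rotation
  in the plane that it spans with the last coordinate, where the length is collected.\<close>

lemma rots_to_axis: "\<exists>g\<in>rots (Suc m). \<forall>k<m. g v k = 0"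
proof -
  have "\<exists>g\<in>rots (Suc m). \<forall>k<j. g v k = 0" if "j \<le> m" for j
    using that
  proof (induction j)
    case 0
    show ?case using rots_id by auto
  next
    case (Suc j)
    then obtain g where g: "g \<in> rots (Suc m)" "\<And>k. k < j \<Longrightarrow> g v k = 0" by auto
    define \<rho> where "\<rho> = sqrt ((g v j)\<^sup>2 + (g v m)\<^sup>2)"
    show ?case
    proof (cases "\<rho> = 0")
      case True
      then have "g v j = 0" by (simp add: \<rho>_def sum_power2_eq_zero_iff)
      then show ?thesis using g by (auto simp: less_Suc_eq)
    next
      case False
      \<comment> \<open>This rotation takes the pair (\<open>g v j\<close>, \<open>g v m\<close>) to
        (0, \<rho>).\<close>
      let ?c = "g v m / \<rho>" and ?s = "- g v j / \<rho>"
      have "(g v m)\<^sup>2 + (g v j)\<^sup>2 = \<rho>\<^sup>2" by (simp add: \<rho>_def)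
      then have "?c\<^sup>2 + ?s\<^sup>2 = 1" using False by (simp add: power_divide flip: add_divide_distrib)
      then have "(\<lambda>v. givens j m ?c ?s (g v)) \<in> rots (Suc m)"
        using g Suc by (intro rots_givens) auto
      moreover have "givens j m ?c ?s (g v) k = 0" if "k < Suc j" for k
        using that Suc g by (auto simp: givens_def less_Suc_eq)
      ultimately show ?thesis
        by (intro bexI[of _ "\<lambda>w. givens j m ?c ?s (g w)"]) auto
    qed
  qed
  then show ?thesis by blast
qed

text \<open>A quarter turn in the plane of the coordinates \<open>r\<close> and \<open>m\<close>
  moves a zero from position \<open>r\<close> to the last position.\<close>

lemma rots_swap_last:
  assumes "r \<le> m"
  shows "\<exists>g\<in>rots (Suc m). \<forall>v. (v r = 0 \<longrightarrow> g v m = 0) \<and> (\<forall>k. k \<noteq> r \<longrightarrow> k \<noteq> m \<longrightarrow> g v k = v k)"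
proof (cases "r = m")
  case False
  then show ?thesis using assms
    by (intro bexI[of _ "givens r m 0 1"] givens_rots) (auto simp: givens_def)
qed (use rots_id in auto)

text \<open>One vector is rotated into the last axis. By induction the others are brought into the
  first l coordinates among the remaining ones, and exchanging coordinate l with the last then moves
  the first vector next to them.\<close>

lemma rots_to_initial:
  "length vs \<le> n \<Longrightarrow> \<exists>g\<in>rots n. \<forall>v\<in>set vs. \<forall>k. length vs \<le> k \<longrightarrow> k < n \<longrightarrow> g v k = 0"
proof (induction "length vs" arbitrary: vs n)
  case 0
  then show ?case using rots_id by auto
next
  case (Suc l)
  obtain v vs' where vs: "vs = v # vs'" "length vs' = l" using Suc.hyps by (cases vs) auto
  obtain m where n: "n = Suc m" using Suc by (cases n) auto
  obtain g1 where g1: "g1 \<in> rots n" "\<And>k. k < m \<Longrightarrow> g1 v k = 0"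
    using rots_to_axis[of m v] n by auto
  obtain g2 where g2: "g2 \<in> rots m" "\<And>w k. w \<in> set vs' \<Longrightarrow> l \<le> k \<Longrightarrow> k < m \<Longrightarrow> g2 (g1 w) k = 0"
    using Suc.hyps(1)[of "map g1 vs'" m] Suc vs n by auto
  obtain g3 where g3: "g3 \<in> rots n" "\<And>v. v l = 0 \<Longrightarrow> g3 v m = 0"
      "\<And>v k. k \<noteq> l \<Longrightarrow> k \<noteq> m \<Longrightarrow> g3 v k = v k"
    using rots_swap_last[of l m] Suc n by auto
  have v0: "g2 (g1 v) k = 0" if "k < m" for k
    using rots_cong[OF g2(1), of "g1 v" "\<lambda>_. 0" k] g1(2) that rots_zero[OF g2(1)] by auto
  have "(\<lambda>w. g3 (g2 (g1 w))) \<in> rots n"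
    using rots_comp[OF g3(1) rots_comp[OF rots_mono[OF g2(1), of n] g1(1)]] n by simp
  moreover have "g3 (g2 (g1 w)) k = 0" if w: "w \<in> set vs" and k: "Suc l \<le> k" "k < n" for w k
  proof (cases "k = m")
    case True
    have "g2 (g1 w) l = 0" using w vs v0[of l] g2(2)[of w l] k n True by auto
    then show ?thesis using g3(2) True by simp
  next
    case False
    then have "k < m" using k n by simp
    then have "g2 (g1 w) k = 0" using w vs v0[of k] g2(2)[of w k] k by auto
    then show ?thesis using g3(3) k False by simp
  qed
  ultimately show ?case using Suc.hyps(2) by metis
qed

text \<open>A vanishing Gram determinant means that the vectors span a proper subspace, which a
  suitable rotation carries into the hyperplane orthogonal to the last axis. With the first vector
  on the last axis, the determinant factors, and one of the two factors must vanish.\<close>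

lemma gram_det_eq_0_imp_rot:
  assumes "length vs = Suc m" "gram_det (Suc m) vs = 0"
  shows "\<exists>g\<in>rots (Suc m). \<forall>v\<in>set vs. g v m = 0"
  using assms
proof (induction m arbitrary: vs)
  case 0
  then obtain v where "vs = [v]" by (cases vs) auto
  with 0 show ?case by (intro bexI[OF _ rots_id]) (auto simp: ip_def)
next
  case (Suc l)
  let ?m = "Suc l"
  obtain v vs' where vs: "vs = v # vs'" "length vs' = ?m" using Suc.prems by (cases vs) auto
  obtain g1 where g1: "g1 \<in> rots (Suc ?m)" "\<And>k. k < ?m \<Longrightarrow> g1 v k = 0"
    using rots_to_axis[of ?m v] by auto
  have "0 = gram_det (Suc ?m) (g1 v # map g1 vs')"
    using gram_det_rots[OF g1(1), of vs] Suc.prems(2) vs by simp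
  then have "g1 v ?m = 0 \<or> gram_det ?m (map g1 vs') = 0"
    using gram_det_Suc_axis[of ?m "g1 v" "map g1 vs'"] g1(2) by auto
  then show ?case
  proof
    \<comment> \<open>Here the rotated \<open>v\<close> is zero, and the remaining vectors are fewer
      than the dimension, so they fit into the coordinates in front of the last.\<close>
    assume 0: "g1 v ?m = 0"
    obtain g2 where g2: "g2 \<in> rots (Suc ?m)" "\<And>w. w \<in> set vs' \<Longrightarrow> g2 (g1 w) ?m = 0"
      using rots_to_initial[of "map g1 vs'" "Suc ?m"] vs by auto
    have "g2 (g1 v) ?m = 0"
      using rots_cong[OF g2(1), of "g1 v" "\<lambda>_. 0" ?m] g1(2) 0 rots_zero[OF g2(1)]
      by (auto simp: less_Suc_eq)
    then show ?thesis using rots_comp[OF g2(1) g1(1)] g2(2) vs by auto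
  next
    assume "gram_det ?m (map g1 vs') = 0"
    then obtain g2 where g2: "g2 \<in> rots ?m" "\<And>w. w \<in> set vs' \<Longrightarrow> g2 (g1 w) l = 0"
      using Suc.IH[of "map g1 vs'"] vs by auto
    \<comment> \<open>After \<open>g2\<close> it is coordinate \<open>l\<close> that vanishes for
      all vectors, \<open>g1 v\<close> included since it lies on the last axis; \<open>g3\<close>
      exchanges this coordinate with the last.\<close>
    obtain g3 where g3: "g3 \<in> rots (Suc ?m)" "\<And>v. v l = 0 \<Longrightarrow> g3 v ?m = 0"
      using rots_swap_last[of l ?m] by auto
    have "g2 (g1 v) l = 0"
      using rots_cong[OF g2(1), of "g1 v" "\<lambda>_. 0" l] g1(2) rots_zero[OF g2(1)] by auto
    moreover have "(\<lambda>w. g3 (g2 (g1 w))) \<in> rots (Suc ?m)"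
      using rots_comp[OF g3(1) rots_comp[OF rots_mono[OF g2(1), of "Suc ?m"] g1(1)]] by simp
    ultimately show ?thesis using g2(2) g3(2) vs by (intro bexI[of _ "\<lambda>w. g3 (g2 (g1 w))"]) auto
  qed
qed

section \<open>Rotation invariant product measures\<close>

abbreviation borel_vec :: "nat \<Rightarrow> (nat \<Rightarrow> real) measure" where
  "borel_vec n \<equiv> PiM {..<n} (\<lambda>_. borel)"

lemma space_borel_vec: "space (borel_vec n) = extensional {..<n}"
  by (auto simp: space_PiM PiE_def)

lemma measurable_vecI:
  assumes "\<And>k. k < n \<Longrightarrow> (\<lambda>x. f x k) \<in> borel_measurable M"
    and "\<And>x. x \<in> space M \<Longrightarrow> f x \<in> extensional {..<n}"
  shows "f \<in> M \<rightarrow>\<^sub>M borel_vec n"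
proof -
  have "(\<lambda>x. \<lambda>k\<in>{..<n}. f x k) \<in> M \<rightarrow>\<^sub>M borel_vec n"
    using assms(1) by (intro measurable_restrict) auto
  moreover have "(\<lambda>k\<in>{..<n}. f x k) = f x" if "x \<in> space M" for x
    using assms(2)[OF that] by (auto simp: extensional_def)
  ultimately show ?thesis by (subst measurable_cong[where g="\<lambda>x. \<lambda>k\<in>{..<n}. f x k"]) auto
qed

lemma measurable_coord: "k < n \<Longrightarrow> (\<lambda>x. x k) \<in> borel_measurable (borel_vec n)"
  by (rule measurable_component_singleton) auto

lemma givens_measurable:
  assumes "i < n" "j < n"
  shows "givens i j c s \<in> borel_vec n \<rightarrow>\<^sub>M borel_vec n"
proof (rule measurable_vecI)
  note [measurable] = measurable_coord[OF assms(1)] measurable_coord[OF assms(2)]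
  fix k assume "k < n"
  note [measurable] = measurable_coord[OF this]
  show "(\<lambda>x. givens i j c s x k) \<in> borel_measurable (borel_vec n)"
    unfolding givens_def fun_upd_def by measurable
qed (use assms in \<open>auto simp: space_borel_vec extensional_def givens_def\<close>)

lemma rots_measurable: "g \<in> rots n \<Longrightarrow> g \<in> borel_vec n \<rightarrow>\<^sub>M borel_vec n"
proof (induction rule: rots.induct)
  case (rots_givens g i j c s)
  then show ?case using measurable_compose[OF rots_givens.IH givens_measurable] by blast
qed simp

lemma measurable_vec_upd [measurable (raw)]:
  "f \<in> N \<rightarrow>\<^sub>M borel_vec n \<Longrightarrow> g \<in> borel_measurable N \<Longrightarrow> (\<lambda>x. (f x)(n := g x)) \<in> N \<rightarrow>\<^sub>M borel_vec (Suc n)"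
  by (rule measurable_fun_upd[where J="{..<n}"]) auto

lemma measurable_vec_comb:
  assumes [measurable]: "f \<in> N \<rightarrow>\<^sub>M borel_vec n" "g \<in> N \<rightarrow>\<^sub>M borel_vec n"
  shows "(\<lambda>x. \<lambda>k\<in>{..<n}. a * f x k + b * g x k) \<in> N \<rightarrow>\<^sub>M borel_vec n"
proof (rule measurable_restrict)
  fix k assume "k \<in> {..<n}"
  then have k: "(\<lambda>x. x k) \<in> borel_measurable (borel_vec n)" by (intro measurable_coord) auto
  note [measurable] = measurable_compose[OF assms(1) k] measurable_compose[OF assms(2) k]
  show "(\<lambda>x. a * f x k + b * g x k) \<in> borel_measurable N" by measurable
qed

lemma gram_det_measurable:
  assumes "\<And>v k. v \<in> set vs \<Longrightarrow> k < n \<Longrightarrow> (\<lambda>x. v x k) \<in> borel_measurable M"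
  shows "(\<lambda>x. gram_det n (map (\<lambda>v. v x) vs)) \<in> borel_measurable M"
  using assms
proof (induction "length vs" arbitrary: vs)
  case (Suc l)
  obtain v vs' where vs: "vs = v # vs'" "length vs' = l" using Suc.hyps by (cases vs) auto
  have v: "(\<lambda>x. ip n (w x) (u x)) \<in> borel_measurable M" if "w \<in> set vs" "u \<in> set vs" for w u
    unfolding ip_def using Suc.prems that by (intro borel_measurable_sum borel_measurable_times) auto
  let ?ws = "map (\<lambda>w x k. w x k - ip n (w x) (v x) / ip n (v x) (v x) * v x k) vs'"
  have "(\<lambda>x. gram_det n (map (\<lambda>v. v x) ?ws)) \<in> borel_measurable M"
  proof (rule Suc.hyps(1))
    fix u k assume "u \<in> set ?ws" "k < n"
    then obtain w where w: "w \<in> set vs'" "u = (\<lambda>x k. w x k - ip n (w x) (v x) / ip n (v x) (v x) * v x k)"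
      by auto
    then have "w \<in> set vs" "v \<in> set vs" using vs by auto
    note [measurable] = Suc.prems[OF this(1) \<open>k < n\<close>] Suc.prems[OF this(2) \<open>k < n\<close>] v[OF this] v[OF this(2,2)]
    show "(\<lambda>x. u x k) \<in> borel_measurable M" unfolding w(2) by measurable
  qed (use vs in auto)
  then have "(\<lambda>x. ip n (v x) (v x) * gram_det n (map (\<lambda>v. v x) ?ws)) \<in> borel_measurable M"
    using v[of v v] vs by (intro borel_measurable_times) auto
  then show ?case by (simp add: vs comp_def)
qed simp

text \<open>Covers Lebesgue measure, where it is used for volumes, and the standard normal law,
  where it is used for the distribution of the Gram determinant. Iterated integrals are the form in
  which invariance applies once two coordinates have been split off by Fubini.\<close>

locale rotation_invariant = sigma_finite_measure \<mu> for \<mu> :: "real measure" +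
  assumes sets_mu [measurable_cong, simp]: "sets \<mu> = sets borel"
    and rotate2: "\<And>F c s. F \<in> borel_measurable (borel \<Otimes>\<^sub>M borel) \<Longrightarrow> c\<^sup>2 + s\<^sup>2 = 1 \<Longrightarrow>
      (\<integral>\<^sup>+x. \<integral>\<^sup>+y. F (c * x + s * y, c * y - s * x) \<partial>\<mu> \<partial>\<mu>) = (\<integral>\<^sup>+x. \<integral>\<^sup>+y. F (x, y) \<partial>\<mu> \<partial>\<mu>)"
begin

abbreviation vec :: "nat \<Rightarrow> (nat \<Rightarrow> real) measure" where
  "vec n \<equiv> PiM {..<n} (\<lambda>_. \<mu>)"

sublocale P: product_sigma_finite "\<lambda>_::nat. \<mu>" ..

lemma sets_vec [measurable_cong]: "sets (vec n) = sets (borel_vec n)"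
  by (rule sets_PiM_cong) auto

lemma space_vec: "space (vec n) = extensional {..<n}"
  using sets_eq_imp_space_eq[OF sets_vec] by (simp add: space_borel_vec)

lemma sigma_finite_vec: "sigma_finite_measure (vec n)"
  by (rule P.sigma_finite) auto

lemma vec_Suc:
  assumes "f \<in> borel_measurable (borel_vec (Suc n))"
  shows "(\<integral>\<^sup>+x. f x \<partial>vec (Suc n)) = (\<integral>\<^sup>+x. \<integral>\<^sup>+y. f (x(n := y)) \<partial>\<mu> \<partial>vec n)"
    and "(\<integral>\<^sup>+x. f x \<partial>vec (Suc n)) = (\<integral>\<^sup>+y. \<integral>\<^sup>+x. f (x(n := y)) \<partial>vec n \<partial>\<mu>)"
proof -
  have "f \<in> borel_measurable (vec (Suc n))" using assms by (simp cong: measurable_cong_sets add: sets_vec)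
  then have f: "f \<in> borel_measurable (PiM (insert n {..<n}) (\<lambda>_. \<mu>))" by (simp add: lessThan_Suc)
  show "(\<integral>\<^sup>+x. f x \<partial>vec (Suc n)) = (\<integral>\<^sup>+x. \<integral>\<^sup>+y. f (x(n := y)) \<partial>\<mu> \<partial>vec n)"
    unfolding lessThan_Suc by (rule P.product_nn_integral_insert) (use f in auto)
  show "(\<integral>\<^sup>+x. f x \<partial>vec (Suc n)) = (\<integral>\<^sup>+y. \<integral>\<^sup>+x. f (x(n := y)) \<partial>vec n \<partial>\<mu>)"
    unfolding lessThan_Suc by (rule P.product_nn_integral_insert_rev) (use f in auto)
qed

text \<open>With the coordinates \<open>i\<close> and \<open>j\<close> integrated innermost, the
  claim is the invariance in the plane for each fixed choice of the other coordinates.\<close>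

lemma nn_integral_givens:
  assumes f: "f \<in> borel_measurable (borel_vec n)" and ij: "i < n" "j < n" "i \<noteq> j" "c\<^sup>2 + s\<^sup>2 = 1"
  shows "(\<integral>\<^sup>+x. f (givens i j c s x) \<partial>vec n) = (\<integral>\<^sup>+x. f x \<partial>vec n)"
proof -
  define I where "I = {..<n} - {i, j}"
  have I: "{..<n} = insert j (insert i I)" "i \<notin> I" "j \<notin> insert i I" "finite I" "finite (insert i I)"
    using ij by (auto simp: I_def)
  have *: "(\<integral>\<^sup>+x. h x \<partial>vec n) = (\<integral>\<^sup>+x. \<integral>\<^sup>+a. \<integral>\<^sup>+b. h (x(i := a, j := b)) \<partial>\<mu> \<partial>\<mu> \<partial>PiM I (\<lambda>_. \<mu>))"
    if "h \<in> borel_measurable (borel_vec n)" for h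
  proof -
    have h[measurable]: "h \<in> borel_measurable (PiM (insert j (insert i I)) (\<lambda>_. \<mu>))"
      using that unfolding I(1)[symmetric] by (simp cong: measurable_cong_sets add: sets_vec)
    interpret sigma_finite_measure "PiM (insert i I) (\<lambda>_. \<mu>)"
      by (rule P.sigma_finite) (use I in auto)
    have "(\<integral>\<^sup>+x. h x \<partial>vec n) = (\<integral>\<^sup>+x. \<integral>\<^sup>+b. h (x(j := b)) \<partial>\<mu> \<partial>PiM (insert i I) (\<lambda>_. \<mu>))"
      unfolding I(1) by (rule P.product_nn_integral_insert) (use I h in auto)
    also have "\<dots> = (\<integral>\<^sup>+x. \<integral>\<^sup>+a. \<integral>\<^sup>+b. h (x(i := a, j := b)) \<partial>\<mu> \<partial>\<mu> \<partial>PiM I (\<lambda>_. \<mu>))"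
      by (subst P.product_nn_integral_insert) (use I in \<open>auto intro!: borel_measurable_nn_integral\<close>)
    finally show ?thesis .
  qed
  have fg: "(\<lambda>x. f (givens i j c s x)) \<in> borel_measurable (borel_vec n)"
    using measurable_compose[OF givens_measurable f] ij by auto
  show ?thesis unfolding *[OF f] *[OF fg]
  proof (rule nn_integral_cong)
    fix x assume x: "x \<in> space (PiM I (\<lambda>_. \<mu>))"
    have upd: "(\<lambda>(a, b). x(i := a, j := b)) \<in> borel \<Otimes>\<^sub>M borel \<rightarrow>\<^sub>M borel_vec n"
    proof (rule measurable_vecI)
      show "(case p of (a, b) \<Rightarrow> x(i := a, j := b)) \<in> extensional {..<n}" for p
        using x I by (auto simp: space_PiM PiE_def extensional_def split: prod.splits)
      show "(\<lambda>p. (case p of (a, b) \<Rightarrow> x(i := a, j := b)) k) \<in> borel_measurable (borel \<Otimes>\<^sub>M borel)" for k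
        unfolding fun_upd_def split_beta by measurable
    qed
    have "(\<lambda>p. f (case p of (a, b) \<Rightarrow> x(i := a, j := b))) \<in> borel_measurable (borel \<Otimes>\<^sub>M borel)"
      by (rule measurable_compose[OF upd f])
    from rotate2[OF this ij(4)]
    show "(\<integral>\<^sup>+a. \<integral>\<^sup>+b. f (givens i j c s (x(i := a, j := b))) \<partial>\<mu> \<partial>\<mu>) =
        (\<integral>\<^sup>+a. \<integral>\<^sup>+b. f (x(i := a, j := b)) \<partial>\<mu> \<partial>\<mu>)"
      using ij by (simp add: givens_def fun_upd_twist)
  qed
qed

lemma nn_integral_rots:
  "g \<in> rots n \<Longrightarrow> f \<in> borel_measurable (borel_vec n) \<Longrightarrow>
    (\<integral>\<^sup>+x. f (g x) \<partial>vec n) = (\<integral>\<^sup>+x. f x \<partial>vec n)"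
proof (induction arbitrary: f rule: rots.induct)
  case (rots_givens g i j c s)
  have "(\<lambda>x. f (givens i j c s x)) \<in> borel_measurable (borel_vec n)"
    using measurable_compose[OF givens_measurable rots_givens.prems] rots_givens by auto
  from rots_givens.IH[OF this] show ?case
    using nn_integral_givens[OF rots_givens.prems] rots_givens.hyps by simp
qed simp

text \<open>Whereas the maps in \<open>rots\<close> mix the coordinates of one vector, here two
  independent vectors are rotated into each other: the same plane rotation acts on each pair
  (\<open>x k\<close>, \<open>y k\<close>). The induction treats one such pair at a time.\<close>

lemma nn_integral_rotate_pair:
  assumes "F \<in> borel_measurable (borel_vec n \<Otimes>\<^sub>M borel_vec n)" "c\<^sup>2 + s\<^sup>2 = 1"
  shows "(\<integral>\<^sup>+x. \<integral>\<^sup>+y. F (\<lambda>k\<in>{..<n}. c * x k + s * y k, \<lambda>k\<in>{..<n}. c * y k - s * x k) \<partial>vec n \<partial>vec n) =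
    (\<integral>\<^sup>+x. \<integral>\<^sup>+y. F (x, y) \<partial>vec n \<partial>vec n)"
  using assms(1)
proof (induction n arbitrary: F)
  case 0
  show ?case by (intro nn_integral_cong) (auto simp: space_PiM)
next
  case (Suc n)
  note nn_meas = borel_measurable_nn_integral
  note F[measurable] = Suc.prems
  have coord[measurable]: "(\<lambda>x. x k) \<in> borel_measurable (borel_vec n)" if "k < n" for k
    by (rule measurable_coord[OF that])
  interpret V: sigma_finite_measure "vec n" by (rule sigma_finite_vec)
  interpret V': sigma_finite_measure "vec (Suc n)" by (rule sigma_finite_vec)
  \<comment> \<open>Brings the last coordinates of both vectors next to each other in the innermost
    integrals, where \<open>rotate2\<close> applies. This requires exchanging the last coordinate
    \<open>a\<close> of the first vector with the initial part \<open>y\<close> of the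
    second.\<close>
  have *: "(\<integral>\<^sup>+x. \<integral>\<^sup>+y. H x y \<partial>vec (Suc n) \<partial>vec (Suc n)) =
      (\<integral>\<^sup>+x. \<integral>\<^sup>+y. \<integral>\<^sup>+a. \<integral>\<^sup>+b. H (x(n := a)) (y(n := b)) \<partial>\<mu> \<partial>\<mu> \<partial>vec n \<partial>vec n)"
    if H[measurable]: "case_prod H \<in> borel_measurable (borel_vec (Suc n) \<Otimes>\<^sub>M borel_vec (Suc n))" for H
  proof -
    have "(\<integral>\<^sup>+x. \<integral>\<^sup>+y. H x y \<partial>vec (Suc n) \<partial>vec (Suc n)) =
      (\<integral>\<^sup>+x. \<integral>\<^sup>+a. \<integral>\<^sup>+y. H (x(n := a)) y \<partial>vec (Suc n) \<partial>\<mu> \<partial>vec n)"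
      by (subst vec_Suc(1)) auto
    also have "\<dots> = (\<integral>\<^sup>+x. \<integral>\<^sup>+a. \<integral>\<^sup>+y. \<integral>\<^sup>+b. H (x(n := a)) (y(n := b)) \<partial>\<mu> \<partial>vec n \<partial>\<mu> \<partial>vec n)"
    proof (intro nn_integral_cong vec_Suc(1))
      fix x a assume "x \<in> space (vec n)"
      then have "x(n := a) \<in> space (borel_vec (Suc n))"
        by (auto simp: space_vec space_borel_vec extensional_def)
      from measurable_compose[OF measurable_Pair1'[OF this] H]
      show "H (x(n := a)) \<in> borel_measurable (borel_vec (Suc n))" by (simp add: comp_def)
    qed
    also have "\<dots> = (\<integral>\<^sup>+x. \<integral>\<^sup>+y. \<integral>\<^sup>+a. \<integral>\<^sup>+b. H (x(n := a)) (y(n := b)) \<partial>\<mu> \<partial>\<mu> \<partial>vec n \<partial>vec n)"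
    proof (rule nn_integral_cong)
      fix x assume x: "x \<in> space (vec n)"
      interpret pair_sigma_finite \<mu> "vec n" ..
      define K where "K p b = H (x(n := fst p)) ((snd p)(n := b))" for p b
      have K: "case_prod K \<in> borel_measurable ((\<mu> \<Otimes>\<^sub>M vec n) \<Otimes>\<^sub>M \<mu>)"
      proof -
        have "x \<in> space (borel_vec n)" using x by (simp add: space_vec space_borel_vec)
        then have [measurable]: "(\<lambda>_. x) \<in> (borel \<Otimes>\<^sub>M borel_vec n) \<Otimes>\<^sub>M borel \<rightarrow>\<^sub>M borel_vec n" by simp
        have eq: "sets ((\<mu> \<Otimes>\<^sub>M vec n) \<Otimes>\<^sub>M \<mu>) = sets ((borel \<Otimes>\<^sub>M borel_vec n) \<Otimes>\<^sub>M borel)"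
          by (intro sets_pair_measure_cong sets_vec sets_mu)
        have "(\<lambda>p. (x(n := fst (fst p)), (snd (fst p))(n := snd p))) \<in>
          (borel \<Otimes>\<^sub>M borel_vec n) \<Otimes>\<^sub>M borel \<rightarrow>\<^sub>M borel_vec (Suc n) \<Otimes>\<^sub>M borel_vec (Suc n)"
          by (intro measurable_Pair measurable_vec_upd) measurable
        from measurable_compose[OF this H]
        have "(\<lambda>p. case_prod H (x(n := fst (fst p)), (snd (fst p))(n := snd p))) \<in> borel_measurable ((\<mu> \<Otimes>\<^sub>M vec n) \<Otimes>\<^sub>M \<mu>)"
          by (rule equalityD2[OF measurable_cong_sets[OF eq refl], THEN subsetD])
        also have "(\<lambda>p. case_prod H (x(n := fst (fst p)), (snd (fst p))(n := snd p))) =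
            case_prod K"
          by (rule ext) (auto simp: K_def split: prod.split)
        finally show ?thesis .
      qed
      show "(\<integral>\<^sup>+a. \<integral>\<^sup>+y. \<integral>\<^sup>+b. H (x(n := a)) (y(n := b)) \<partial>\<mu> \<partial>vec n \<partial>\<mu>) =
        (\<integral>\<^sup>+y. \<integral>\<^sup>+a. \<integral>\<^sup>+b. H (x(n := a)) (y(n := b)) \<partial>\<mu> \<partial>\<mu> \<partial>vec n)"
        using nn_meas[OF K] Fubini'[of "\<lambda>a y. \<integral>\<^sup>+b. K (a, y) b \<partial>\<mu>"]
        by (simp add: K_def case_prod_unfold)
    qed
    finally show ?thesis .
  qed
  define R where "R n = (\<lambda>(x, y). (\<lambda>k\<in>{..<n}. c * x k + s * y k, \<lambda>k\<in>{..<n}. c * y k - s * x k))"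
    for n :: nat and x y :: "nat \<Rightarrow> real"
  have R[measurable]: "R n \<in> borel_vec n \<Otimes>\<^sub>M borel_vec n \<rightarrow>\<^sub>M borel_vec n \<Otimes>\<^sub>M borel_vec n" for n
  proof -
    have "(\<lambda>p. (\<lambda>k\<in>{..<n}. c * fst p k + s * snd p k, \<lambda>k\<in>{..<n}. c * snd p k + (- s) * fst p k)) \<in>
       borel_vec n \<Otimes>\<^sub>M borel_vec n \<rightarrow>\<^sub>M borel_vec n \<Otimes>\<^sub>M borel_vec n"
      by (intro measurable_Pair measurable_vec_comb) measurable
    then show ?thesis by (simp add: R_def case_prod_unfold)
  qed
  \<comment> \<open>The integral over the last pair of coordinates; the induction hypothesis is
    applied to it as a function of the initial parts.\<close>
  define G where "G = (\<lambda>(u, w). \<integral>\<^sup>+a. \<integral>\<^sup>+b. F (u(n := a), w(n := b)) \<partial>\<mu> \<partial>\<mu>)"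
  have G: "G \<in> borel_measurable (borel_vec n \<Otimes>\<^sub>M borel_vec n)"
    unfolding G_def by measurable
  have "(\<integral>\<^sup>+x. \<integral>\<^sup>+y. F (R (Suc n) (x, y)) \<partial>vec (Suc n) \<partial>vec (Suc n)) =
     (\<integral>\<^sup>+x. \<integral>\<^sup>+y. \<integral>\<^sup>+a. \<integral>\<^sup>+b. F (R (Suc n) (x(n := a), y(n := b))) \<partial>\<mu> \<partial>\<mu> \<partial>vec n \<partial>vec n)"
    by (rule *) measurable
  also have "\<dots> = (\<integral>\<^sup>+x. \<integral>\<^sup>+y. G (R n (x, y)) \<partial>vec n \<partial>vec n)"
  proof (intro nn_integral_cong)
    fix x y assume xy: "x \<in> space (vec n)" "y \<in> space (vec n)"
    define u where "u = (\<lambda>k\<in>{..<n}. c * x k + s * y k)"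
    define w where "w = (\<lambda>k\<in>{..<n}. c * y k - s * x k)"
    have uw: "R n (x, y) = (u, w)" by (simp add: R_def u_def w_def)
    have sp: "u \<in> space (borel_vec n)" "w \<in> space (borel_vec n)"
      by (auto simp: u_def w_def space_borel_vec)
    then have [measurable]: "(\<lambda>_. u) \<in> borel \<Otimes>\<^sub>M borel \<rightarrow>\<^sub>M borel_vec n" "(\<lambda>_. w) \<in> borel \<Otimes>\<^sub>M borel \<rightarrow>\<^sub>M borel_vec n"
      by simp_all
    have "R (Suc n) (x(n := a), y(n := b)) = (u(n := c * a + s * b), w(n := c * b - s * a))" for a b
      by (auto simp: R_def u_def w_def fun_eq_iff)
    then have "(\<integral>\<^sup>+a. \<integral>\<^sup>+b. F (R (Suc n) (x(n := a), y(n := b))) \<partial>\<mu> \<partial>\<mu>) =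
      (\<integral>\<^sup>+a. \<integral>\<^sup>+b. F (u(n := c * a + s * b), w(n := c * b - s * a)) \<partial>\<mu> \<partial>\<mu>)" by simp
    also have "\<dots> = G (R n (x, y))"
      using rotate2[of "\<lambda>p. F (u(n := fst p), w(n := snd p))" c s] assms(2)
      by (simp add: G_def uw)
    finally show "(\<integral>\<^sup>+a. \<integral>\<^sup>+b. F (R (Suc n) (x(n := a), y(n := b))) \<partial>\<mu> \<partial>\<mu>) = G (R n (x, y))" .
  qed
  also have "\<dots> = (\<integral>\<^sup>+x. \<integral>\<^sup>+y. G (x, y) \<partial>vec n \<partial>vec n)"
    unfolding R_def prod.case by (rule Suc.IH[OF G])
  also have "\<dots> = (\<integral>\<^sup>+x. \<integral>\<^sup>+y. F (x, y) \<partial>vec (Suc n) \<partial>vec (Suc n))"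
    by (subst *) (simp_all add: G_def)
  finally show ?case unfolding R_def prod.case .
qed

end

section \<open>Rotation invariance of Lebesgue measure and of the standard normal law\<close>

lemma rotation_invariant_lborel: "rotation_invariant lborel"
proof (unfold_locales)
  fix F :: "real \<times> real \<Rightarrow> ennreal" and c s :: real
  assume F[measurable]: "F \<in> borel_measurable (borel \<Otimes>\<^sub>M borel)" and cs: "c\<^sup>2 + s\<^sup>2 = 1"
  show "(\<integral>\<^sup>+x. \<integral>\<^sup>+y. F (c * x + s * y, c * y - s * x) \<partial>lborel \<partial>lborel) = (\<integral>\<^sup>+x. \<integral>\<^sup>+y. F (x, y) \<partial>lborel \<partial>lborel)"
  proof (cases "c = 0")
    case True
    \<comment> \<open>A quarter turn: exchange of the two variables together with
      reflections.\<close>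
    then have s: "s \<noteq> 0" "\<bar>s\<bar> = 1" using cs by (auto simp: power2_eq_1_iff)
    have "(\<integral>\<^sup>+x. \<integral>\<^sup>+y. F (x, y) \<partial>lborel \<partial>lborel) = (\<integral>\<^sup>+y. \<integral>\<^sup>+x. F (x, y) \<partial>lborel \<partial>lborel)"
      by (rule lborel_pair.Fubini') simp
    also have "\<dots> = (\<integral>\<^sup>+y. \<integral>\<^sup>+x. F (s * x, y) \<partial>lborel \<partial>lborel)"
      by (subst nn_integral_real_affine[OF _ s(1), where t=0]) (use s in simp_all)
    also have "\<dots> = (\<integral>\<^sup>+y. \<integral>\<^sup>+x. F (s * x, - s * y) \<partial>lborel \<partial>lborel)"
      by (subst nn_integral_real_affine[of _ "-s" 0]) (use s in simp_all)
    finally show ?thesis using True by simp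
  next
    case False
    \<comment> \<open>For c \<noteq> 0 the rotation is composed of two affine substitutions in a
      single variable each, first in y with factor 1 / |c|, then in x with factor |c|.\<close>
    have "(\<integral>\<^sup>+x. \<integral>\<^sup>+y. F (x, y) \<partial>lborel \<partial>lborel) =
       (\<integral>\<^sup>+x. \<bar>1/c\<bar> * (\<integral>\<^sup>+y. F (x, - s * x / c + 1 / c * y) \<partial>lborel) \<partial>lborel)"
      by (rule nn_integral_cong, rule nn_integral_real_affine) (use False in simp_all)
    also have "\<dots> = \<bar>1/c\<bar> * (\<integral>\<^sup>+x. \<integral>\<^sup>+y. F (x, - s * x / c + 1 / c * y) \<partial>lborel \<partial>lborel)"
      by (rule nn_integral_cmult) simp
    also have "(\<integral>\<^sup>+x. \<integral>\<^sup>+y. F (x, - s * x / c + 1 / c * y) \<partial>lborel \<partial>lborel) =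
        (\<integral>\<^sup>+y. \<integral>\<^sup>+x. F (x, - s * x / c + 1 / c * y) \<partial>lborel \<partial>lborel)"
      by (rule lborel_pair.Fubini') simp
    also have "\<dots> = (\<integral>\<^sup>+y. \<bar>c\<bar> * (\<integral>\<^sup>+x. F (s * y + c * x, - s * (s * y + c * x) / c + 1 / c * y) \<partial>lborel) \<partial>lborel)"
      by (rule nn_integral_cong, rule nn_integral_real_affine) (use False in simp_all)
    also have "\<dots> = \<bar>c\<bar> * (\<integral>\<^sup>+y. \<integral>\<^sup>+x. F (s * y + c * x, - s * (s * y + c * x) / c + 1 / c * y) \<partial>lborel \<partial>lborel)"
      by (rule nn_integral_cmult) simp
    also have "(\<integral>\<^sup>+y. \<integral>\<^sup>+x. F (s * y + c * x, - s * (s * y + c * x) / c + 1 / c * y) \<partial>lborel \<partial>lborel) =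
       (\<integral>\<^sup>+x. \<integral>\<^sup>+y. F (s * y + c * x, - s * (s * y + c * x) / c + 1 / c * y) \<partial>lborel \<partial>lborel)"
      by (rule lborel_pair.Fubini') simp
    also have "\<dots> = (\<integral>\<^sup>+x. \<integral>\<^sup>+y. F (c * x + s * y, c * y - s * x) \<partial>lborel \<partial>lborel)"
    proof -
      have "- s * (s * y + c * x) / c + 1 / c * y = c * y - s * x" for x y
      proof -
        have "- s * (s * y + c * x) + y = (1 - s\<^sup>2) * y - s * c * x" by algebra
        also have "1 - s\<^sup>2 = c\<^sup>2" using cs by simp
        finally have "- s * (s * y + c * x) + y = c * (c * y - s * x)" by algebra
        then have "(- s * (s * y + c * x) + y) / c = c * y - s * x" using False by simp
        then show ?thesis by (simp add: add_divide_distrib diff_divide_distrib)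
      qed
      then show ?thesis by (intro nn_integral_cong) (simp add: add.commute)
    qed
    finally show ?thesis using False
      by (simp add: mult.assoc[symmetric] flip: ennreal_mult)
  qed
qed auto

text \<open>The joint density depends on x^2 + y^2 only, so the invariance of Lebesgue measure
  applies to the density times \<open>F\<close>.\<close>

lemma rotation_invariant_std_normal: "rotation_invariant std_normal_distribution"
proof -
  interpret prob_space std_normal_distribution by (rule prob_space_normal_density) simp
  interpret L: rotation_invariant lborel by (rule rotation_invariant_lborel)
  show ?thesis
  proof unfold_locales
    fix F :: "real \<times> real \<Rightarrow> ennreal" and c s :: real
    assume F[measurable]: "F \<in> borel_measurable (borel \<Otimes>\<^sub>M borel)" and cs: "c\<^sup>2 + s\<^sup>2 = 1"
    have *: "(\<integral>\<^sup>+x. \<integral>\<^sup>+y. H (x, y) \<partial>std_normal_distribution \<partial>std_normal_distribution) =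
       (\<integral>\<^sup>+x. \<integral>\<^sup>+y. ennreal (exp (- (x\<^sup>2 + y\<^sup>2) / 2) / (2 * pi)) * H (x, y) \<partial>lborel \<partial>lborel)"
      if [measurable]: "H \<in> borel_measurable (borel \<Otimes>\<^sub>M borel)" for H
    proof -
      have "(\<integral>\<^sup>+x. \<integral>\<^sup>+y. H (x, y) \<partial>std_normal_distribution \<partial>std_normal_distribution) =
         (\<integral>\<^sup>+x. ennreal (std_normal_density x) * (\<integral>\<^sup>+y. ennreal (std_normal_density y) * H (x, y) \<partial>lborel) \<partial>lborel)"
        by (subst nn_integral_density, measurable)+
      also have "\<dots> = (\<integral>\<^sup>+x. \<integral>\<^sup>+y. ennreal (std_normal_density x) * (ennreal (std_normal_density y) * H (x, y)) \<partial>lborel \<partial>lborel)"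
        by (subst nn_integral_cmult) simp_all
      also have "\<dots> = (\<integral>\<^sup>+x. \<integral>\<^sup>+y. ennreal (exp (- (x\<^sup>2 + y\<^sup>2) / 2) / (2 * pi)) * H (x, y) \<partial>lborel \<partial>lborel)"
      proof (intro nn_integral_cong)
        fix x y :: real
        have "std_normal_density x * std_normal_density y = exp (- x\<^sup>2 / 2 + - y\<^sup>2 / 2) / (sqrt (2 * pi))\<^sup>2"
          unfolding std_normal_density_def exp_add by (simp add: power2_eq_square)
        also have "- x\<^sup>2 / 2 + - y\<^sup>2 / 2 = - (x\<^sup>2 + y\<^sup>2) / 2" by (simp add: field_simps)
        finally show "ennreal (std_normal_density x) * (ennreal (std_normal_density y) * H (x, y)) =
          ennreal (exp (- (x\<^sup>2 + y\<^sup>2) / 2) / (2 * pi)) * H (x, y)"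
          by (simp add: mult.assoc[symmetric] flip: ennreal_mult)
      qed
      finally show ?thesis .
    qed
    have q: "(c * x + s * y)\<^sup>2 + (c * y - s * x)\<^sup>2 = x\<^sup>2 + y\<^sup>2" for x y
    proof -
      have "(c * x + s * y)\<^sup>2 + (c * y - s * x)\<^sup>2 = (c\<^sup>2 + s\<^sup>2) * (x\<^sup>2 + y\<^sup>2)" by algebra
      then show ?thesis using cs by simp
    qed
    show "(\<integral>\<^sup>+x. \<integral>\<^sup>+y. F (c * x + s * y, c * y - s * x) \<partial>std_normal_distribution \<partial>std_normal_distribution) =
       (\<integral>\<^sup>+x. \<integral>\<^sup>+y. F (x, y) \<partial>std_normal_distribution \<partial>std_normal_distribution)"
      using L.rotate2[of "\<lambda>p. ennreal (exp (- ((fst p)\<^sup>2 + (snd p)\<^sup>2) / 2) / (2 * pi)) * F p", OF _ cs]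
        *[of "\<lambda>p. F (c * fst p + s * snd p, c * snd p - s * fst p)"] *[of F]
      by (simp add: q)
  qed auto
qed

section \<open>Volumes of simplices\<close>

interpretation L: rotation_invariant lborel
  by (rule rotation_invariant_lborel)

text \<open>The list starts with the vector of highest index, so that in \<open>v # vs\<close> the vectors of \<open>vs\<close> keep
  their indices.\<close>

fun comb :: "(nat \<Rightarrow> real) list \<Rightarrow> (nat \<Rightarrow> real) \<Rightarrow> nat \<Rightarrow> real" where
  "comb [] c k = 0"
| "comb (v # vs) c k = c (length vs) * v k + comb vs c k"

text \<open>The linear map whose matrix has the columns \<open>vs\<close>, restricted to the first
  \<open>n\<close> coordinates so that its values are points of the carrier.\<close>

definition lin :: "nat \<Rightarrow> (nat \<Rightarrow> real) list \<Rightarrow> (nat \<Rightarrow> real) \<Rightarrow> nat \<Rightarrow> real" where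
  "lin n vs c = (\<lambda>k\<in>{..<n}. comb vs c k)"

lemma comb_map_rev: "comb (map V (rev [0..<r])) c k = (\<Sum>i<r. c i * V i k)"
  by (induction r) auto

lemma comb_cong: "(\<And>i. i < length vs \<Longrightarrow> c i = c' i) \<Longrightarrow> comb vs c k = comb vs c' k"
  by (induction vs) auto

lemma rots_comb:
  assumes "g \<in> rots n"
  shows "g (comb vs c) k = comb (map g vs) c k"
proof (induction vs arbitrary: k)
  case Nil
  then show ?case using rots_zero[OF assms] by (simp add: fun_eq_iff[symmetric, of "comb [] c"] cong: if_cong)
next
  case (Cons v vs)
  have "comb (v # vs) c = (\<lambda>k. c (length vs) * v k + 1 * comb vs c k)" by auto
  then show ?case using rots_linear[OF assms, of "c (length vs)" v 1 "comb vs c" k] Cons by simp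
qed

lemma comb_measurable:
  "length vs \<le> m \<Longrightarrow> (\<lambda>c. comb vs c k) \<in> borel_measurable (borel_vec m)"
proof (induction vs)
  case (Cons v vs)
  then have [measurable]: "(\<lambda>c. c (length vs)) \<in> borel_measurable (borel_vec m)"
    "(\<lambda>c. comb vs c k) \<in> borel_measurable (borel_vec m)" by (auto intro: measurable_coord)
  show ?case by simp
qed simp

lemma lin_measurable: "length vs \<le> m \<Longrightarrow> lin n vs \<in> borel_vec m \<rightarrow>\<^sub>M borel_vec n"
  by (rule measurable_vecI) (auto simp: lin_def comb_measurable cong: measurable_cong)

lemma lin_extensional [simp]: "lin n vs c \<in> extensional {..<n}"
  by (simp add: lin_def)

lemma lin_map_rots:
  assumes "g \<in> rots n"
  shows "lin n (map g vs) c = g (lin n vs c)"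
proof
  fix k
  show "lin n (map g vs) c k = g (lin n vs c) k"
  proof (cases "k < n")
    case True
    then have "g (lin n vs c) k = g (comb vs c) k"
      using rots_cong[OF assms, of "lin n vs c" "comb vs c" k] by (simp add: lin_def)
    then show ?thesis using True rots_comb[OF assms] by (simp add: lin_def)
  qed (simp add: lin_def rots_outside[OF assms])
qed

text \<open>The change of variables formula for a square matrix with columns \<open>vs\<close>, the
  square root of the Gram determinant being the absolute value of its determinant. The measurable
  inverse is carried along because images of Borel sets are later expressed as preimages under
  it.\<close>

definition lin_iso :: "nat \<Rightarrow> (nat \<Rightarrow> real) list \<Rightarrow> bool" where
  "lin_iso n vs \<longleftrightarrow> (\<exists>R \<in> borel_vec n \<rightarrow>\<^sub>M borel_vec n.
     (\<forall>y\<in>extensional {..<n}. lin n vs (R y) = y) \<and>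
     (\<forall>c\<in>extensional {..<n}. R (lin n vs c) = c)) \<and>
     (\<forall>f\<in>borel_measurable (borel_vec n).
       ennreal (sqrt (gram_det n vs)) * (\<integral>\<^sup>+c. f (lin n vs c) \<partial>L.vec n) = (\<integral>\<^sup>+y. f y \<partial>L.vec n))"

lemma lin_iso_rots:
  assumes g: "g \<in> rots n" and iso: "lin_iso n (map g vs)"
  shows "lin_iso n vs"
proof -
  obtain h where h: "h \<in> rots n" "\<And>v. g (h v) = v" "\<And>v. h (g v) = v"
    using rots_inverse[OF g] by auto
  obtain R where R: "R \<in> borel_vec n \<rightarrow>\<^sub>M borel_vec n"
    "\<And>y. y\<in>extensional {..<n} \<Longrightarrow> g (lin n vs (R y)) = y"
    "\<And>c. c\<in>extensional {..<n} \<Longrightarrow> R (g (lin n vs c)) = c"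
    "\<And>f. f\<in>borel_measurable (borel_vec n) \<Longrightarrow>
       ennreal (sqrt (gram_det n vs)) * (\<integral>\<^sup>+c. f (g (lin n vs c)) \<partial>L.vec n) = (\<integral>\<^sup>+y. f y \<partial>L.vec n)"
    using iso unfolding lin_iso_def lin_map_rots[OF g] gram_det_rots[OF g] by blast
  show ?thesis unfolding lin_iso_def
  proof (intro conjI bexI[of _ "\<lambda>y. R (g y)"] ballI)
    show "(\<lambda>y. R (g y)) \<in> borel_vec n \<rightarrow>\<^sub>M borel_vec n"
      by (rule measurable_compose[OF rots_measurable[OF g] R(1)])
    fix y :: "nat \<Rightarrow> real" assume "y \<in> extensional {..<n}"
    then show "lin n vs (R (g y)) = y" using R(2)[of "g y"] rots_extensional[OF g, of y] by (metis h(3))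
  next
    fix f :: "(nat \<Rightarrow> real) \<Rightarrow> ennreal" assume f: "f \<in> borel_measurable (borel_vec n)"
    have "ennreal (sqrt (gram_det n vs)) * (\<integral>\<^sup>+c. f (h (g (lin n vs c))) \<partial>L.vec n) = (\<integral>\<^sup>+y. f (h y) \<partial>L.vec n)"
      by (rule R(4)) (rule measurable_compose[OF rots_measurable[OF h(1)] f])
    then show "ennreal (sqrt (gram_det n vs)) * (\<integral>\<^sup>+c. f (lin n vs c) \<partial>L.vec n) = (\<integral>\<^sup>+y. f y \<partial>L.vec n)"
      by (simp add: h L.nn_integral_rots[OF h(1) f])
  qed (use R(3) in auto)
qed

text \<open>The matrix is block triangular: the coefficient \<open>c m\<close> enters the last
  coordinate only, where for fixed other coefficients it is an affine substitution with slope
  \<open>v m\<close>. The other block is the smaller map.\<close>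

lemma lin_iso_axis:
  assumes v: "\<And>k. k < m \<Longrightarrow> v k = 0" "v m \<noteq> 0" and len: "length vs = m" and iso: "lin_iso m vs"
  shows "lin_iso (Suc m) (v # vs)"
proof -
  obtain R where R[measurable]: "R \<in> borel_vec m \<rightarrow>\<^sub>M borel_vec m"
    and R2: "\<And>y. y\<in>extensional {..<m} \<Longrightarrow> lin m vs (R y) = y"
    and R3: "\<And>c. c\<in>extensional {..<m} \<Longrightarrow> R (lin m vs c) = c"
    and R4: "\<And>f. f\<in>borel_measurable (borel_vec m) \<Longrightarrow>
       ennreal (sqrt (gram_det m vs)) * (\<integral>\<^sup>+c. f (lin m vs c) \<partial>L.vec m) = (\<integral>\<^sup>+y. f y \<partial>L.vec m)"
    using iso unfolding lin_iso_def by blast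
  have Rext: "R y \<in> extensional {..<m}" if "y \<in> extensional {..<m}" for y
    using measurable_space[OF R] that by (auto simp: space_borel_vec)
  define r where "r y = restrict y {..<m}" for y :: "nat \<Rightarrow> real"
  have r[measurable]: "r \<in> borel_vec (Suc m) \<rightarrow>\<^sub>M borel_vec m"
    unfolding r_def by (rule measurable_restrict) (auto intro!: measurable_coord)
  have rext: "r y \<in> extensional {..<m}" for y by (simp add: r_def)
  have c_r: "comb vs (r c) k = comb vs c k" for c k by (rule comb_cong) (auto simp: r_def len)
  have c_u: "comb vs (c(m := x)) k = comb vs c k" for c k x by (rule comb_cong) (auto simp: len)
  have lin: "lin (Suc m) (v # vs) c = (lin m vs (r c))(m := c m * v m + comb vs c m)" for c
    by (auto simp: lin_def fun_eq_iff len v c_r less_Suc_eq)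
  have [measurable]: "(\<lambda>c. comb vs c m) \<in> borel_measurable (borel_vec m)"
    by (rule comb_measurable) (simp add: len)
  have [measurable]: "(\<lambda>c. c m) \<in> borel_measurable (borel_vec (Suc m))" by (rule measurable_coord) simp
  have [measurable]: "lin m vs \<in> borel_vec m \<rightarrow>\<^sub>M borel_vec m" by (rule lin_measurable) (simp add: len)
  show ?thesis unfolding lin_iso_def
  proof (intro conjI bexI[of _ "\<lambda>y. (R (r y))(m := (y m - comb vs (R (r y)) m) / v m)"] ballI)
    show "(\<lambda>y. (R (r y))(m := (y m - comb vs (R (r y)) m) / v m)) \<in> borel_vec (Suc m) \<rightarrow>\<^sub>M borel_vec (Suc m)"
      by (intro measurable_vec_upd) measurable
    fix y :: "nat \<Rightarrow> real" assume y: "y \<in> extensional {..<Suc m}"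
    have e: "(r y)(m := y m) = y" using y by (auto simp: r_def fun_eq_iff extensional_def less_Suc_eq)
    have "r ((R (r y))(m := x)) = R (r y)" for x
      using Rext[OF rext, of y] by (auto simp: r_def fun_eq_iff extensional_def)
    then show "lin (Suc m) (v # vs) ((R (r y))(m := (y m - comb vs (R (r y)) m) / v m)) = y"
      using R2[OF rext] e v by (simp add: lin c_u)
  next
    fix c :: "nat \<Rightarrow> real" assume c: "c \<in> extensional {..<Suc m}"
    have e: "(r c)(m := c m) = c" using c by (auto simp: r_def fun_eq_iff extensional_def less_Suc_eq)
    have "r ((lin m vs (r c))(m := x)) = lin m vs (r c)" for x
      by (auto simp: r_def lin_def fun_eq_iff)
    then show "(R (r (lin (Suc m) (v # vs) c)))(m := (lin (Suc m) (v # vs) c m - comb vs (R (r (lin (Suc m) (v # vs) c))) m) / v m) = c"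
      using R3[OF rext] e v by (simp add: lin c_r)
  next
    fix f :: "(nat \<Rightarrow> real) \<Rightarrow> ennreal" assume f[measurable]: "f \<in> borel_measurable (borel_vec (Suc m))"
    have f': "(\<lambda>c. f (lin (Suc m) (v # vs) c)) \<in> borel_measurable (borel_vec (Suc m))"
      using lin_measurable[of "v # vs" "Suc m" "Suc m"] len by (intro measurable_compose[OF _ f]) auto
    have rc: "r (c(m := x)) = c" if "c \<in> space (L.vec m)" for c x
      using that by (auto simp: r_def L.space_vec extensional_def fun_eq_iff)
    have g: "gram_det (Suc m) (v # vs) = (v m)\<^sup>2 * gram_det m vs"
      by (rule gram_det_Suc_axis) (rule v(1))
    define h where "h y = (\<integral>\<^sup>+x. f (y(m := x)) \<partial>lborel)" for y
    have h: "h \<in> borel_measurable (borel_vec m)"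
      unfolding h_def by measurable
    have "ennreal (sqrt (gram_det (Suc m) (v # vs))) * (\<integral>\<^sup>+c. f (lin (Suc m) (v # vs) c) \<partial>L.vec (Suc m)) =
      ennreal (sqrt (gram_det m vs)) * (ennreal \<bar>v m\<bar> * (\<integral>\<^sup>+c. f (lin (Suc m) (v # vs) c) \<partial>L.vec (Suc m)))"
      by (simp add: g real_sqrt_mult ennreal_mult gram_det_nonneg mult_ac del: gram_det.simps)
    note eq = this
    have "(\<integral>\<^sup>+c. f (lin (Suc m) (v # vs) c) \<partial>L.vec (Suc m)) =
      (\<integral>\<^sup>+c. \<integral>\<^sup>+x. f ((lin m vs c)(m := x * v m + comb vs c m)) \<partial>lborel \<partial>L.vec m)"
      unfolding L.vec_Suc(1)[OF f'] by (intro nn_integral_cong) (simp add: lin rc c_u)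
    then have "ennreal \<bar>v m\<bar> * (\<integral>\<^sup>+c. f (lin (Suc m) (v # vs) c) \<partial>L.vec (Suc m)) =
      ennreal \<bar>v m\<bar> * (\<integral>\<^sup>+c. \<integral>\<^sup>+x. f ((lin m vs c)(m := x * v m + comb vs c m)) \<partial>lborel \<partial>L.vec m)" by simp
    also have "\<dots> = (\<integral>\<^sup>+c. ennreal \<bar>v m\<bar> * (\<integral>\<^sup>+x. f ((lin m vs c)(m := x * v m + comb vs c m)) \<partial>lborel) \<partial>L.vec m)"
      by (rule nn_integral_cmult[symmetric]) measurable
    also have "\<dots> = (\<integral>\<^sup>+c. h (lin m vs c) \<partial>L.vec m)"
    proof (rule nn_integral_cong)
      fix c assume c: "c \<in> space (L.vec m)"
      have "(\<lambda>_. lin m vs c) \<in> borel \<rightarrow>\<^sub>M borel_vec m" by (simp add: space_borel_vec)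
      then have m: "(\<lambda>x. f ((lin m vs c)(m := x))) \<in> borel_measurable borel" by measurable
      show "ennreal \<bar>v m\<bar> * (\<integral>\<^sup>+x. f ((lin m vs c)(m := x * v m + comb vs c m)) \<partial>lborel) = h (lin m vs c)"
        unfolding h_def using nn_integral_real_affine[OF m v(2), of "comb vs c m"] by (simp add: add.commute mult.commute)
    qed
    finally have "ennreal (sqrt (gram_det (Suc m) (v # vs))) * (\<integral>\<^sup>+c. f (lin (Suc m) (v # vs) c) \<partial>L.vec (Suc m)) =
      ennreal (sqrt (gram_det m vs)) * (\<integral>\<^sup>+c. h (lin m vs c) \<partial>L.vec m)" unfolding eq by simp
    also have "\<dots> = (\<integral>\<^sup>+y. h y \<partial>L.vec m)" by (rule R4[OF h])
    also have "\<dots> = (\<integral>\<^sup>+y. f y \<partial>L.vec (Suc m))" unfolding h_def L.vec_Suc(1)[OF f] ..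
    finally show "ennreal (sqrt (gram_det (Suc m) (v # vs))) * (\<integral>\<^sup>+c. f (lin (Suc m) (v # vs) c) \<partial>L.vec (Suc m)) =
      (\<integral>\<^sup>+y. f y \<partial>L.vec (Suc m))" .
  qed
qed

text \<open>Rotating the first vector into the last axis makes the matrix block triangular, and the
  factorisation of the Gram determinant shows that both blocks are again nonsingular.\<close>

lemma lin_iso_if_gram_det:
  assumes "length vs = n" "gram_det n vs \<noteq> 0"
  shows "lin_iso n vs"
  using assms
proof (induction n arbitrary: vs)
  case 0
  then show ?case unfolding lin_iso_def
    by (intro conjI bexI[of _ "\<lambda>x. x"]) (auto simp: lin_def L.P.nn_integral_empty fun_eq_iff PiM_empty nn_integral_count_space_finite restrict_def)
next
  case (Suc m)
  then obtain v vs' where vs: "vs = v # vs'" "length vs' = m" by (cases vs) auto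
  obtain g where g: "g \<in> rots (Suc m)" "\<And>k. k < m \<Longrightarrow> g v k = 0" using rots_to_axis by blast
  have "gram_det (Suc m) (map g vs) = (g v m)\<^sup>2 * gram_det m (map g vs')"
    unfolding vs(1) list.map by (rule gram_det_Suc_axis) (rule g(2))
  with Suc.prems gram_det_rots[OF g(1)] have "g v m \<noteq> 0" "gram_det m (map g vs') \<noteq> 0" by auto
  with Suc.IH[of "map g vs'"] vs g have "lin_iso (Suc m) (map g vs)"
    by (auto intro!: lin_iso_axis)
  then show ?case by (rule lin_iso_rots[OF g(1)])
qed

lemma nn_integral_translate:
  assumes "f \<in> borel_measurable (borel_vec n)"
  shows "(\<integral>\<^sup>+y. f (\<lambda>k\<in>{..<n}. a k + y k) \<partial>L.vec n) = (\<integral>\<^sup>+y. f y \<partial>L.vec n)"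
  using assms
proof (induction n arbitrary: f)
  case 0
  show ?case by (intro nn_integral_cong) (auto simp: space_PiM)
next
  case (Suc n)
  note f[measurable] = Suc.prems
  have [measurable]: "(\<lambda>y. \<lambda>k\<in>{..<n}. a k + y k) \<in> borel_vec n \<rightarrow>\<^sub>M borel_vec n" for n
  proof (rule measurable_restrict)
    fix k assume "k \<in> {..<n}"
    then have [measurable]: "(\<lambda>y. y k) \<in> borel_measurable (borel_vec n)" by (intro measurable_coord) auto
    show "(\<lambda>y. a k + y k) \<in> borel_measurable (borel_vec n)" by measurable
  qed
  define h where "h y = (\<integral>\<^sup>+x. f (y(n := x)) \<partial>lborel)" for y
  have h: "h \<in> borel_measurable (borel_vec n)"
    unfolding h_def by measurable
  have "(\<integral>\<^sup>+y. f (\<lambda>k\<in>{..<Suc n}. a k + y k) \<partial>L.vec (Suc n)) =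
     (\<integral>\<^sup>+y. \<integral>\<^sup>+x. f ((\<lambda>k\<in>{..<n}. a k + y k)(n := a n + x)) \<partial>lborel \<partial>L.vec n)"
    by (subst L.vec_Suc(1)) (auto intro!: nn_integral_cong arg_cong[where f=f])
  also have "\<dots> = (\<integral>\<^sup>+y. h (\<lambda>k\<in>{..<n}. a k + y k) \<partial>L.vec n)"
  proof (rule nn_integral_cong)
    fix y assume "y \<in> space (L.vec n)"
    let ?u = "\<lambda>k\<in>{..<n}. a k + y k"
    have "(\<lambda>_. ?u) \<in> borel \<rightarrow>\<^sub>M borel_vec n" by (simp add: space_borel_vec)
    then have m: "(\<lambda>x. f (?u(n := x))) \<in> borel_measurable borel" by measurable
    show "(\<integral>\<^sup>+x. f (?u(n := a n + x)) \<partial>lborel) = h ?u"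
      unfolding h_def using nn_integral_real_affine[OF m, of 1 "a n"] by simp
  qed
  also have "\<dots> = (\<integral>\<^sup>+y. h y \<partial>L.vec n)" by (rule Suc.IH[OF h])
  also have "\<dots> = (\<integral>\<^sup>+y. f y \<partial>L.vec (Suc n))" unfolding h_def L.vec_Suc(1)[OF f] ..
  finally show ?case .
qed

section \<open>Simplices as affine images of the corner simplex, and their charts\<close>

definition corner_simplex :: "nat \<Rightarrow> real \<Rightarrow> (nat \<Rightarrow> real) set" where
  "corner_simplex n s = {c \<in> extensional {..<n}. (\<forall>i<n. c i \<ge> 0) \<and> (\<Sum>i<n. c i) \<le> s}"

lemma corner_simplex_sets: "corner_simplex n s \<in> sets (borel_vec n)"
proof -
  have "{c \<in> space (borel_vec n). (\<forall>i\<in>{..<n}. 0 \<le> c i) \<and> (\<Sum>i<n. c i) \<le> s} \<in> sets (borel_vec n)"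
    by (intro sets.sets_Collect_conj sets.sets_Collect_finite_All borel_measurable_le
        borel_measurable_sum measurable_coord borel_measurable_const) auto
  also have "{c \<in> space (borel_vec n). (\<forall>i\<in>{..<n}. 0 \<le> c i) \<and> (\<Sum>i<n. c i) \<le> s} = corner_simplex n s"
    by (auto simp: corner_simplex_def space_borel_vec)
  finally show ?thesis .
qed

lemma emeasure_corner_simplex:
  assumes "s \<ge> 0"
  shows "emeasure (L.vec n) (corner_simplex n s) = ennreal (s ^ n / fact n)"
proof -
  have "corner_simplex n s = {x. (\<forall>i\<in>{..<n}. 0 \<le> x i) \<and> sum x {..<n} \<le> s} \<inter> space (L.vec n)"
    by (auto simp: corner_simplex_def L.space_vec)
  then have "emeasure (L.vec n) (corner_simplex n s) = s ^ n / fact n"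
    using emeasure_std_simplex_aux[of "{..<n}" s] assms by simp
  then show ?thesis using assms by (simp add: ennreal_fact[symmetric] divide_ennreal)
qed

lemma ip_frame:
  assumes "orthonormal_frame n r u"
  shows "ip n (\<lambda>k. \<Sum>i<r. a i * u i k) (\<lambda>k. \<Sum>i<r. b i * u i k) = ip r a b"
proof -
  have "ip n (\<lambda>k. \<Sum>i<r. a i * u i k) (\<lambda>k. \<Sum>i<r. b i * u i k) =
     (\<Sum>k<n. \<Sum>i<r. \<Sum>j<r. a i * b j * (u i k * u j k))"
    by (simp add: ip_def sum_product mult_ac)
  also have "\<dots> = (\<Sum>i<r. \<Sum>j<r. a i * b j * (\<Sum>k<n. u i k * u j k))"
    by (subst sum.swap, rule sum.cong[OF refl], subst sum.swap) (simp add: sum_distrib_left)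
  also have "\<dots> = (\<Sum>i<r. \<Sum>j<r. if i = j then a i * b j else 0)"
    using assms by (intro sum.cong refl) (auto simp: orthonormal_frame_def)
  also have "\<dots> = ip r a b" by (simp add: ip_def)
  finally show ?thesis .
qed

lemma flat_chart_inj:
  assumes "orthonormal_frame n r u" "flat_chart n r p u a = flat_chart n r p u b" "j < r"
  shows "a j = b j"
proof -
  let ?d = "\<lambda>k. \<Sum>i<r. (a i - b i) * u i k"
  have "?d k = 0" if "k < n" for k
    using fun_cong[OF assms(2), of k] that by (simp add: flat_chart_def left_diff_distrib sum_subtractf)
  then have "ip n ?d ?d = 0" by (simp add: ip_self_eq_0_iff)
  then have "ip r (\<lambda>i. a i - b i) (\<lambda>i. a i - b i) = 0" unfolding ip_frame[OF assms(1)] .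
  then show ?thesis using assms(3) by (simp add: ip_self_eq_0_iff)
qed

lemma simplex_hull_vertex:
  assumes "i \<le> r" "x i \<in> extensional {..<n}"
  shows "x i \<in> simplex_hull n r x"
proof -
  let ?c = "\<lambda>j. if j = i then 1 else 0 :: real"
  have 1: "x i = (\<lambda>k\<in>{..<n}. \<Sum>j\<le>r. ?c j * x j k)"
    using assms by (auto simp: fun_eq_iff extensional_def if_distrib[of "\<lambda>c. c * _"] cong: if_cong)
  have 2: "(\<forall>j\<le>r. ?c j \<ge> 0) \<and> (\<Sum>j\<le>r. ?c j) = 1" using assms by simp
  show ?thesis unfolding simplex_hull_def
    by (rule CollectI, rule exI[of _ ?c], rule conjI[OF 1 2])
qed

lemma affine_combination_eq:
  fixes c :: "nat \<Rightarrow> real"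
  assumes "(\<Sum>i\<le>r. c i) = 1"
  shows "(\<Sum>i\<le>r. c i * y i) = y 0 + (\<Sum>i<r. c (Suc i) * (y (Suc i) - y 0))"
proof -
  have "c 0 + (\<Sum>i<r. c (Suc i)) = 1" using assms by (simp add: sum.atMost_shift)
  from arg_cong[OF this, of "\<lambda>z. z * y 0"]
  have "c 0 * y 0 + (\<Sum>i<r. c (Suc i) * y 0) = y 0" by (simp add: distrib_right sum_distrib_right)
  then show ?thesis
    by (simp add: sum.atMost_shift right_diff_distrib sum_subtractf)
qed

text \<open>Reversed to match the order of \<open>comb\<close>, so that the coefficient with index
  \<open>i\<close> belongs to the edge from vertex 0 to vertex \<open>i + 1\<close>.\<close>

abbreviation edges :: "nat \<Rightarrow> (nat \<Rightarrow> nat \<Rightarrow> real) \<Rightarrow> (nat \<Rightarrow> real) list" where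
  "edges r x \<equiv> map (\<lambda>i k. x (Suc i) k - x 0 k) (rev [0..<r])"

text \<open>The weight of vertex 0 is determined by the other weights, which range over the corner
  simplex. Thus the hull is an affine image of a set whose volume 1 / r! is known.\<close>

lemma simplex_hull_alt:
  "simplex_hull n r x = {(\<lambda>k\<in>{..<n}. x 0 k + lin n (edges r x) c k) | c. c \<in> corner_simplex r 1}"
proof (intro set_eqI iffI)
  fix s assume "s \<in> simplex_hull n r x"
  then obtain c where c: "s = (\<lambda>k\<in>{..<n}. \<Sum>i\<le>r. c i * x i k)" "\<And>i. i \<le> r \<Longrightarrow> c i \<ge> 0" "(\<Sum>i\<le>r. c i) = 1"
    unfolding simplex_hull_def by auto
  define c' where "c' = (\<lambda>i\<in>{..<r}. c (Suc i))"
  have "c 0 + (\<Sum>i<r. c (Suc i)) = 1" using c(3) by (simp add: sum.atMost_shift)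
  moreover have "c 0 \<ge> 0" using c(2) by blast
  ultimately have "(\<Sum>i<r. c (Suc i)) \<le> 1" by linarith
  then have "c' \<in> corner_simplex r 1" using c(2) by (auto simp: c'_def corner_simplex_def)
  moreover have "s = (\<lambda>k\<in>{..<n}. x 0 k + lin n (edges r x) c' k)"
    unfolding c(1) affine_combination_eq[OF c(3)]
    by (intro restrict_ext) (simp add: lin_def comb_map_rev c'_def)
  ultimately show "s \<in> {(\<lambda>k\<in>{..<n}. x 0 k + lin n (edges r x) c k) | c. c \<in> corner_simplex r 1}" by blast
next
  fix s assume "s \<in> {(\<lambda>k\<in>{..<n}. x 0 k + lin n (edges r x) c k) | c. c \<in> corner_simplex r 1}"
  then obtain c where c: "s = (\<lambda>k\<in>{..<n}. x 0 k + lin n (edges r x) c k)" "c \<in> corner_simplex r 1" by auto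
  define c' where "c' = (\<lambda>i. case i of 0 \<Rightarrow> 1 - (\<Sum>i<r. c i) | Suc i \<Rightarrow> c i)"
  have 1: "(\<Sum>i\<le>r. c' i) = 1" by (simp add: sum.atMost_shift c'_def)
  have 2: "\<forall>i\<le>r. c' i \<ge> 0" using c(2) by (auto simp: c'_def corner_simplex_def split: nat.split)
  have 3: "s = (\<lambda>k\<in>{..<n}. \<Sum>i\<le>r. c' i * x i k)"
    unfolding c(1) affine_combination_eq[OF 1]
    by (intro restrict_ext) (simp add: lin_def comb_map_rev c'_def)
  show "s \<in> simplex_hull n r x" unfolding simplex_hull_def
    by (rule CollectI, rule exI[of _ c'], intro conjI 1 2 3)
qed

text \<open>After the rotation the set is a hyperplane orthogonal to the last axis, and each line
  parallel to that axis meets it in a single point.\<close>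

lemma null_hyperplane:
  assumes "g \<in> rots (Suc m)"
  shows "{y \<in> extensional {..<Suc m}. g y m = t} \<in> null_sets (L.vec (Suc m))"
proof -
  have H: "{y \<in> space (borel_vec (Suc m)). y m = t} \<in> sets (borel_vec (Suc m))"
    by (intro borel_measurable_eq measurable_coord borel_measurable_const) simp
  let ?H = "{y \<in> space (borel_vec (Suc m)). y m = t}"
  have ind: "indicator ?H \<in> borel_measurable (borel_vec (Suc m))" using H by simp
  have "(\<integral>\<^sup>+y. indicator ?H (g y) \<partial>L.vec (Suc m)) = (\<integral>\<^sup>+y. indicator ?H y \<partial>L.vec (Suc m))"
    by (rule L.nn_integral_rots[OF assms ind])
  also have "\<dots> = (\<integral>\<^sup>+y. \<integral>\<^sup>+x. indicator ?H (y(m := x)) \<partial>lborel \<partial>L.vec m)"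
    by (rule L.vec_Suc(1)[OF ind])
  also have "\<dots> = (\<integral>\<^sup>+y. \<integral>\<^sup>+x. indicator {t} x \<partial>lborel \<partial>L.vec m)"
    by (intro nn_integral_cong) (auto simp: indicator_def space_borel_vec L.space_vec extensional_def)
  also have "\<dots> = 0" by simp
  finally have 0: "(\<integral>\<^sup>+y. indicator ?H (g y) \<partial>L.vec (Suc m)) = 0" .
  have E: "{y \<in> extensional {..<Suc m}. g y m = t} = g -` ?H \<inter> space (borel_vec (Suc m))"
    using rots_extensional[OF assms] by (auto simp: space_borel_vec)
  have S: "{y \<in> extensional {..<Suc m}. g y m = t} \<in> sets (L.vec (Suc m))"
    unfolding E L.sets_vec by (rule measurable_sets[OF rots_measurable[OF assms] H])
  have "emeasure (L.vec (Suc m)) {y \<in> extensional {..<Suc m}. g y m = t} =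
     (\<integral>\<^sup>+y. indicator {y \<in> extensional {..<Suc m}. g y m = t} y \<partial>L.vec (Suc m))"
    using S by simp
  also have "\<dots> = (\<integral>\<^sup>+y. indicator ?H (g y) \<partial>L.vec (Suc m))"
    by (intro nn_integral_cong)
       (use rots_extensional[OF assms] in \<open>auto simp: indicator_def space_borel_vec L.space_vec\<close>)
  finally show ?thesis using S 0 by (auto simp: null_sets_def)
qed

lemma measure_affine_simplex:
  assumes len: "length vs = r"
  shows "measure (L.vec r) {(\<lambda>k\<in>{..<r}. a k + lin r vs c k) | c. c \<in> corner_simplex r 1} =
    sqrt (gram_det r vs) / fact r"
proof (cases "gram_det r vs = 0")
  case True
  then obtain m where r: "r = Suc m" using len by (cases r) auto
  obtain g where g: "g \<in> rots (Suc m)" "\<And>v. v \<in> set vs \<Longrightarrow> g v m = 0"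
    using gram_det_eq_0_imp_rot[of vs m] len True r by auto
  have gc: "g (lin r vs c) m = 0" for c
  proof -
    have "g (lin r vs c) m = comb (map g vs) c m" using fun_cong[OF lin_map_rots[OF g(1), of vs c], of m] r by (simp add: lin_def)
    also have "comb (map g vs) c m = 0"
      using g(2) by (induction vs) auto
    finally show ?thesis .
  qed
  define A where "A = {(\<lambda>k\<in>{..<r}. a k + lin r vs c k) | c. c \<in> corner_simplex r 1}"
  have "g (\<lambda>k\<in>{..<r}. a k + lin r vs c k) m = g a m" for c
  proof -
    have "g (\<lambda>k\<in>{..<r}. a k + lin r vs c k) m = g (\<lambda>k. 1 * a k + 1 * lin r vs c k) m"
      by (rule rots_cong[OF g(1)]) (auto simp: r)
    also have "\<dots> = g a m" by (subst rots_linear[OF g(1)]) (simp add: gc)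
    finally show ?thesis .
  qed
  then have "A \<subseteq> {y \<in> extensional {..<Suc m}. g y m = g a m}" using r by (auto simp: A_def)
  \<comment> \<open>A measurable subset of a null set has measure 0, and a non-measurable set has
    measure 0 by convention.\<close>
  then have "emeasure (L.vec r) A = 0 \<or> A \<notin> sets (L.vec r)"
    using null_sets_subset[OF null_hyperplane[OF g(1), of "g a m"]] r by (auto simp: null_sets_def)
  then have "measure (L.vec r) A = 0"
    by (auto simp: measure_def emeasure_notin_sets)
  then show ?thesis using True by (simp add: A_def)
next
  case False
  obtain R where R: "R \<in> borel_vec r \<rightarrow>\<^sub>M borel_vec r"
    "\<And>y. y\<in>extensional {..<r} \<Longrightarrow> lin r vs (R y) = y"
    "\<And>c. c\<in>extensional {..<r} \<Longrightarrow> R (lin r vs c) = c"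
    "\<And>f. f\<in>borel_measurable (borel_vec r) \<Longrightarrow>
       ennreal (sqrt (gram_det r vs)) * (\<integral>\<^sup>+c. f (lin r vs c) \<partial>L.vec r) = (\<integral>\<^sup>+y. f y \<partial>L.vec r)"
    using lin_iso_if_gram_det[OF len False] unfolding lin_iso_def by blast
  define A where "A = {(\<lambda>k\<in>{..<r}. a k + lin r vs c k) | c. c \<in> corner_simplex r 1}"
  define B where "B = R -` corner_simplex r 1 \<inter> space (borel_vec r)"
  define T where "T b y = (\<lambda>k\<in>{..<r}. b k + y k)" for b y :: "nat \<Rightarrow> real"
  have T: "T b \<in> borel_vec r \<rightarrow>\<^sub>M borel_vec r" for b
    unfolding T_def by (intro measurable_restrict borel_measurable_add borel_measurable_const measurable_coord) auto
  have B: "B \<in> sets (borel_vec r)"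
    unfolding B_def by (rule measurable_sets[OF R(1) corner_simplex_sets])
  have Text: "T b y \<in> extensional {..<r}" for b y by (simp add: T_def)
  have TT: "T a (T (\<lambda>k. - a k) y) = y" "T (\<lambda>k. - a k) (T a y) = y" if "y \<in> extensional {..<r}" for y
    using that by (auto simp: T_def fun_eq_iff extensional_def)
  \<comment> \<open>The affine image is written as a preimage under the inverse map, which shows it
    to be a Borel set.\<close>
  have AB: "A = T (\<lambda>k. - a k) -` B \<inter> space (borel_vec r)"
  proof (intro set_eqI iffI)
    fix y assume "y \<in> A"
    then obtain c where c: "y = T a (lin r vs c)" "c \<in> corner_simplex r 1" by (auto simp: A_def T_def)
    then show "y \<in> T (\<lambda>k. - a k) -` B \<inter> space (borel_vec r)"
      using R(3)[of c] by (auto simp: TT B_def space_borel_vec Text corner_simplex_def)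
  next
    fix y assume y: "y \<in> T (\<lambda>k. - a k) -` B \<inter> space (borel_vec r)"
    define c where "c = R (T (\<lambda>k. - a k) y)"
    have "y = T a (lin r vs c)" using y R(2)[OF Text] by (simp add: c_def TT space_borel_vec)
    moreover have "c \<in> corner_simplex r 1" using y by (simp add: c_def B_def)
    ultimately show "y \<in> A" by (auto simp: A_def T_def)
  qed
  have A: "A \<in> sets (borel_vec r)" unfolding AB by (rule measurable_sets[OF T B])
  then have iA: "indicator A \<in> borel_measurable (borel_vec r)" by simp
  have "emeasure (L.vec r) A = (\<integral>\<^sup>+y. indicator A y \<partial>L.vec r)"
    using A by (simp add: L.sets_vec)
  also have "\<dots> = (\<integral>\<^sup>+y. indicator A (T a y) \<partial>L.vec r)"
    unfolding T_def by (rule nn_integral_translate[OF iA, symmetric])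
  also have "\<dots> = ennreal (sqrt (gram_det r vs)) * (\<integral>\<^sup>+c. indicator A (T a (lin r vs c)) \<partial>L.vec r)"
    by (rule R(4)[symmetric]) (rule measurable_compose[OF T iA])
  also have "(\<integral>\<^sup>+c. indicator A (T a (lin r vs c)) \<partial>L.vec r) = (\<integral>\<^sup>+c. indicator (corner_simplex r 1) c \<partial>L.vec r)"
  proof (rule nn_integral_cong)
    fix c assume "c \<in> space (L.vec r)"
    then have "T a (lin r vs c) \<in> A \<longleftrightarrow> c \<in> corner_simplex r 1"
      using R(3)[of c] unfolding AB by (auto simp: B_def TT space_borel_vec L.space_vec Text)
    then show "(indicator A (T a (lin r vs c)) :: ennreal) = indicator (corner_simplex r 1) c"
      by (simp add: indicator_def)
  qed
  also have "\<dots> = ennreal (1 / fact r)"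
    using emeasure_corner_simplex[of 1 r] corner_simplex_sets[of r 1] by (simp add: L.sets_vec)
  finally have "emeasure (L.vec r) A = ennreal (sqrt (gram_det r vs) / fact r)"
    by (simp add: gram_det_nonneg flip: ennreal_mult)
  then show ?thesis unfolding A_def[symmetric] by (simp add: measure_def gram_det_nonneg)
qed

text \<open>Orthonormal coordinates preserve inner products, so the Gram determinant of the edges
  may be computed in the chart, where the simplex has full dimension. The result mentions neither
  \<open>p\<close> nor \<open>u\<close>, which gives uniqueness in
  \<open>flat_volume\<close>.\<close>

lemma measure_chart_simplex:
  assumes u: "orthonormal_frame n r u" and x: "\<And>i. i \<le> r \<Longrightarrow> x i \<in> extensional {..<n}"
    and sub: "simplex_hull n r x \<subseteq> flat_chart n r p u ` extensional {..<r}"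
  shows "measure (L.vec r) {a \<in> extensional {..<r}. flat_chart n r p u a \<in> simplex_hull n r x} =
    sqrt (gram_det n (edges r x)) / fact r"
proof -
  have "\<exists>a. \<forall>i\<le>r. a i \<in> extensional {..<r} \<and> x i = flat_chart n r p u (a i)"
  proof -
    have "\<forall>i\<in>{..r}. \<exists>b. b \<in> extensional {..<r} \<and> x i = flat_chart n r p u b"
      using sub simplex_hull_vertex x by (fastforce simp: image_iff subset_iff)
    then show ?thesis unfolding Ball_def atMost_iff by (rule choice_iff'[THEN iffD1])
  qed
  then obtain a where a: "\<And>i. i \<le> r \<Longrightarrow> a i \<in> extensional {..<r}" "\<And>i. i \<le> r \<Longrightarrow> x i = flat_chart n r p u (a i)"
    by blast
  have xk: "x i k = p k + (\<Sum>j<r. a i j * u j k)" if "i \<le> r" "k < n" for i k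
    using a(2)[OF that(1)] that(2) by (simp add: flat_chart_def)
  have dx: "x (Suc i) k - x 0 k = (\<Sum>j<r. (a (Suc i) j - a 0 j) * u j k)" if "i < r" "k < n" for i k
    using that by (simp add: xk left_diff_distrib sum_subtractf)
  have gram: "gram_det n (edges r x) = gram_det r (edges r a)"
  proof (rule gram_det_cong)
    fix i j assume "i < length (edges r x)" "j < length (edges r x)"
    then have i: "r - Suc i < r" "rev [0..<r] ! i = r - Suc i" and j: "r - Suc j < r" "rev [0..<r] ! j = r - Suc j"
      by (auto simp: rev_nth)
    let ?d = "\<lambda>i k. \<Sum>j<r. (a (Suc i) j - a 0 j) * u j k"
    have "ip n (edges r x ! i) (edges r x ! j) = ip n (?d (r - Suc i)) (?d (r - Suc j))"
      using i j \<open>i < _\<close> \<open>j < _\<close> dx by (auto simp: ip_def intro!: sum.cong)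
    also have "\<dots> = ip r (edges r a ! i) (edges r a ! j)"
      unfolding ip_frame[OF u] using i j \<open>i < _\<close> \<open>j < _\<close> by simp
    finally show "ip n (edges r x ! i) (edges r x ! j) = ip r (edges r a ! i) (edges r a ! j)" .
  qed simp
  have chart: "(\<lambda>k\<in>{..<n}. x 0 k + lin n (edges r x) c k) =
      flat_chart n r p u (\<lambda>j\<in>{..<r}. a 0 j + lin r (edges r a) c j)" for c
  proof (rule ext)
    fix k
    show "(\<lambda>k\<in>{..<n}. x 0 k + lin n (edges r x) c k) k =
      flat_chart n r p u (\<lambda>j\<in>{..<r}. a 0 j + lin r (edges r a) c j) k"
    proof (cases "k < n")
      case True
      have "x 0 k + (\<Sum>i<r. c i * (x (Suc i) k - x 0 k)) =
        p k + (\<Sum>j<r. a 0 j * u j k) + (\<Sum>i<r. c i * (\<Sum>j<r. (a (Suc i) j - a 0 j) * u j k))"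
        using True dx by (simp add: xk)
      also have "(\<Sum>i<r. c i * (\<Sum>j<r. (a (Suc i) j - a 0 j) * u j k)) =
         (\<Sum>j<r. (\<Sum>i<r. c i * (a (Suc i) j - a 0 j)) * u j k)"
        unfolding sum_distrib_left sum_distrib_right by (subst sum.swap) (simp add: mult.assoc)
      finally show ?thesis using True
        by (simp add: flat_chart_def lin_def comb_map_rev distrib_right sum.distrib)
    qed (simp add: flat_chart_def)
  qed
  have "{b \<in> extensional {..<r}. flat_chart n r p u b \<in> simplex_hull n r x} =
     {(\<lambda>k\<in>{..<r}. a 0 k + lin r (edges r a) c k) | c. c \<in> corner_simplex r 1}"
  proof (intro set_eqI iffI)
    fix b assume b: "b \<in> {b \<in> extensional {..<r}. flat_chart n r p u b \<in> simplex_hull n r x}"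
    then obtain c where c: "c \<in> corner_simplex r 1"
      "flat_chart n r p u b = flat_chart n r p u (\<lambda>j\<in>{..<r}. a 0 j + lin r (edges r a) c j)"
      unfolding simplex_hull_alt chart by auto
    have "b = (\<lambda>j\<in>{..<r}. a 0 j + lin r (edges r a) c j)"
      using flat_chart_inj[OF u c(2)] b by (auto simp: fun_eq_iff extensional_def restrict_def)
    then show "b \<in> {(\<lambda>k\<in>{..<r}. a 0 k + lin r (edges r a) c k) | c. c \<in> corner_simplex r 1}" using c by blast
  next
    fix b assume "b \<in> {(\<lambda>k\<in>{..<r}. a 0 k + lin r (edges r a) c k) | c. c \<in> corner_simplex r 1}"
    then show "b \<in> {b \<in> extensional {..<r}. flat_chart n r p u b \<in> simplex_hull n r x}"
      unfolding simplex_hull_alt chart by auto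
  qed
  then show ?thesis unfolding gram by (simp add: measure_affine_simplex)
qed

text \<open>A rotation carries all edges into the first \<open>r\<close> coordinates. Its inverse,
  applied to the first \<open>r\<close> unit vectors, yields an orthonormal frame whose span
  contains the edges; the chart is based at vertex 0.\<close>

lemma exists_chart:
  assumes "r \<le> n"
  shows "\<exists>p u. orthonormal_frame n r u \<and> simplex_hull n r x \<subseteq> flat_chart n r p u ` extensional {..<r}"
proof -
  obtain g where g: "g \<in> rots n" "\<And>v k. v \<in> set (edges r x) \<Longrightarrow> r \<le> k \<Longrightarrow> k < n \<Longrightarrow> g v k = 0"
    using rots_to_initial[of "edges r x" n] assms by auto
  obtain h where h: "h \<in> rots n" "\<And>v. g (h v) = v" "\<And>v. h (g v) = v"
    using rots_inverse[OF g(1)] by auto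
  define u where "u j = h (\<lambda>k. if k = j then 1 else 0)" for j :: nat
  have "orthonormal_frame n r u"
    unfolding orthonormal_frame_def
  proof (intro allI impI)
    fix i j assume ij: "i < r" "j < r"
    have "(\<Sum>k<n. u i k * u j k) = ip n (u i) (u j)" by (simp add: ip_def)
    also have "\<dots> = ip n (\<lambda>k. if k = i then 1 else 0) (\<lambda>k. if k = j then 1 else 0)"
      unfolding u_def by (rule rots_ip[OF h(1)])
    also have "\<dots> = (if i = j then 1 else 0)"
      using ij assms by (auto simp: ip_def if_distrib[of "\<lambda>c. c * _"] cong: if_cong)
    finally show "(\<Sum>k<n. u i k * u j k) = (if i = j then 1 else 0)" .
  qed
  moreover have "simplex_hull n r x \<subseteq> flat_chart n r (x 0) u ` extensional {..<r}"
  proof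
    fix s assume "s \<in> simplex_hull n r x"
    then obtain c where s: "s = (\<lambda>k\<in>{..<n}. x 0 k + lin n (edges r x) c k)" unfolding simplex_hull_alt by auto
    define y where "y = g (lin n (edges r x) c)"
    have y0: "y k = 0" if "r \<le> k" "k < n" for k
    proof -
      have "y k = comb (map g (edges r x)) c k"
        unfolding y_def lin_map_rots[OF g(1), symmetric] using that by (simp add: lin_def)
      also have "\<dots> = (\<Sum>i<r. c i * g (\<lambda>k. x (Suc i) k - x 0 k) k)"
        unfolding map_map comp_def by (rule comb_map_rev)
      also have "\<dots> = 0" using g(2)[OF _ that] by (intro sum.neutral) auto
      finally show ?thesis .
    qed
    have "s = flat_chart n r (x 0) u (restrict y {..<r})"
    proof
      fix k
      show "s k = flat_chart n r (x 0) u (restrict y {..<r}) k"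
      proof (cases "k < n")
        case True
        have "lin n (edges r x) c k = h y k" by (simp add: y_def h)
        also have "\<dots> = h (\<lambda>k. \<Sum>j<r. y j * (if k = j then 1 else 0)) k"
          by (rule rots_cong[OF h(1) _ True])
             (use y0 in \<open>auto simp: if_distrib[of "\<lambda>c. _ * c"] not_less cong: if_cong\<close>)
        also have "\<dots> = (\<Sum>j<r. y j * u j k)" unfolding u_def by (rule rots_sum[OF h(1)])
        finally show ?thesis using True by (simp add: s flat_chart_def)
      qed (simp add: s flat_chart_def)
    qed
    then show "s \<in> flat_chart n r (x 0) u ` extensional {..<r}" by blast
  qed
  ultimately show ?thesis by blast
qed

theorem flat_volume_simplex_hull:
  assumes "r \<le> n" "\<And>i. i \<le> r \<Longrightarrow> x i \<in> extensional {..<n}"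
  shows "flat_volume n r (simplex_hull n r x) = sqrt (gram_det n (edges r x)) / fact r"
proof -
  have M: "measure (L.vec r) {a \<in> extensional {..<r}. flat_chart n r p u a \<in> simplex_hull n r x} =
      sqrt (gram_det n (edges r x)) / fact r"
    if "orthonormal_frame n r u" "simplex_hull n r x \<subseteq> flat_chart n r p u ` extensional {..<r}" for p u
    by (rule measure_chart_simplex[OF that(1) assms(2) that(2)])
  obtain p u where pu: "orthonormal_frame n r u" "simplex_hull n r x \<subseteq> flat_chart n r p u ` extensional {..<r}"
    using exists_chart[OF assms(1), of x] by (elim exE conjE)
  show ?thesis unfolding flat_volume_def
  proof (rule the_equality)
    show "\<exists>p u. orthonormal_frame n r u \<and> simplex_hull n r x \<subseteq> flat_chart n r p u ` extensional {..<r} \<and>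
       sqrt (gram_det n (edges r x)) / fact r =
       measure (L.vec r) {a \<in> extensional {..<r}. flat_chart n r p u a \<in> simplex_hull n r x}"
      by (rule exI[of _ p], rule exI[of _ u]) (intro conjI pu M[OF pu, symmetric])
  next
    fix v assume "\<exists>p u. orthonormal_frame n r u \<and> simplex_hull n r x \<subseteq> flat_chart n r p u ` extensional {..<r} \<and>
       v = measure (L.vec r) {a \<in> extensional {..<r}. flat_chart n r p u a \<in> simplex_hull n r x}"
    then show "v = sqrt (gram_det n (edges r x)) / fact r"
      by (elim exE conjE) (simp only: M)
  qed
qed

lemma log_simplex_volume_eq:
  assumes "r \<le> n" "\<And>i. i \<le> r \<Longrightarrow> x i \<in> extensional {..<n}"
  shows "log_simplex_volume n r x = ln (gram_det n (edges r x)) / 2"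
proof -
  have fv: "flat_volume n r (simplex_hull n r x) = sqrt (gram_det n (edges r x)) / fact r"
    by (rule flat_volume_simplex_hull) (use assms in auto)
  have "log_simplex_volume n r x = ln (sqrt (gram_det n (edges r x)))"
    unfolding log_simplex_volume_def fv by simp
  \<comment> \<open>In the degenerate case both sides reduce to \<open>ln 0\<close>, that is to
    0.\<close>
  then show ?thesis using gram_det_nonneg[of n "edges r x"] by (cases "gram_det n (edges r x) = 0") (auto simp: ln_sqrt)
qed

section \<open>Gaussian vectors and gamma distributions\<close>

interpretation N: rotation_invariant std_normal_distribution
  by (rule rotation_invariant_std_normal)

lemma ip_measurable: "(\<lambda>x. ip n x x) \<in> borel_measurable (borel_vec n)"
  unfolding ip_def by (intro borel_measurable_sum borel_measurable_times measurable_coord) auto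

lemma emeasure_distr_nn_integral:
  assumes "f \<in> M \<rightarrow>\<^sub>M N" "A \<in> sets N"
  shows "emeasure (distr M N f) A = (\<integral>\<^sup>+x. indicator A (f x) \<partial>M)"
proof -
  have "emeasure (distr M N f) A = (\<integral>\<^sup>+y. indicator A y \<partial>distr M N f)" using assms(2) by simp
  also have "\<dots> = (\<integral>\<^sup>+x. indicator A (f x) \<partial>M)"
    by (rule nn_integral_distr) (use assms in auto)
  finally show ?thesis .
qed

lemma nn_integral_gaussian_vec:
  assumes "f \<in> borel_measurable (borel_vec n)"
  shows "(\<integral>\<^sup>+x. f x \<partial>N.vec n) =
    (\<integral>\<^sup>+x. ennreal ((1 / sqrt (2 * pi)) ^ n * exp (- ip n x x / 2)) * f x \<partial>L.vec n)"
  using assms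
proof (induction n arbitrary: f)
  case 0
  show ?case by (simp add: ip_def PiM_empty nn_integral_count_space_finite)
next
  case (Suc n)
  note f[measurable] = Suc.prems
  let ?K = "\<lambda>n x. ennreal ((1 / sqrt (2 * pi)) ^ n * exp (- ip n x x / 2))"
  have K[measurable]: "?K n \<in> borel_measurable (borel_vec n)" for n
    using ip_measurable[of n] by measurable
  define g where "g x = (\<integral>\<^sup>+y. ennreal (std_normal_density y) * f (x(n := y)) \<partial>lborel)" for x
  have fs: "(\<lambda>y. f (x(n := y))) \<in> borel_measurable borel" if "x \<in> extensional {..<n}" for x
  proof -
    have "(\<lambda>_. x) \<in> borel \<rightarrow>\<^sub>M borel_vec n" using that by (simp add: space_borel_vec)
    then show ?thesis by measurable
  qed
  have g: "g \<in> borel_measurable (borel_vec n)" unfolding g_def by measurable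
  have "(\<integral>\<^sup>+x. f x \<partial>N.vec (Suc n)) = (\<integral>\<^sup>+x. g x \<partial>N.vec n)"
    unfolding N.vec_Suc(1)[OF f] g_def
    by (intro nn_integral_cong nn_integral_density) (auto simp: N.space_vec fs)
  also have "\<dots> = (\<integral>\<^sup>+x. ?K n x * g x \<partial>L.vec n)" by (rule Suc.IH[OF g])
  also have "\<dots> = (\<integral>\<^sup>+x. \<integral>\<^sup>+y. ?K (Suc n) (x(n := y)) * f (x(n := y)) \<partial>lborel \<partial>L.vec n)"
  proof (rule nn_integral_cong)
    fix x assume x: "x \<in> space (L.vec n)"
    have "?K n x * g x = (\<integral>\<^sup>+y. ?K n x * (ennreal (std_normal_density y) * f (x(n := y))) \<partial>lborel)"
      unfolding g_def using fs[of x] x by (intro nn_integral_cmult[symmetric]) (auto simp: L.space_vec)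
    also have "\<dots> = (\<integral>\<^sup>+y. ?K (Suc n) (x(n := y)) * f (x(n := y)) \<partial>lborel)"
    proof (rule nn_integral_cong)
      fix y
      have "ip (Suc n) (x(n := y)) (x(n := y)) = ip n x x + y\<^sup>2"
        by (simp add: ip_def power2_eq_square)
      then have "- ip (Suc n) (x(n := y)) (x(n := y)) / 2 = - ip n x x / 2 + - y\<^sup>2 / 2"
        by (simp add: field_simps)
      then have "(1 / sqrt (2 * pi)) ^ n * exp (- ip n x x / 2) * std_normal_density y =
        (1 / sqrt (2 * pi)) ^ Suc n * exp (- ip (Suc n) (x(n := y)) (x(n := y)) / 2)"
        unfolding std_normal_density_def power_Suc by (simp only: exp_add mult_ac)
      then show "?K n x * (ennreal (std_normal_density y) * f (x(n := y))) = ?K (Suc n) (x(n := y)) * f (x(n := y))"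
        by (simp add: mult.assoc[symmetric] flip: ennreal_mult)
    qed
    finally show "?K n x * g x = (\<integral>\<^sup>+y. ?K (Suc n) (x(n := y)) * f (x(n := y)) \<partial>lborel)" .
  qed
  also have "\<dots> = (\<integral>\<^sup>+x. ?K (Suc n) x * f x \<partial>L.vec (Suc n))"
    by (rule L.vec_Suc(1)[symmetric]) measurable
  finally show ?case .
qed

text \<open>The linear change of variables for the multiples by \<open>c\<close> of the unit
  vectors, whose Gram determinant is (c^n)^2.\<close>

lemma nn_integral_vec_scale:
  assumes f: "f \<in> borel_measurable (borel_vec n)" and c: "c > 0"
  shows "(\<integral>\<^sup>+y. f y \<partial>L.vec n) = ennreal (c ^ n) * (\<integral>\<^sup>+y. f (\<lambda>k\<in>{..<n}. c * y k) \<partial>L.vec n)"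
proof -
  define vs where "vs = map (\<lambda>i k. if k = i then c else 0) (rev [0..<n])"
  have "gram_det n vs = (c ^ n)\<^sup>2"
    unfolding vs_def by (induction n) (simp_all add: gram_det_Suc_axis power_mult_distrib del: gram_det.simps(2))
  moreover have "lin n vs y = (\<lambda>k\<in>{..<n}. c * y k)" for y
    by (auto simp: lin_def vs_def comb_map_rev fun_eq_iff if_distrib[of "\<lambda>c. _ * c"] cong: if_cong)
  ultimately show ?thesis
    using lin_iso_if_gram_det[of vs n] f c unfolding lin_iso_def by (auto simp: vs_def)
qed

definition gamma_measure :: "real \<Rightarrow> real measure" where
  "gamma_measure a = density lborel (\<lambda>u. ennreal (indicator {0<..} u * (u powr (a - 1) / exp u / Gamma a)))"

text \<open>By homogeneity the volume of the ball |x|^2 / 2 \<le> u is u^(n/2) times its value at u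
  = 1, and differentiation in u gives the density. The constant stays unspecified here; the total
  mass of the Gaussian law determines it afterwards.\<close>

lemma lborel_half_norm:
  assumes n: "n > 0"
  shows "\<exists>C\<ge>0. distr (L.vec n) borel (\<lambda>x. ip n x x / 2) =
    density lborel (\<lambda>u. ennreal (indicator {0<..} u * (C * u powr (n / 2 - 1))))"
proof -
  let ?q = "\<lambda>x. ip n x x / 2"
  have q[measurable]: "?q \<in> borel_measurable (L.vec n)"
    using ip_measurable[of n] by (simp cong: measurable_cong_sets add: L.sets_vec)
  have qb: "?q \<in> borel_measurable (borel_vec n)" using ip_measurable[of n] by simp
  define V where "V u = emeasure (distr (L.vec n) borel ?q) {..u}" for u
  have V: "V u = (\<integral>\<^sup>+x. indicator {..u} (?q x) \<partial>L.vec n)" for u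
    unfolding V_def by (rule emeasure_distr_nn_integral) (use q in auto)
  have Vle0: "V u = 0" if "u \<le> 0" for u
  proof -
    obtain m where m: "n = Suc m" using n by (cases n) auto
    have null: "{y \<in> extensional {..<n}. y m = 0} \<in> null_sets (L.vec n)"
      using null_hyperplane[OF rots_id, of m 0] m by simp
    have sub: "?q -` {..u} \<inter> space (L.vec n) \<subseteq> {y \<in> extensional {..<n}. y m = 0}"
    proof
      fix x assume x: "x \<in> ?q -` {..u} \<inter> space (L.vec n)"
      then have "ip n x x = 0" using ip_self_nonneg[of n x] that by simp
      then have "x m = 0" using m by (simp add: ip_self_eq_0_iff)
      then show "x \<in> {y \<in> extensional {..<n}. y m = 0}" using x by (simp add: L.space_vec)
    qed
    have "emeasure (L.vec n) (?q -` {..u} \<inter> space (L.vec n)) = 0"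
      using null_sets_subset[OF null measurable_sets[OF q] sub] by auto
    then show ?thesis unfolding V_def by (subst emeasure_distr) auto
  qed
  have Vscale: "V u = ennreal (sqrt u ^ n) * V 1" if "u > 0" for u
  proof -
    have "V u = ennreal (sqrt u ^ n) * (\<integral>\<^sup>+y. indicator {..u} (?q (\<lambda>k\<in>{..<n}. sqrt u * y k)) \<partial>L.vec n)"
      unfolding V using qb that by (intro nn_integral_vec_scale) auto
    moreover have "?q (\<lambda>k\<in>{..<n}. sqrt u * y k) = u * ?q y" for y
    proof -
      have "ip n (\<lambda>k\<in>{..<n}. sqrt u * y k) (\<lambda>k\<in>{..<n}. sqrt u * y k) = (\<Sum>k<n. (sqrt u * sqrt u) * (y k * y k))"
        unfolding ip_def by (intro sum.cong) (auto simp: mult_ac)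
      then show ?thesis using that by (simp add: ip_def sum_distrib_left)
    qed
    moreover have "(\<integral>\<^sup>+y. indicator {..u} (u * ?q y) \<partial>L.vec n) = V 1"
      unfolding V using that by (intro nn_integral_cong) (simp add: indicator_def)
    ultimately show ?thesis by simp
  qed
  have V1: "V 1 < \<infinity>"
  proof -
    have "V 1 = emeasure (L.vec n) (?q -` {..1} \<inter> space (L.vec n))"
      unfolding V_def by (subst emeasure_distr) auto
    \<comment> \<open>A crude bound: only finiteness matters, and the ball |x|^2 \<le> 2 lies in the
      cube with side [-2, 2].\<close>
    also have "\<dots> \<le> emeasure (L.vec n) (PiE {..<n} (\<lambda>_. {-2..2}))"
    proof (rule emeasure_mono)
      show "?q -` {..1} \<inter> space (L.vec n) \<subseteq> PiE {..<n} (\<lambda>_. {-2..2})"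
      proof
        fix x assume x: "x \<in> ?q -` {..1} \<inter> space (L.vec n)"
        have "x k \<in> {-2..2}" if "k < n" for k
        proof -
          have "(x k)\<^sup>2 \<le> ip n x x"
            unfolding ip_def power2_eq_square by (rule member_le_sum) (use that in auto)
          then have "(x k)\<^sup>2 \<le> 2\<^sup>2" using x by auto
          then have "\<bar>x k\<bar> \<le> 2" using power2_le_iff_abs_le[of 2 "x k"] by simp
          then show ?thesis by auto
        qed
        then show "x \<in> PiE {..<n} (\<lambda>_. {-2..2})" using x by (auto simp: L.space_vec PiE_def)
      qed
      show "PiE {..<n} (\<lambda>_. {-2..2}) \<in> sets (L.vec n)" by (intro sets_PiM_I_finite) auto
    qed
    also have "\<dots> = (\<Prod>k<n. emeasure lborel {-2..2::real})" by (rule L.P.emeasure_PiM) auto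
    also have "\<dots> < \<infinity>" by (simp add: ennreal_power flip: ennreal_numeral)
    finally show ?thesis .
  qed
  define c where "c = enn2real (V 1)"
  have c: "V 1 = ennreal c" "c \<ge> 0" using V1 by (auto simp: c_def)
  define D where "D = density lborel (\<lambda>u. ennreal (indicator {0<..} u * (c * (n / 2) * u powr (n / 2 - 1))))"
  have D: "emeasure D {..u} = V u" for u
  proof -
    have "emeasure D {..u} = (\<integral>\<^sup>+x. ennreal (indicator {0<..} x * (c * (n / 2) * x powr (n / 2 - 1))) * indicator {..u} x \<partial>lborel)"
      unfolding D_def by (rule emeasure_density) auto
    also have "\<dots> = V u"
    proof (cases "u > 0")
      case False
      then have "(\<integral>\<^sup>+x. ennreal (indicator {0<..} x * (c * (n / 2) * x powr (n / 2 - 1))) * indicator {..u} x \<partial>lborel) = (\<integral>\<^sup>+x. 0 \<partial>(lborel :: real measure))"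
        by (intro nn_integral_cong) (auto simp: indicator_def)
      then show ?thesis using Vle0[of u] False by simp
    next
      case True
      have "(\<integral>\<^sup>+x. ennreal (indicator {0<..} x * (c * (n / 2) * x powr (n / 2 - 1))) * indicator {..u} x \<partial>lborel) =
        (\<integral>\<^sup>+x. ennreal (c * (n / 2)) * (ennreal (x powr (n / 2 - 1)) * indicator {0..u} x) \<partial>lborel)"
        using c by (intro nn_integral_cong) (auto simp: indicator_def ennreal_mult[symmetric])
      also have "\<dots> = ennreal (c * (n / 2)) * (\<integral>\<^sup>+x. ennreal (x powr (n / 2 - 1)) * indicator {0..u} x \<partial>lborel)"
        by (rule nn_integral_cmult) measurable
      also have "(\<integral>\<^sup>+x. ennreal (x powr (n / 2 - 1)) * indicator {0..u} x \<partial>lborel) = ennreal (u powr (n / 2 - 1 + 1) / (n / 2 - 1 + 1))"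
        by (rule nn_integral_has_integral_lebesgue'[OF _ has_integral_powr_from_0]) (use n True in auto)
      also have "ennreal (c * (n / 2)) * ennreal (u powr (n / 2 - 1 + 1) / (n / 2 - 1 + 1)) = ennreal (u powr (n / 2)) * ennreal c"
        using c n by (simp add: ennreal_mult[symmetric] mult.commute)
      also have "u powr (n / 2) = sqrt u ^ n"
        using True by (simp add: powr_half_sqrt[symmetric] powr_powr powr_realpow[symmetric] del: powr_realpow)
      also have "ennreal (sqrt u ^ n) * ennreal c = V u" using Vscale[OF True] c by simp
      finally show ?thesis .
    qed
    finally show ?thesis .
  qed
  have "distr (L.vec n) borel ?q = D"
  proof (rule measure_eqI_generator_eq[where \<Omega>=UNIV and E="range (\<lambda>a::real. {..a})" and A="\<lambda>i::nat. {..real i}"])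
    show "Int_stable (range (\<lambda>a::real. {..a}))" by (auto simp: Int_stable_def)
    show "sets (distr (L.vec n) borel ?q) = sigma_sets UNIV (range atMost)"
      by (simp add: borel_eq_atMost)
    show "sets D = sigma_sets UNIV (range atMost)" by (simp add: D_def borel_eq_atMost)
    show "(\<Union>i. {..real i}) = UNIV" by (auto simp: real_arch_simple)
    show "emeasure (distr (L.vec n) borel ?q) {..real i} \<noteq> \<infinity>" for i
      using Vle0[of "real i"] Vscale[of "real i"] c by (cases "i = 0") (auto simp: V_def[symmetric] ennreal_mult[symmetric])
  qed (auto simp: D V_def)
  then show ?thesis using c by (intro exI[of _ "c * (n / 2)"]) (simp add: D_def)
qed

lemma gaussian_half_norm:
  assumes n: "n > 0"
  shows "distr (N.vec n) borel (\<lambda>x. ip n x x / 2) = gamma_measure (n / 2)"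
proof -
  obtain C where C: "C \<ge> 0" "distr (L.vec n) borel (\<lambda>x. ip n x x / 2) =
    density lborel (\<lambda>u. ennreal (indicator {0<..} u * (C * u powr (n / 2 - 1))))"
    using lborel_half_norm[OF n] by auto
  define K where "K = (1 / sqrt (2 * pi)) ^ n"
  have K: "K \<ge> 0" by (simp add: K_def)
  note ip_measurable[measurable]
  have *: "(\<integral>\<^sup>+x. f (ip n x x / 2) \<partial>N.vec n) =
    (\<integral>\<^sup>+u. ennreal (K * C) * (ennreal (indicator {0..} u * u powr (n / 2 - 1) / exp u) * f u) \<partial>lborel)"
    if [measurable]: "f \<in> borel_measurable borel" for f
  proof -
    have q[measurable]: "(\<lambda>x. ip n x x / 2) \<in> borel_measurable (L.vec n)"
      using ip_measurable[of n] by (simp cong: measurable_cong_sets add: L.sets_vec)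
    have "(\<integral>\<^sup>+x. f (ip n x x / 2) \<partial>N.vec n) =
       (\<integral>\<^sup>+x. ennreal (K * exp (- (ip n x x / 2))) * f (ip n x x / 2) \<partial>L.vec n)"
      by (subst nn_integral_gaussian_vec) (simp_all add: K_def)
    also have "\<dots> = (\<integral>\<^sup>+u. ennreal (K * exp (- u)) * f u \<partial>distr (L.vec n) borel (\<lambda>x. ip n x x / 2))"
      by (subst nn_integral_distr) auto
    also have "\<dots> = (\<integral>\<^sup>+u. ennreal (indicator {0<..} u * (C * u powr (n / 2 - 1))) * (ennreal (K * exp (- u)) * f u) \<partial>lborel)"
      unfolding C(2) by (subst nn_integral_density) auto
    also have "\<dots> = (\<integral>\<^sup>+u. ennreal (K * C) * (ennreal (indicator {0..} u * u powr (n / 2 - 1) / exp u) * f u) \<partial>lborel)"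
    proof (rule nn_integral_cong)
      fix u :: real
      have "exp (- u) = 1 / exp u" by (simp add: exp_minus inverse_eq_divide)
      then have "indicator {0<..} u * (C * u powr (n / 2 - 1)) * (K * exp (- u)) =
         K * C * (indicator {0..} u * u powr (n / 2 - 1) / exp u)"
        by (cases "u = 0"; cases "u > 0") (simp_all add: indicator_def)
      then have "ennreal (indicator {0<..} u * (C * u powr (n / 2 - 1))) * ennreal (K * exp (- u)) =
         ennreal (K * C) * ennreal (indicator {0..} u * u powr (n / 2 - 1) / exp u)"
        using K C(1) by (simp flip: ennreal_mult)
      then show "ennreal (indicator {0<..} u * (C * u powr (n / 2 - 1))) * (ennreal (K * exp (- u)) * f u) =
         ennreal (K * C) * (ennreal (indicator {0..} u * u powr (n / 2 - 1) / exp u) * f u)"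
        by (simp add: mult.assoc[symmetric])
    qed
    finally show ?thesis .
  qed
  interpret P: prob_space "N.vec n"
    by (intro prob_space_PiM prob_space_normal_density) simp
  \<comment> \<open>The law is known up to the constant \<open>K * C\<close>. Comparing its total
    mass 1 with Euler's integral for \<Gamma>(n / 2) identifies this constant.\<close>
  have "1 = (\<integral>\<^sup>+x. 1 \<partial>N.vec n)" by (simp add: P.emeasure_space_1)
  also have "\<dots> = ennreal (K * C) * (\<integral>\<^sup>+u. ennreal (indicator {0..} u * u powr (n / 2 - 1) / exp u) \<partial>lborel)"
    using *[of "\<lambda>_. 1"] by (simp add: nn_integral_cmult)
  also have "(\<integral>\<^sup>+u. ennreal (indicator {0..} u * u powr (n / 2 - 1) / exp u) \<partial>lborel) = ennreal (Gamma (n / 2))"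
    using n by (subst Gamma_conv_nn_integral_real) auto
  finally have "ennreal (K * C * Gamma (n / 2)) = 1"
    using K C n by (simp add: ennreal_mult)
  then have KC: "K * C = 1 / Gamma (n / 2)"
    using n by (simp add: ennreal_eq_1 field_simps Gamma_real_pos less_imp_neq[OF Gamma_real_pos, symmetric])
  show ?thesis
  proof (rule measure_eqI)
    fix A assume "A \<in> sets (distr (N.vec n) borel (\<lambda>x. ip n x x / 2))"
    then have A[measurable]: "A \<in> sets borel" by simp
    have q[measurable]: "(\<lambda>x. ip n x x / 2) \<in> borel_measurable (N.vec n)"
      using ip_measurable[of n] by (simp cong: measurable_cong_sets add: N.sets_vec)
    have "emeasure (distr (N.vec n) borel (\<lambda>x. ip n x x / 2)) A = (\<integral>\<^sup>+x. indicator A (ip n x x / 2) \<partial>N.vec n)"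
      by (rule emeasure_distr_nn_integral) (use q in auto)
    also have "\<dots> = (\<integral>\<^sup>+u. ennreal (indicator {0<..} u * (u powr (n / 2 - 1) / exp u / Gamma (n / 2))) * indicator A u \<partial>lborel)"
    proof (subst *)
      show "(\<integral>\<^sup>+u. ennreal (K * C) * (ennreal (indicator {0..} u * u powr (n / 2 - 1) / exp u) * indicator A u) \<partial>lborel) =
        (\<integral>\<^sup>+u. ennreal (indicator {0<..} u * (u powr (n / 2 - 1) / exp u / Gamma (n / 2))) * indicator A u \<partial>lborel)"
      proof (rule nn_integral_cong)
        fix u :: real
        have "K * C * (indicator {0..} u * u powr (n / 2 - 1) / exp u) =
          indicator {0<..} u * (u powr (n / 2 - 1) / exp u / Gamma (n / 2))"
          unfolding KC by (cases "u = 0") (auto simp: indicator_def)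
        then have "ennreal (K * C) * ennreal (indicator {0..} u * u powr (n / 2 - 1) / exp u) =
          ennreal (indicator {0<..} u * (u powr (n / 2 - 1) / exp u / Gamma (n / 2)))"
          using K C(1) by (simp flip: ennreal_mult)
        then show "ennreal (K * C) * (ennreal (indicator {0..} u * u powr (n / 2 - 1) / exp u) * indicator A u) =
          ennreal (indicator {0<..} u * (u powr (n / 2 - 1) / exp u / Gamma (n / 2))) * indicator A u"
          by (simp add: mult.assoc[symmetric])
      qed
    qed simp
    also have "\<dots> = emeasure (gamma_measure (n / 2)) A"
      unfolding gamma_measure_def by (subst emeasure_density) auto
    finally show "emeasure (distr (N.vec n) borel (\<lambda>x. ip n x x / 2)) A = emeasure (gamma_measure (n / 2)) A" .
  qed (simp add: gamma_measure_def)
qed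

lemma prob_space_gaussian_vec: "prob_space (N.vec n)"
  by (intro prob_space_PiM prob_space_normal_density) simp

section \<open>The Gram determinant of the edges of a Gaussian simplex\<close>

abbreviation vecs :: "nat \<Rightarrow> nat \<Rightarrow> (nat \<Rightarrow> nat \<Rightarrow> real) measure" where
  "vecs r n \<equiv> PiM {..<r} (\<lambda>_. borel_vec n)"

abbreviation gaussian_vecs :: "nat \<Rightarrow> nat \<Rightarrow> (nat \<Rightarrow> nat \<Rightarrow> real) measure" where
  "gaussian_vecs r n \<equiv> PiM {..<r} (\<lambda>_. N.vec n)"

lemma prob_space_gaussian_vecs: "prob_space (gaussian_vecs r n)"
  by (intro prob_space_PiM prob_space_gaussian_vec)

lemma sets_gaussian_vecs: "sets (gaussian_vecs r n) = sets (vecs r n)"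
  by (intro sets_PiM_cong refl N.sets_vec)

lemma measurable_entry: "i < r \<Longrightarrow> k < n \<Longrightarrow> (\<lambda>\<omega>. \<omega> i k) \<in> borel_measurable (vecs r n)"
  by (rule measurable_compose[OF measurable_component_singleton[of i "{..<r}"] measurable_coord[of k n]]) auto

text \<open>For \<open>\<alpha> = 1\<close> these are the edges at the vertex \<open>x\<close>. The parameter \<open>\<alpha>\<close> is needed for the induction,
  which replaces it by \<open>\<alpha> / sqrt (1 + \<alpha>\<^sup>2)\<close>.\<close>

definition centered :: "nat \<Rightarrow> real \<Rightarrow> (nat \<Rightarrow> real) \<Rightarrow> (nat \<Rightarrow> nat \<Rightarrow> real) \<Rightarrow> (nat \<Rightarrow> real) list" where
  "centered r \<alpha> x \<omega> = map (\<lambda>i k. \<omega> i k - \<alpha> * x k) (rev [0..<r])"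

lemma length_centered [simp]: "length (centered r \<alpha> x \<omega>) = r"
  by (simp add: centered_def)

lemma centered_nth: "i < r \<Longrightarrow> centered r \<alpha> x \<omega> ! i = (\<lambda>k. \<omega> (r - Suc i) k - \<alpha> * x k)"
  by (simp add: centered_def rev_nth)

lemma gram_det_family_measurable:
  assumes "\<And>i k. i < r \<Longrightarrow> k < n \<Longrightarrow> (\<lambda>p. V p i k) \<in> borel_measurable M"
  shows "(\<lambda>p. gram_det n (map (V p) (rev [0..<r]))) \<in> borel_measurable M"
proof -
  have "(\<lambda>p. gram_det n (map (\<lambda>v. v p) (map (\<lambda>i p. V p i) (rev [0..<r])))) \<in> borel_measurable M"
    by (rule gram_det_measurable) (use assms in auto)
  then show ?thesis by (simp add: comp_def)
qed

lemma centered_measurable: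
  "(\<lambda>p. gram_det n (centered r \<alpha> (fst p) (snd p))) \<in> borel_measurable (borel_vec n \<Otimes>\<^sub>M vecs r n)"
  unfolding centered_def
proof (rule gram_det_family_measurable)
  fix i k assume "i < r" "k < n"
  note [measurable] = measurable_entry[OF this] measurable_coord[OF \<open>k < n\<close>]
  show "(\<lambda>p. snd p i k - \<alpha> * fst p k) \<in> borel_measurable (borel_vec n \<Otimes>\<^sub>M vecs r n)" by measurable
qed

lemma gaussian_vecs_Suc:
  assumes "f \<in> borel_measurable (vecs (Suc r) n)"
  shows "(\<integral>\<^sup>+\<omega>. f \<omega> \<partial>gaussian_vecs (Suc r) n) =
    (\<integral>\<^sup>+y. \<integral>\<^sup>+w. f (w(r := y)) \<partial>gaussian_vecs r n \<partial>N.vec n)"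
proof -
  interpret V: sigma_finite_measure "N.vec n" by (rule N.sigma_finite_vec)
  interpret PW: product_sigma_finite "\<lambda>_::nat. N.vec n" ..
  have e: "{..<Suc r} = insert r {..<r}" by (rule lessThan_Suc)
  have "f \<in> borel_measurable (gaussian_vecs (Suc r) n)"
    using assms by (simp cong: measurable_cong_sets add: sets_gaussian_vecs)
  then show ?thesis unfolding e by (intro PW.product_nn_integral_insert_rev) auto
qed

lemma nn_integral_gram_det_measurable:
  fixes f :: "real \<Rightarrow> ennreal"
  assumes f: "f \<in> borel_measurable borel"
    and A: "\<And>k. k < n \<Longrightarrow> (\<lambda>p. A p k) \<in> borel_measurable M"
    and B: "\<And>i k. i < r \<Longrightarrow> k < n \<Longrightarrow> (\<lambda>q. B (fst q) (snd q) i k) \<in> borel_measurable (M \<Otimes>\<^sub>M vecs r n)"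
  shows "(\<lambda>p. \<integral>\<^sup>+\<omega>. f (gram_det n (A p # map (B p \<omega>) (rev [0..<r]))) \<partial>gaussian_vecs r n) \<in> borel_measurable M"
proof -
  interpret W: prob_space "gaussian_vecs r n" by (rule prob_space_gaussian_vecs)
  define V where "V q i = (if i = r then A (fst q) else B (fst q) (snd q) i)" for q i
  have "(\<lambda>q. gram_det n (map (V q) (rev [0..<Suc r]))) \<in> borel_measurable (M \<Otimes>\<^sub>M vecs r n)"
  proof (rule gram_det_family_measurable)
    fix i k assume "i < Suc r" "k < n"
    then show "(\<lambda>q. V q i k) \<in> borel_measurable (M \<Otimes>\<^sub>M vecs r n)"
      using B[of i k] measurable_compose[OF measurable_fst A[of k]] by (cases "i = r") (auto simp: V_def)
  qed
  moreover have "map (V q) (rev [0..<Suc r]) = A (fst q) # map (B (fst q) (snd q)) (rev [0..<r])" for q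
    by (auto simp: V_def)
  ultimately have "(\<lambda>q. gram_det n (A (fst q) # map (B (fst q) (snd q)) (rev [0..<r]))) \<in> borel_measurable (M \<Otimes>\<^sub>M vecs r n)"
    by (simp only:)
  from measurable_compose[OF this f]
  have "(\<lambda>(p, \<omega>). f (gram_det n (A p # map (B p \<omega>) (rev [0..<r])))) \<in> borel_measurable (M \<Otimes>\<^sub>M vecs r n)"
    by (simp add: case_prod_unfold)
  then have "(\<lambda>(p, \<omega>). f (gram_det n (A p # map (B p \<omega>) (rev [0..<r])))) \<in> borel_measurable (M \<Otimes>\<^sub>M gaussian_vecs r n)"
    by (simp cong: measurable_cong_sets sets_pair_measure_cong add: sets_gaussian_vecs)
  then show ?thesis by (rule W.borel_measurable_nn_integral)
qed

text \<open>If \<open>g\<close> rotates a vector into the last axis, these are orthonormal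
  coordinates of the projection of \<open>x\<close> to the orthogonal complement of that
  vector.\<close>

definition project_rot :: "((nat \<Rightarrow> real) \<Rightarrow> nat \<Rightarrow> real) \<Rightarrow> nat \<Rightarrow> (nat \<Rightarrow> real) \<Rightarrow> nat \<Rightarrow> real" where
  "project_rot g m x = restrict (g x) {..<m}"

lemma project_rot_measurable:
  assumes "g \<in> rots (Suc m)"
  shows "project_rot g m \<in> borel_vec (Suc m) \<rightarrow>\<^sub>M borel_vec m"
  unfolding project_rot_def
  by (intro measurable_restrict measurable_compose[OF rots_measurable[OF assms] measurable_coord]) auto

text \<open>A rotated Gaussian vector is again Gaussian, and dropping its last coordinate leaves a
  Gaussian vector in one dimension less.\<close>

lemma distr_project_rot:
  assumes g: "g \<in> rots (Suc m)"
  shows "distr (N.vec (Suc m)) (N.vec m) (project_rot g m) = N.vec m"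
proof (rule measure_eqI)
  fix A assume "A \<in> sets (distr (N.vec (Suc m)) (N.vec m) (project_rot g m))"
  then have A: "A \<in> sets (N.vec m)" "A \<in> sets (borel_vec m)" by (auto simp: N.sets_vec)
  let ?h = "\<lambda>x. indicator A (restrict x {..<m}) :: ennreal"
  have h: "?h \<in> borel_measurable (borel_vec (Suc m))"
    using project_rot_measurable[OF rots_id, of m] A(2) unfolding project_rot_def by simp
  interpret P: prob_space std_normal_distribution by (rule prob_space_normal_density) simp
  have "emeasure (distr (N.vec (Suc m)) (N.vec m) (project_rot g m)) A = (\<integral>\<^sup>+x. ?h (g x) \<partial>N.vec (Suc m))"
    unfolding project_rot_def[symmetric]
    using project_rot_measurable[OF g] A
    by (intro emeasure_distr_nn_integral) (simp_all cong: measurable_cong_sets add: N.sets_vec)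
  also have "\<dots> = (\<integral>\<^sup>+x. ?h x \<partial>N.vec (Suc m))" by (rule N.nn_integral_rots[OF g h])
  also have "\<dots> = (\<integral>\<^sup>+x. \<integral>\<^sup>+y. ?h (x(m := y)) \<partial>std_normal_distribution \<partial>N.vec m)" by (rule N.vec_Suc(1)[OF h])
  also have "\<dots> = (\<integral>\<^sup>+x. indicator A x \<partial>N.vec m)"
  proof (rule nn_integral_cong)
    fix x assume "x \<in> space (N.vec m)"
    then have "restrict (x(m := y)) {..<m} = x" for y by (auto simp: N.space_vec extensional_def fun_eq_iff)
    then show "(\<integral>\<^sup>+y. ?h (x(m := y)) \<partial>std_normal_distribution) = indicator A x"
      using P.emeasure_space_1 by simp
  qed
  also have "\<dots> = emeasure (N.vec m) A" using A by simp
  finally show "emeasure (distr (N.vec (Suc m)) (N.vec m) (project_rot g m)) A = emeasure (N.vec m) A" .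
qed simp

lemma nn_integral_project_rot:
  assumes g: "g \<in> rots (Suc m)" and H: "H \<in> borel_measurable (borel_vec m \<Otimes>\<^sub>M vecs r m)"
  shows "(\<integral>\<^sup>+x. \<integral>\<^sup>+\<omega>. H (project_rot g m x, \<lambda>i\<in>{..<r}. project_rot g m (\<omega> i)) \<partial>gaussian_vecs r (Suc m) \<partial>N.vec (Suc m)) =
    (\<integral>\<^sup>+x. \<integral>\<^sup>+\<omega>. H (x, \<omega>) \<partial>gaussian_vecs r m \<partial>N.vec m)"
proof -
  let ?p = "project_rot g m"
  have p: "?p \<in> N.vec (Suc m) \<rightarrow>\<^sub>M N.vec m"
    using project_rot_measurable[OF g] by (simp cong: measurable_cong_sets add: N.sets_vec)
  have H': "H \<in> borel_measurable (N.vec m \<Otimes>\<^sub>M gaussian_vecs r m)"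
    using H by (simp cong: measurable_cong_sets sets_pair_measure_cong add: N.sets_vec sets_gaussian_vecs)
  have d: "distr (gaussian_vecs r (Suc m)) (gaussian_vecs r m) (compose {..<r} ?p) = gaussian_vecs r m"
    using distr_PiM_finite_prob_space'[of "{..<r}" "\<lambda>_. N.vec (Suc m)" "\<lambda>_. N.vec m" ?p] p
    by (simp add: prob_space_gaussian_vec distr_project_rot[OF g])
  have c: "compose {..<r} ?p \<in> gaussian_vecs r (Suc m) \<rightarrow>\<^sub>M gaussian_vecs r m"
    unfolding compose_def by (intro measurable_restrict measurable_compose[OF _ p] measurable_component_singleton) auto
  interpret S: sigma_finite_measure "gaussian_vecs r m"
    using prob_space_gaussian_vecs prob_space_imp_sigma_finite by blast
  have inner: "(\<integral>\<^sup>+\<omega>. H (y, \<lambda>i\<in>{..<r}. ?p (\<omega> i)) \<partial>gaussian_vecs r (Suc m)) = (\<integral>\<^sup>+\<omega>. H (y, \<omega>) \<partial>gaussian_vecs r m)"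
    if y: "y \<in> space (N.vec m)" for y
  proof -
    have my: "(\<lambda>\<omega>. H (y, \<omega>)) \<in> borel_measurable (gaussian_vecs r m)"
      using measurable_compose[OF measurable_Pair1'[OF y] H'] .
    have "(\<integral>\<^sup>+\<omega>. H (y, \<omega>) \<partial>gaussian_vecs r m) =
      (\<integral>\<^sup>+\<omega>. H (y, \<omega>) \<partial>distr (gaussian_vecs r (Suc m)) (gaussian_vecs r m) (compose {..<r} ?p))"
      by (simp only: d)
    also have "\<dots> = (\<integral>\<^sup>+\<omega>. H (y, compose {..<r} ?p \<omega>) \<partial>gaussian_vecs r (Suc m))"
      by (rule nn_integral_distr[OF c]) (use my in simp)
    finally show ?thesis by (simp add: compose_def)
  qed
  have m: "(\<lambda>y. \<integral>\<^sup>+\<omega>. H (y, \<omega>) \<partial>gaussian_vecs r m) \<in> borel_measurable (N.vec m)"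
    by (rule S.borel_measurable_nn_integral) (use H' in simp)
  have "(\<integral>\<^sup>+x. \<integral>\<^sup>+\<omega>. H (?p x, \<lambda>i\<in>{..<r}. ?p (\<omega> i)) \<partial>gaussian_vecs r (Suc m) \<partial>N.vec (Suc m)) =
     (\<integral>\<^sup>+x. (\<integral>\<^sup>+\<omega>. H (?p x, \<omega>) \<partial>gaussian_vecs r m) \<partial>N.vec (Suc m))"
    by (intro nn_integral_cong inner) (use measurable_space[OF p] in auto)
  also have "\<dots> = (\<integral>\<^sup>+y. (\<integral>\<^sup>+\<omega>. H (y, \<omega>) \<partial>gaussian_vecs r m) \<partial>distr (N.vec (Suc m)) (N.vec m) ?p)"
    by (rule nn_integral_distr[OF p, symmetric]) (use m in simp)
  finally show ?thesis by (simp add: distr_project_rot[OF g])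
qed

text \<open>Let \<open>y\<close> be the last point and \<open>\<rho> = sqrt (1 + \<alpha>\<^sup>2)\<close>. The rotation of the pair \<open>(x, y)\<close> that carries
  \<open>y - \<alpha> x\<close> to \<open>\<rho> y\<close> preserves the law and turns \<open>\<alpha> x\<close> into \<open>\<beta> x - \<alpha> \<beta> y\<close>. The determinant then only
  depends on the length of \<open>y\<close> and on the projections of the other points orthogonally to \<open>y\<close>, in which
  the multiple of \<open>y\<close> disappears.\<close>

lemma gram_det_centered_step:
  fixes m r :: nat and \<alpha> :: real
  assumes f[measurable]: "f \<in> borel_measurable borel"
  defines "\<beta> \<equiv> \<alpha> / sqrt (1 + \<alpha>\<^sup>2)"
  shows "(\<integral>\<^sup>+x. \<integral>\<^sup>+\<omega>. f (gram_det (Suc m) (centered (Suc r) \<alpha> x \<omega>)) \<partial>gaussian_vecs (Suc r) (Suc m) \<partial>N.vec (Suc m)) =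
    (\<integral>\<^sup>+u. \<integral>\<^sup>+x. \<integral>\<^sup>+\<omega>. f (2 * (1 + \<alpha>\<^sup>2) * u * gram_det m (centered r \<beta> x \<omega>)) \<partial>gaussian_vecs r m \<partial>N.vec m
      \<partial>gamma_measure (real (Suc m) / 2))"
proof -
  let ?n = "Suc m"
  define \<rho> where "\<rho> = sqrt (1 + \<alpha>\<^sup>2)"
  have pos: "1 + \<alpha>\<^sup>2 > 0" by (simp add: add_pos_nonneg)
  have \<rho>: "\<rho> > 0" "\<rho>\<^sup>2 = 1 + \<alpha>\<^sup>2" using pos by (auto simp: \<rho>_def)
  have \<beta>: "\<beta> = \<alpha> / \<rho>" by (simp add: \<beta>_def \<rho>_def)
  interpret V: prob_space "N.vec ?n" by (rule prob_space_gaussian_vec)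
  interpret V': prob_space "N.vec m" by (rule prob_space_gaussian_vec)
  interpret W: prob_space "gaussian_vecs r ?n" by (rule prob_space_gaussian_vecs)
  interpret W': prob_space "gaussian_vecs r m" by (rule prob_space_gaussian_vecs)
  interpret VV: pair_sigma_finite "N.vec ?n" "N.vec ?n" ..
  interpret PW: product_sigma_finite "\<lambda>_::nat. N.vec ?n" ..
  let ?X = "\<lambda>x y. \<lambda>k\<in>{..<?n}. 1 / \<rho> * x k + - \<alpha> / \<rho> * y k" and ?Y = "\<lambda>x y. \<lambda>k\<in>{..<?n}. 1 / \<rho> * y k - - \<alpha> / \<rho> * x k"
  let ?L = "\<lambda>x y \<omega>. (\<lambda>k. ?Y x y k - \<alpha> * ?X x y k) # centered r \<alpha> (?X x y) \<omega>"
  let ?R = "\<lambda>x y \<omega>. (\<lambda>k. \<rho> * y k) # map (\<lambda>i k. \<omega> i k - \<beta> * x k + \<alpha> * \<beta> * y k) (rev [0..<r])"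
  note entry = measurable_entry and coord = measurable_coord
  define F where "F = (\<lambda>p. \<integral>\<^sup>+\<omega>. f (gram_det ?n ((\<lambda>k. snd p k - \<alpha> * fst p k) # centered r \<alpha> (fst p) \<omega>)) \<partial>gaussian_vecs r ?n)"
  define F2 where "F2 = (\<lambda>p. \<integral>\<^sup>+\<omega>. f (gram_det ?n ((\<lambda>k. \<rho> * snd p k) #
      map (\<lambda>i k. \<omega> i k - \<beta> * fst p k + \<alpha> * \<beta> * snd p k) (rev [0..<r]))) \<partial>gaussian_vecs r ?n)"
  have [measurable]: "(\<lambda>x. x k) \<in> borel_measurable (borel_vec ?n)" if "k < ?n" for k
    by (rule coord[OF that])
  have [measurable]: "(\<lambda>\<omega>. \<omega> i k) \<in> borel_measurable (vecs r ?n)" if "i < r" "k < ?n" for i k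
    by (rule entry[OF that])
  have F: "F \<in> borel_measurable (borel_vec ?n \<Otimes>\<^sub>M borel_vec ?n)"
    unfolding F_def centered_def by (rule nn_integral_gram_det_measurable[OF f]) measurable
  have F2: "F2 \<in> borel_measurable (borel_vec ?n \<Otimes>\<^sub>M borel_vec ?n)"
    unfolding F2_def by (rule nn_integral_gram_det_measurable[OF f]) measurable
  have "(\<integral>\<^sup>+x. \<integral>\<^sup>+\<omega>. f (gram_det ?n (centered (Suc r) \<alpha> x \<omega>)) \<partial>gaussian_vecs (Suc r) ?n \<partial>N.vec ?n) =
     (\<integral>\<^sup>+x. \<integral>\<^sup>+y. F (x, y) \<partial>N.vec ?n \<partial>N.vec ?n)"
  proof (rule nn_integral_cong)
    fix x assume x: "x \<in> space (N.vec ?n)"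
    have m: "(\<lambda>\<omega>. f (gram_det ?n (centered (Suc r) \<alpha> x \<omega>))) \<in> borel_measurable (gaussian_vecs (Suc r) ?n)"
    proof -
      have "x \<in> space (borel_vec ?n)" using x by (simp add: N.space_vec space_borel_vec)
      from measurable_compose[OF measurable_Pair1'[OF this] centered_measurable]
      show ?thesis by (simp cong: measurable_cong_sets add: sets_gaussian_vecs)
    qed
    have "(\<integral>\<^sup>+\<omega>. f (gram_det ?n (centered (Suc r) \<alpha> x \<omega>)) \<partial>gaussian_vecs (Suc r) ?n) =
      (\<integral>\<^sup>+y. \<integral>\<^sup>+w. f (gram_det ?n (centered (Suc r) \<alpha> x (w(r := y)))) \<partial>gaussian_vecs r ?n \<partial>N.vec ?n)"
      by (rule gaussian_vecs_Suc) (use m in \<open>simp cong: measurable_cong_sets add: sets_gaussian_vecs\<close>)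
    also have "\<dots> = (\<integral>\<^sup>+y. F (x, y) \<partial>N.vec ?n)"
    proof -
      have "centered (Suc r) \<alpha> x (w(r := y)) = (\<lambda>k. y k - \<alpha> * x k) # centered r \<alpha> x w" for w y
        by (auto simp: centered_def)
      then show ?thesis by (simp add: F_def del: gram_det.simps)
    qed
    finally show "(\<integral>\<^sup>+\<omega>. f (gram_det ?n (centered (Suc r) \<alpha> x \<omega>)) \<partial>gaussian_vecs (Suc r) ?n) = (\<integral>\<^sup>+y. F (x, y) \<partial>N.vec ?n)" .
  qed
  also have "\<dots> = (\<integral>\<^sup>+x. \<integral>\<^sup>+y. F (?X x y, ?Y x y) \<partial>N.vec ?n \<partial>N.vec ?n)"
    by (rule N.nn_integral_rotate_pair[OF F, symmetric])
       (use \<rho> pos in \<open>simp add: power_divide flip: add_divide_distrib\<close>)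
  also have "\<dots> = (\<integral>\<^sup>+x. \<integral>\<^sup>+y. F2 (x, y) \<partial>N.vec ?n \<partial>N.vec ?n)"
  proof (intro nn_integral_cong)
    fix x y :: "nat \<Rightarrow> real"
    have e: "1 / \<rho> * y k - - \<alpha> / \<rho> * x k - \<alpha> * (1 / \<rho> * x k + - \<alpha> / \<rho> * y k) = \<rho> * y k" for k
    proof -
      have "1 / \<rho> * y k - - \<alpha> / \<rho> * x k - \<alpha> * (1 / \<rho> * x k + - \<alpha> / \<rho> * y k) = (1 + \<alpha>\<^sup>2) / \<rho> * y k"
        by (simp add: algebra_simps add_divide_distrib power2_eq_square)
      also have "(1 + \<alpha>\<^sup>2) / \<rho> = \<rho>" using \<rho> by (simp add: power2_eq_square field_simps)
      finally show ?thesis .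
    qed
    have "gram_det ?n (?L x y \<omega>) =
      gram_det ?n (?R x y \<omega>)" for \<omega>
    proof (rule gram_det_coord_cong)
      fix i k assume "i < length (?L x y \<omega>)" and k: "k < ?n"
      then have i: "i < Suc r" by simp
      show "((?L x y \<omega>) ! i) k =
        ((?R x y \<omega>) ! i) k"
      proof (cases i)
        case 0
        then show ?thesis using k e[of k] by simp
      next
        case (Suc j)
        then show ?thesis using i k by (simp add: centered_nth rev_nth \<beta> field_simps)
      qed
    qed simp
    then show "F (?X x y, ?Y x y) = F2 (x, y)"
      unfolding F_def F2_def fst_conv snd_conv by presburger
  qed
  \<comment> \<open>With \<open>y\<close> integrated last it is fixed in the inner integrals, so
    that the rotation \<open>g\<close> taking it to the last axis can be chosen for each
    \<open>y\<close> separately.\<close>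
  also have "\<dots> = (\<integral>\<^sup>+y. \<integral>\<^sup>+x. F2 (x, y) \<partial>N.vec ?n \<partial>N.vec ?n)"
    by (rule VV.Fubini'[symmetric]) (use F2 in \<open>simp cong: measurable_cong_sets sets_pair_measure_cong add: N.sets_vec\<close>)
  also have "\<dots> = (\<integral>\<^sup>+y. \<integral>\<^sup>+x. \<integral>\<^sup>+\<omega>. f (2 * (1 + \<alpha>\<^sup>2) * (ip ?n y y / 2) * gram_det m (centered r \<beta> x \<omega>)) \<partial>gaussian_vecs r m \<partial>N.vec m \<partial>N.vec ?n)"
  proof (rule nn_integral_cong)
    fix y :: "nat \<Rightarrow> real"
    obtain g where g: "g \<in> rots ?n" "\<And>k. k < m \<Longrightarrow> g y k = 0" using rots_to_axis by blast
    let ?p = "project_rot g m"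
    define H where "H = (\<lambda>p. f (2 * (1 + \<alpha>\<^sup>2) * (ip ?n y y / 2) * gram_det m (centered r \<beta> (fst p) (snd p))))"
    have H: "H \<in> borel_measurable (borel_vec m \<Otimes>\<^sub>M vecs r m)"
      unfolding H_def using centered_measurable[of m r \<beta>] by measurable
    have "gram_det ?n (?R x y \<omega>) =
       2 * (1 + \<alpha>\<^sup>2) * (ip ?n y y / 2) * gram_det m (centered r \<beta> (?p x) (\<lambda>i\<in>{..<r}. ?p (\<omega> i)))" for x \<omega>
    proof -
      have "gram_det ?n (?R x y \<omega>) =
        gram_det ?n (g (\<lambda>k. \<rho> * y k) # map (\<lambda>i. g (\<lambda>k. \<omega> i k - \<beta> * x k + \<alpha> * \<beta> * y k)) (rev [0..<r]))"
        by (subst gram_det_rots[OF g(1), symmetric]) (simp add: comp_def del: gram_det.simps)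
      also have "\<dots> = (g (\<lambda>k. \<rho> * y k) m)\<^sup>2 * gram_det m (map (\<lambda>i. g (\<lambda>k. \<omega> i k - \<beta> * x k + \<alpha> * \<beta> * y k)) (rev [0..<r]))"
      proof (rule gram_det_Suc_axis)
        fix k assume "k < m"
        then show "g (\<lambda>k. \<rho> * y k) k = 0" using rots_linear[OF g(1), of \<rho> y 0 y k] g(2) by simp
      qed
      also have "(g (\<lambda>k. \<rho> * y k) m)\<^sup>2 = 2 * (1 + \<alpha>\<^sup>2) * (ip ?n y y / 2)"
      proof -
        have "ip ?n y y = ip ?n (g y) (g y)" by (simp add: rots_ip[OF g(1)])
        also have "\<dots> = (g y m)\<^sup>2" using g(2) by (simp add: ip_def power2_eq_square)
        finally show ?thesis using rots_linear[OF g(1), of \<rho> y 0 y m] \<rho> by (simp add: power_mult_distrib)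
      qed
      also have "gram_det m (map (\<lambda>i. g (\<lambda>k. \<omega> i k - \<beta> * x k + \<alpha> * \<beta> * y k)) (rev [0..<r])) =
         gram_det m (centered r \<beta> (?p x) (\<lambda>i\<in>{..<r}. ?p (\<omega> i)))"
      proof (rule gram_det_coord_cong)
        fix i k assume "i < length (map (\<lambda>i. g (\<lambda>k. \<omega> i k - \<beta> * x k + \<alpha> * \<beta> * y k)) (rev [0..<r]))" and k: "k < m"
        then have i: "i < r" by simp
        have "g (\<lambda>k. \<omega> j k - \<beta> * x k + \<alpha> * \<beta> * y k) k = g (\<omega> j) k - \<beta> * g x k + \<alpha> * \<beta> * g y k" for j
          using rots_linear[OF g(1), of 1 "\<lambda>k. \<omega> j k - \<beta> * x k" "\<alpha> * \<beta>" y k]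
            rots_linear[OF g(1), of 1 "\<omega> j" "-\<beta>" x k] by simp
        then show "(map (\<lambda>i. g (\<lambda>k. \<omega> i k - \<beta> * x k + \<alpha> * \<beta> * y k)) (rev [0..<r]) ! i) k =
          (centered r \<beta> (?p x) (\<lambda>i\<in>{..<r}. ?p (\<omega> i)) ! i) k"
          using i k g(2) by (simp add: centered_nth rev_nth project_rot_def)
      qed simp
      finally show ?thesis .
    qed
    then have "F2 (x, y) = (\<integral>\<^sup>+\<omega>. H (?p x, \<lambda>i\<in>{..<r}. ?p (\<omega> i)) \<partial>gaussian_vecs r ?n)" for x
      unfolding F2_def H_def fst_conv snd_conv by presburger
    then show "(\<integral>\<^sup>+x. F2 (x, y) \<partial>N.vec ?n) =
        (\<integral>\<^sup>+x. \<integral>\<^sup>+\<omega>. f (2 * (1 + \<alpha>\<^sup>2) * (ip ?n y y / 2) * gram_det m (centered r \<beta> x \<omega>)) \<partial>gaussian_vecs r m \<partial>N.vec m)"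
      using nn_integral_project_rot[OF g(1) H] by (simp add: H_def)
  qed
  also have "\<dots> = (\<integral>\<^sup>+u. \<integral>\<^sup>+x. \<integral>\<^sup>+\<omega>. f (2 * (1 + \<alpha>\<^sup>2) * u * gram_det m (centered r \<beta> x \<omega>)) \<partial>gaussian_vecs r m \<partial>N.vec m
      \<partial>distr (N.vec ?n) borel (\<lambda>y. ip ?n y y / 2))"
  proof (rule nn_integral_distr[symmetric])
    show "(\<lambda>y. ip ?n y y / 2) \<in> N.vec ?n \<rightarrow>\<^sub>M borel"
      using ip_measurable[of ?n] by (simp cong: measurable_cong_sets add: N.sets_vec)
    have "(\<lambda>p. f (2 * (1 + \<alpha>\<^sup>2) * fst (fst p) * gram_det m (centered r \<beta> (snd (fst p)) (snd p)))) \<in>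
      borel_measurable ((borel \<Otimes>\<^sub>M borel_vec m) \<Otimes>\<^sub>M vecs r m)"
    proof -
      have "(\<lambda>p. (snd (fst p), snd p)) \<in> (borel \<Otimes>\<^sub>M borel_vec m) \<Otimes>\<^sub>M vecs r m \<rightarrow>\<^sub>M borel_vec m \<Otimes>\<^sub>M vecs r m"
        by measurable
      from measurable_compose[OF this centered_measurable]
      have [measurable]: "(\<lambda>p. gram_det m (centered r \<beta> (snd (fst p)) (snd p))) \<in>
        borel_measurable ((borel \<Otimes>\<^sub>M borel_vec m) \<Otimes>\<^sub>M vecs r m)" by simp
      show ?thesis by measurable
    qed
    then have "(\<lambda>(q, \<omega>). f (2 * (1 + \<alpha>\<^sup>2) * fst q * gram_det m (centered r \<beta> (snd q) \<omega>))) \<in>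
      borel_measurable ((borel \<Otimes>\<^sub>M N.vec m) \<Otimes>\<^sub>M gaussian_vecs r m)"
      by (simp cong: measurable_cong_sets sets_pair_measure_cong add: N.sets_vec sets_gaussian_vecs case_prod_unfold)
    from W'.borel_measurable_nn_integral[OF this]
    have "(\<lambda>(u, x). \<integral>\<^sup>+\<omega>. f (2 * (1 + \<alpha>\<^sup>2) * u * gram_det m (centered r \<beta> x \<omega>)) \<partial>gaussian_vecs r m) \<in>
      borel_measurable (borel \<Otimes>\<^sub>M N.vec m)" by (simp add: case_prod_unfold)
    from V'.borel_measurable_nn_integral[OF this]
    show "(\<lambda>u. \<integral>\<^sup>+x. \<integral>\<^sup>+\<omega>. f (2 * (1 + \<alpha>\<^sup>2) * u * gram_det m (centered r \<beta> x \<omega>)) \<partial>gaussian_vecs r m \<partial>N.vec m) \<in>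
      borel_measurable (distr (N.vec ?n) borel (\<lambda>y. ip ?n y y / 2))" by simp
  qed
  finally show ?thesis unfolding gaussian_half_norm[OF zero_less_Suc] .
qed

lemma prob_space_gamma_measure: "n > 0 \<Longrightarrow> prob_space (gamma_measure (real n / 2))"
  unfolding gaussian_half_norm[symmetric]
  by (intro prob_space.prob_space_distr prob_space_gaussian_vec)
     (use ip_measurable[of n] in \<open>simp cong: measurable_cong_sets add: N.sets_vec\<close>)

lemma sets_gamma_measure [measurable_cong, simp]: "sets (gamma_measure a) = sets borel"
  by (simp add: gamma_measure_def)

text \<open>One step of the recursion removes one vector and one dimension, so \<open>d\<close> is
  preserved and the shape parameter drops by 1/2. For \<beta> = \<alpha> / sqrt (1 + \<alpha>^2) the
  scalar factors combine through (1 + \<alpha>^2) (1 + r \<beta>^2) = 1 + (r + 1) \<alpha>^2. At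
  \<alpha> = 1 this is the factor 1 + r of the simplex.\<close>

theorem gram_det_centered_law:
  assumes f: "f \<in> borel_measurable borel"
  shows "(\<integral>\<^sup>+x. \<integral>\<^sup>+\<omega>. f (gram_det (d + r) (centered r \<alpha> x \<omega>)) \<partial>gaussian_vecs r (d + r) \<partial>N.vec (d + r)) =
    (\<integral>\<^sup>+u. f ((1 + r * \<alpha>\<^sup>2) * (\<Prod>j<r. 2 * u j)) \<partial>PiM {..<r} (\<lambda>j. gamma_measure (real (Suc (d + j)) / 2)))"
  using f
proof (induction r arbitrary: \<alpha> f)
  case 0
  interpret V: prob_space "N.vec d" by (rule prob_space_gaussian_vec)
  interpret W: prob_space "gaussian_vecs 0 d" by (rule prob_space_gaussian_vecs)
  show ?case
    by (simp add: centered_def V.emeasure_space_1 W.emeasure_space_1 PiM_empty nn_integral_count_space_finite)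
next
  case (Suc r)
  note f[measurable] = Suc.prems
  let ?G = "\<lambda>j. gamma_measure (real (Suc (d + j)) / 2)"
  let ?\<beta> = "\<alpha> / sqrt (1 + \<alpha>\<^sup>2)"
  have pos: "1 + \<alpha>\<^sup>2 > 0" by (simp add: add_pos_nonneg)
  have sf: "sigma_finite_measure (?G j)" for j
    by (intro prob_space_imp_sigma_finite prob_space_gamma_measure) simp
  interpret G: product_sigma_finite ?G by (rule product_sigma_finite.intro) (rule sf)
  have e: "{..<Suc r} = insert r {..<r}" by (rule lessThan_Suc)
  have "(\<integral>\<^sup>+x. \<integral>\<^sup>+\<omega>. f (gram_det (d + Suc r) (centered (Suc r) \<alpha> x \<omega>)) \<partial>gaussian_vecs (Suc r) (d + Suc r) \<partial>N.vec (d + Suc r)) =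
    (\<integral>\<^sup>+u. \<integral>\<^sup>+x. \<integral>\<^sup>+\<omega>. f (2 * (1 + \<alpha>\<^sup>2) * u * gram_det (d + r) (centered r ?\<beta> x \<omega>)) \<partial>gaussian_vecs r (d + r) \<partial>N.vec (d + r) \<partial>?G r)"
    using gram_det_centered_step[OF f, of "d + r" r \<alpha>] by (simp only: add_Suc_right)
  also have "\<dots> = (\<integral>\<^sup>+v. \<integral>\<^sup>+u. f (2 * (1 + \<alpha>\<^sup>2) * v * ((1 + r * ?\<beta>\<^sup>2) * (\<Prod>j<r. 2 * u j))) \<partial>PiM {..<r} ?G \<partial>?G r)"
    by (intro nn_integral_cong Suc.IH) measurable
  also have "\<dots> = (\<integral>\<^sup>+v. \<integral>\<^sup>+u. f ((1 + Suc r * \<alpha>\<^sup>2) * (\<Prod>j<Suc r. 2 * (u(r := v)) j)) \<partial>PiM {..<r} ?G \<partial>?G r)"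
  proof (intro nn_integral_cong arg_cong[where f=f])
    fix v :: real and u :: "nat \<Rightarrow> real"
    have "(1 + \<alpha>\<^sup>2) * (1 + r * ?\<beta>\<^sup>2) = 1 + Suc r * \<alpha>\<^sup>2"
      using pos by (simp add: power_divide field_simps)
    moreover have "(\<Prod>j<Suc r. 2 * (u(r := v)) j) = (\<Prod>j<r. 2 * u j) * (2 * v)" by simp
    moreover have "2 * (1 + \<alpha>\<^sup>2) * v * ((1 + r * ?\<beta>\<^sup>2) * (\<Prod>j<r. 2 * u j)) =
      ((1 + \<alpha>\<^sup>2) * (1 + r * ?\<beta>\<^sup>2)) * ((\<Prod>j<r. 2 * u j) * (2 * v))" by (simp only: mult_ac)
    ultimately show "2 * (1 + \<alpha>\<^sup>2) * v * ((1 + r * ?\<beta>\<^sup>2) * (\<Prod>j<r. 2 * u j)) =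
      (1 + Suc r * \<alpha>\<^sup>2) * (\<Prod>j<Suc r. 2 * (u(r := v)) j)" by (simp only:)
  qed
  also have "\<dots> = (\<integral>\<^sup>+u. f ((1 + Suc r * \<alpha>\<^sup>2) * (\<Prod>j<Suc r. 2 * u j)) \<partial>PiM {..<Suc r} ?G)"
    unfolding e
  proof (rule G.product_nn_integral_insert_rev[symmetric])
    have [measurable]: "(\<lambda>u. u j) \<in> borel_measurable (PiM (insert r {..<r}) ?G)" if "j \<in> insert r {..<r}" for j
      using measurable_component_singleton[OF that, of ?G]
      by (simp only: measurable_cong_sets[OF refl sets_gamma_measure])
    show "(\<lambda>u. f ((1 + Suc r * \<alpha>\<^sup>2) * (\<Prod>j\<in>insert r {..<r}. 2 * u j))) \<in> borel_measurable (PiM (insert r {..<r}) ?G)"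
      by measurable
  qed auto
  finally show ?case .
qed

section \<open>The moment generating function of the log-volume\<close>

text \<open>The integrand is u^s, and multiplying the density by it shifts the parameter of Euler's
  integral from a to a + s.\<close>

lemma gamma_measure_moment:
  fixes s :: complex
  assumes a: "a > 0" and s: "Re s > - a"
  shows "integrable (gamma_measure a) (\<lambda>u. exp (s * of_real (ln u)))"
    and "(\<integral>u. exp (s * of_real (ln u)) \<partial>gamma_measure a) = Gamma (of_real a + s) / of_real (Gamma a)"
proof -
  let ?z = "of_real a + s"
  define h where "h u = indicator {0<..} u *\<^sub>R (of_real u powr (?z - 1) / of_real (exp u))" for u :: real
  have z: "Re ?z > 0" using s by simp
  have [measurable]: "h \<in> borel_measurable borel" unfolding h_def by measurable
  have si: "set_integrable lebesgue {0<..} (\<lambda>t. complex_of_real t powr (?z - 1) / of_real (exp t))"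
    by (rule absolutely_integrable_Gamma_integral'[OF z])
  then have leb: "integrable lebesgue h" and
    int: "integral\<^sup>L lebesgue h = integral {0<..} (\<lambda>t. complex_of_real t powr (?z - 1) / of_real (exp t))"
    using si set_lebesgue_integral_eq_integral(2)[OF si]
    unfolding set_integrable_def set_lebesgue_integral_def h_def by simp_all
  have ih: "integrable lborel h" using leb by (simp add: integrable_completion)
  have Lh: "integral\<^sup>L lborel h = Gamma ?z"
    using int Gamma_integral_complex'[OF z] by (simp add: integral_completion integral_unique)
  have G: "Gamma a > 0" by (rule Gamma_real_pos[OF a])
  have eq: "(indicator {0<..} u * (u powr (a - 1) / exp u / Gamma a)) *\<^sub>R exp (s * of_real (ln u)) = h u / of_real (Gamma a)"
    for u :: real
  proof (cases "u > 0")
    case True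
    have "of_real (u powr (a - 1)) * exp (s * of_real (ln u)) = of_real u powr (?z - 1)"
      using True by (simp add: powr_def Ln_of_real exp_of_real[symmetric] exp_add[symmetric] algebra_simps)
    then show ?thesis using True by (simp add: h_def scaleR_conv_of_real field_simps)
  qed (simp add: h_def)
  have nn: "AE u in lborel. 0 \<le> indicator {0<..} u * (u powr (a - 1) / exp u / Gamma a)"
    using G by (simp add: indicator_def)
  show "integrable (gamma_measure a) (\<lambda>u. exp (s * of_real (ln u)))"
    unfolding gamma_measure_def
    by (subst integrable_density[OF _ _ nn]) (use ih G in \<open>simp_all only: eq, auto\<close>)
  show "(\<integral>u. exp (s * of_real (ln u)) \<partial>gamma_measure a) = Gamma ?z / of_real (Gamma a)"
    unfolding gamma_measure_def
    by (subst integral_density[OF _ _ nn]) (use ih G in \<open>simp_all only: eq, auto simp: Lh\<close>)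
qed

lemma nn_integral_inverse_unit_interval:
  "(\<integral>\<^sup>+u. ennreal (1 / u) * indicator {0<..1} u \<partial>lborel) = \<infinity>" (is "?I = _")
proof -
  have "ennreal (real N) \<le> ?I" for N
  proof -
    have "(\<integral>\<^sup>+u. ennreal (1 / u) * indicator {exp (- real N)..1} u \<partial>lborel) = ennreal (ln 1 - ln (exp (- real N)))"
    proof (rule nn_integral_FTC_Icc)
      fix x assume "x \<in> {exp (- real N)..1}"
      then have "x > 0" using less_le_trans[OF exp_gt_zero] by auto
      then show "DERIV ln x :> 1 / x" "0 \<le> 1 / x" by (auto intro!: derivative_eq_intros)
    qed auto
    then have "ennreal (real N) = (\<integral>\<^sup>+u. ennreal (1 / u) * indicator {exp (- real N)..1} u \<partial>lborel)" by simp
    also have "\<dots> \<le> ?I"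
      by (intro nn_integral_mono) (auto simp: indicator_def intro: less_le_trans[OF exp_gt_zero])
    finally show ?thesis .
  qed
  note le = this
  show ?thesis
  proof (cases ?I)
    case (real c)
    obtain N :: nat where "c < real N" using reals_Archimedean2 by blast
    with le[of N] real show ?thesis by simp
  qed simp
qed

text \<open>Near 0 the density times |u^s| is at least a constant times 1 / u. The exact domain of
  convergence matters, since \<open>cmgf\<close> distinguishes cases by integrability and
  \<open>mgf_continuation\<close> prescribes the values wherever the expectation converges.\<close>

lemma gamma_measure_moment_infinite:
  fixes s :: complex
  assumes a: "a > 0" and s: "Re s \<le> - a"
  shows "(\<integral>\<^sup>+u. ennreal (norm (exp (s * of_real (ln u)))) \<partial>gamma_measure a) = \<infinity>"
proof -
  have G: "Gamma a > 0" by (rule Gamma_real_pos[OF a])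
  have "\<infinity> = ennreal (1 / (exp 1 * Gamma a)) * (\<integral>\<^sup>+u. ennreal (1 / u) * indicator {0<..1} u \<partial>lborel)"
    unfolding nn_integral_inverse_unit_interval using G by (simp add: ennreal_mult_top)
  also have "\<dots> = (\<integral>\<^sup>+u. ennreal (1 / (exp 1 * Gamma a)) * (ennreal (1 / u) * indicator {0<..1} u) \<partial>lborel)"
    by (rule nn_integral_cmult[symmetric]) simp
  also have "\<dots> \<le> (\<integral>\<^sup>+u. ennreal (indicator {0<..} u * (u powr (a - 1) / exp u / Gamma a)) *
      ennreal (norm (exp (s * of_real (ln u)))) \<partial>lborel)"
  proof (rule nn_integral_mono)
    fix u :: real
    show "ennreal (1 / (exp 1 * Gamma a)) * (ennreal (1 / u) * indicator {0<..1} u) \<le>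
      ennreal (indicator {0<..} u * (u powr (a - 1) / exp u / Gamma a)) * ennreal (norm (exp (s * of_real (ln u))))"
    proof (cases "u \<in> {0<..1}")
      case True
      then have u: "0 < u" "u \<le> 1" by auto
      have "1 / u = exp (- ln u)" using u by (simp add: exp_minus inverse_eq_divide)
      also have "\<dots> \<le> exp ((a - 1 + Re s) * ln u)"
      proof -
        have "0 \<le> (a + Re s) * ln u" using s u by (intro mult_nonpos_nonpos) auto
        then show ?thesis by (simp add: algebra_simps)
      qed
      also have "\<dots> = u powr (a - 1) * norm (exp (s * of_real (ln u)))"
        using u by (simp add: powr_def norm_exp_eq_Re exp_add[symmetric] algebra_simps)
      finally have "1 / u * (1 / (exp 1 * Gamma a)) \<le> u powr (a - 1) * norm (exp (s * of_real (ln u))) * (1 / (exp u * Gamma a))"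
        using u G by (intro mult_mono) (auto intro!: divide_left_mono mult_right_mono)
      then show ?thesis using u G by (simp add: ennreal_mult[symmetric] mult_ac ennreal_leI)
    qed simp
  qed
  also have "\<dots> = (\<integral>\<^sup>+u. ennreal (norm (exp (s * of_real (ln u)))) \<partial>gamma_measure a)"
    unfolding gamma_measure_def by (rule nn_integral_density[symmetric]) auto
  finally show ?thesis by (simp add: top.extremum_uniqueI)
qed

text \<open>Excludes the case 0 * \<infinity> = 0 when a product of moments with one infinite factor
  is to be infinite.\<close>

lemma gamma_measure_moment_nonzero:
  fixes s :: complex
  assumes "n > 0"
  shows "(\<integral>\<^sup>+u. ennreal (norm (exp (s * of_real (ln u)))) \<partial>gamma_measure (real n / 2)) \<noteq> 0"
proof -
  interpret prob_space "gamma_measure (real n / 2)" by (rule prob_space_gamma_measure[OF assms])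
  show ?thesis by (subst nn_integral_0_iff_AE) (auto simp: AE_False)
qed

lemma AE_gamma_measure_pos: "AE u in gamma_measure a. u > 0"
  unfolding gamma_measure_def by (subst AE_density) (auto simp: indicator_def)

text \<open>The index \<open>j\<close> starts at 0, so that the shape parameters are (d + 1) / 2,
  ..., (d + r) / 2.\<close>

definition gamma_vec :: "nat \<Rightarrow> nat \<Rightarrow> (nat \<Rightarrow> real) measure" where
  "gamma_vec d r = PiM {..<r} (\<lambda>j. gamma_measure (real (Suc (d + j)) / 2))"

lemma gamma_vec_measurable: "(\<lambda>u. c * (\<Prod>j<r. 2 * u j)) \<in> borel_measurable (gamma_vec d r)"
proof -
  have [measurable]: "(\<lambda>u. u j) \<in> borel_measurable (gamma_vec d r)" if "j \<in> {..<r}" for j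
    using measurable_component_singleton[OF that, of "\<lambda>j. gamma_measure (real (Suc (d + j)) / 2)"]
    unfolding gamma_vec_def by (simp only: measurable_cong_sets[OF refl sets_gamma_measure])
  show ?thesis by measurable
qed

section \<open>The law of the edge Gram determinant of the random points\<close>

context
  fixes M :: "'a measure" and n d r :: nat and X :: "nat \<Rightarrow> 'a \<Rightarrow> nat \<Rightarrow> real"
  assumes pts: "gaussian_points M n r X" and n: "n = d + r"
begin

interpretation prob_space M using pts by (simp add: gaussian_points_def)

lemma points_measurable: "i \<le> r \<Longrightarrow> X i \<in> M \<rightarrow>\<^sub>M borel_vec n"
  using pts unfolding gaussian_points_def indep_vars_def by auto

abbreviation edge_det :: "'a \<Rightarrow> real" where
  "edge_det \<omega> \<equiv> gram_det n (edges r (\<lambda>i. X i \<omega>))"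

lemma log_volume_eq_edge_det: "\<omega> \<in> space M \<Longrightarrow> log_simplex_volume n r (\<lambda>i. X i \<omega>) = ln (edge_det \<omega>) / 2"
  using measurable_space[OF points_measurable]
  by (intro log_simplex_volume_eq) (auto simp: n space_borel_vec)

lemma edge_det_measurable: "edge_det \<in> borel_measurable M"
proof (rule gram_det_family_measurable)
  fix i k assume "i < r" "k < n"
  then show "(\<lambda>\<omega>. X (Suc i) \<omega> k - X 0 \<omega> k) \<in> borel_measurable M"
    by (intro borel_measurable_diff measurable_compose[OF points_measurable measurable_coord]) auto
qed

lemma points_joint_law:
  "distr M (PiM {..r} (\<lambda>_. borel_vec n)) (\<lambda>\<omega>. \<lambda>i\<in>{..r}. X i \<omega>) = PiM {..r} (\<lambda>_. N.vec n)"
proof -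
  have "distr M (PiM {..r} (\<lambda>_. borel_vec n)) (\<lambda>\<omega>. \<lambda>i\<in>{..r}. X i \<omega>) = PiM {..r} (\<lambda>i. distr M (borel_vec n) (X i))"
    using pts points_measurable unfolding gaussian_points_def
    by (subst indep_vars_iff_distr_eq_PiM'[symmetric]) auto
  also have "\<dots> = PiM {..r} (\<lambda>_. N.vec n)"
    using pts by (intro PiM_cong) (auto simp: gaussian_points_def std_gaussian_def)
  finally show ?thesis .
qed

text \<open>Independence turns the expectation into an integral over a product space. Vertex 0 is
  split off as the vector \<open>x\<close>, and the other vertices are renumbered from 0; this is
  the situation of \<open>centered\<close> with \<alpha> = 1.\<close>

lemma nn_integral_edge_det:
  assumes f: "f \<in> borel_measurable borel"
  shows "(\<integral>\<^sup>+\<omega>. f (edge_det \<omega>) \<partial>M) = (\<integral>\<^sup>+u. f ((1 + r) * (\<Prod>j<r. 2 * u j)) \<partial>gamma_vec d r)"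
proof -
  let ?h = "\<lambda>w. f (gram_det n (edges r w))"
  interpret V: prob_space "N.vec n" by (rule prob_space_gaussian_vec)
  interpret PW: product_sigma_finite "\<lambda>_::nat. N.vec n" ..
  have S: "sets (PiM I (\<lambda>_. N.vec n)) = sets (PiM I (\<lambda>_. borel_vec n))" for I :: "nat set"
    by (intro sets_PiM_cong refl N.sets_vec)
  have entry: "(\<lambda>w. w i k) \<in> borel_measurable (PiM {..r} (\<lambda>_. borel_vec n))" if "i \<le> r" "k < n" for i k
    by (rule measurable_compose[OF measurable_component_singleton[of i "{..r}"] measurable_coord[of k n]]) (use that in auto)
  have h: "?h \<in> borel_measurable (PiM {..r} (\<lambda>_. borel_vec n))"
  proof (rule measurable_compose[OF gram_det_family_measurable f])
    fix i k assume "i < r" "k < n"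
    then show "(\<lambda>w. w (Suc i) k - w 0 k) \<in> borel_measurable (PiM {..r} (\<lambda>_. borel_vec n))"
      by (intro borel_measurable_diff entry) auto
  qed
  have rv: "(\<lambda>\<omega>. \<lambda>i\<in>{..r}. X i \<omega>) \<in> M \<rightarrow>\<^sub>M PiM {..r} (\<lambda>_. borel_vec n)"
    by (intro measurable_restrict points_measurable) auto
  have e: "{..r} = insert 0 (Suc ` {..<r})"
    by (auto simp: image_iff gr0_conv_Suc Suc_le_eq less_Suc_eq_0_disj less_Suc_eq_le[symmetric])
  have reindex: "distr (PiM (Suc ` {..<r}) (\<lambda>_. N.vec n)) (gaussian_vecs r n) (\<lambda>w. \<lambda>i\<in>{..<r}. w (Suc i)) = gaussian_vecs r n"
    by (rule distr_PiM_reindex) (auto simp: prob_space_gaussian_vec)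
  have shift: "(\<lambda>w. \<lambda>i\<in>{..<r}. w (Suc i)) \<in> PiM (Suc ` {..<r}) (\<lambda>_. N.vec n) \<rightarrow>\<^sub>M gaussian_vecs r n"
    by (intro measurable_restrict measurable_component_singleton) auto
  have "edges r (\<lambda>i\<in>{..r}. X i \<omega>) = edges r (\<lambda>i. X i \<omega>)" for \<omega>
    by (rule map_cong) auto
  then have "(\<integral>\<^sup>+\<omega>. f (edge_det \<omega>) \<partial>M) = (\<integral>\<^sup>+\<omega>. ?h (\<lambda>i\<in>{..r}. X i \<omega>) \<partial>M)" by (simp only:)
  also have "\<dots> = (\<integral>\<^sup>+w. ?h w \<partial>distr M (PiM {..r} (\<lambda>_. borel_vec n)) (\<lambda>\<omega>. \<lambda>i\<in>{..r}. X i \<omega>))"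
    by (rule nn_integral_distr[symmetric, OF rv]) (use h in simp)
  also have "\<dots> = (\<integral>\<^sup>+w. ?h w \<partial>PiM (insert 0 (Suc ` {..<r})) (\<lambda>_. N.vec n))"
    by (simp only: points_joint_law e[symmetric])
  also have "\<dots> = (\<integral>\<^sup>+x. \<integral>\<^sup>+w. ?h (w(0 := x)) \<partial>PiM (Suc ` {..<r}) (\<lambda>_. N.vec n) \<partial>N.vec n)"
    by (rule PW.product_nn_integral_insert_rev)
       (use h in \<open>simp_all add: e[symmetric] measurable_cong_sets[OF S refl]\<close>)
  also have "\<dots> = (\<integral>\<^sup>+x. \<integral>\<^sup>+\<omega>. f (gram_det n (centered r 1 x \<omega>)) \<partial>gaussian_vecs r n \<partial>N.vec n)"
  proof (rule nn_integral_cong)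
    fix x assume x: "x \<in> space (N.vec n)"
    have m: "(\<lambda>\<omega>. f (gram_det n (centered r 1 x \<omega>))) \<in> borel_measurable (gaussian_vecs r n)"
    proof -
      have "x \<in> space (borel_vec n)" using x by (simp add: N.space_vec space_borel_vec)
      from measurable_compose[OF measurable_Pair1'[OF this] centered_measurable] f
      show ?thesis by (simp cong: measurable_cong_sets add: sets_gaussian_vecs)
    qed
    have "edges r (w(0 := x)) = centered r 1 x (\<lambda>i\<in>{..<r}. w (Suc i))" for w
      unfolding centered_def by (rule map_cong) auto
    then have "(\<integral>\<^sup>+w. ?h (w(0 := x)) \<partial>PiM (Suc ` {..<r}) (\<lambda>_. N.vec n)) =
      (\<integral>\<^sup>+w. f (gram_det n (centered r 1 x (\<lambda>i\<in>{..<r}. w (Suc i)))) \<partial>PiM (Suc ` {..<r}) (\<lambda>_. N.vec n))" by simp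
    also have "\<dots> = (\<integral>\<^sup>+\<omega>. f (gram_det n (centered r 1 x \<omega>))
        \<partial>distr (PiM (Suc ` {..<r}) (\<lambda>_. N.vec n)) (gaussian_vecs r n) (\<lambda>w. \<lambda>i\<in>{..<r}. w (Suc i)))"
      by (rule nn_integral_distr[symmetric, OF shift]) (use m in simp)
    finally show "(\<integral>\<^sup>+w. ?h (w(0 := x)) \<partial>PiM (Suc ` {..<r}) (\<lambda>_. N.vec n)) =
      (\<integral>\<^sup>+\<omega>. f (gram_det n (centered r 1 x \<omega>)) \<partial>gaussian_vecs r n)" unfolding reindex .
  qed
  also have "\<dots> = (\<integral>\<^sup>+u. f ((1 + r) * (\<Prod>j<r. 2 * u j)) \<partial>gamma_vec d r)"
    unfolding n gamma_vec_def using gram_det_centered_law[OF f, of d r 1] by simp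
  finally show ?thesis .
qed

lemma distr_edge_det:
  "distr M borel edge_det = distr (gamma_vec d r) borel (\<lambda>u. (1 + r) * (\<Prod>j<r. 2 * u j))"
proof (rule measure_eqI)
  fix A assume "A \<in> sets (distr M borel edge_det)"
  then have A: "A \<in> sets borel" by simp
  have "emeasure (distr M borel edge_det) A = (\<integral>\<^sup>+\<omega>. indicator A (edge_det \<omega>) \<partial>M)"
    by (rule emeasure_distr_nn_integral[OF edge_det_measurable A])
  also have "\<dots> = (\<integral>\<^sup>+u. indicator A ((1 + r) * (\<Prod>j<r. 2 * u j)) \<partial>gamma_vec d r)"
    by (rule nn_integral_edge_det) (use A in simp)
  also have "\<dots> = emeasure (distr (gamma_vec d r) borel (\<lambda>u. (1 + r) * (\<Prod>j<r. 2 * u j))) A"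
    by (rule emeasure_distr_nn_integral[OF gamma_vec_measurable A, symmetric])
  finally show "emeasure (distr M borel edge_det) A = emeasure (distr (gamma_vec d r) borel (\<lambda>u. (1 + r) * (\<Prod>j<r. 2 * u j))) A" .
qed simp

end

text \<open>The log-volume is half the logarithm of the Gram determinant, hence the arguments t / 2.
  The exponential collects the deterministic factor (1 + r) 2^r and the centering \<open>m\<close>.
  The formula makes sense for all complex t and will be the meromorphic continuation.\<close>

definition volume_mgf :: "nat \<Rightarrow> nat \<Rightarrow> real \<Rightarrow> complex \<Rightarrow> complex" where
  "volume_mgf d r m t = exp (t * of_real ((ln (1 + real r) + real r * ln 2) / 2 - m)) *
     (\<Prod>j<r. Gamma (of_real (real (Suc (d + j)) / 2) + t / 2) / of_real (Gamma (real (Suc (d + j)) / 2)))"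

lemma gamma_vec_mgf:
  fixes t :: complex and m :: real and d r :: nat
  defines "h \<equiv> (\<lambda>y::real. exp (t * of_real (ln y / 2 - m)))"
    and "P \<equiv> (\<lambda>u::nat \<Rightarrow> real. (1 + real r) * (\<Prod>j<r. 2 * u j))"
  assumes r: "r > 0"
  shows "integrable (gamma_vec d r) (\<lambda>u. h (P u)) \<longleftrightarrow> Re t > - real d - 1"
    and "Re t > - real d - 1 \<Longrightarrow> (\<integral>u. h (P u) \<partial>gamma_vec d r) = volume_mgf d r m t"
proof -
  let ?a = "\<lambda>j. real (Suc (d + j)) / 2"
  let ?G = "\<lambda>j. gamma_measure (?a j)"
  let ?\<phi> = "\<lambda>u. exp (t / 2 * of_real (ln u))"
  define C where "C = exp (t * of_real ((ln (1 + real r) + real r * ln 2) / 2 - m))"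
  have pG: "prob_space (?G j)" for j by (rule prob_space_gamma_measure) simp
  interpret G: product_sigma_finite ?G
    by (rule product_sigma_finite.intro) (rule prob_space_imp_sigma_finite[OF pG])
  have [measurable]: "(\<lambda>u. u j) \<in> borel_measurable (gamma_vec d r)" if "j \<in> {..<r}" for j
    using measurable_component_singleton[OF that, of ?G]
    unfolding gamma_vec_def by (simp only: measurable_cong_sets[OF refl sets_gamma_measure])
  have pos: "AE u in gamma_vec d r. \<forall>j<r. u j > 0"
    unfolding gamma_vec_def by (subst AE_ball_countable[of "{..<r}", simplified Ball_def lessThan_iff])
      (auto intro!: AE_PiM_component pG AE_gamma_measure_pos)
  \<comment> \<open>Splitting the logarithm of the product requires positive factors, which the
    Gamma laws give almost surely.\<close>
  have eq: "AE u in gamma_vec d r. h (P u) = C * (\<Prod>j<r. ?\<phi> (u j))"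
    using pos
  proof eventually_elim
    case (elim u)
    have "ln (P u) = ln (1 + real r) + (\<Sum>j<r. ln (2 * u j))"
      unfolding P_def using elim by (subst ln_mult_pos) (auto intro!: prod_pos ln_prod)
    also have "(\<Sum>j<r. ln (2 * u j)) = (\<Sum>j<r. ln 2 + ln (u j))"
      using elim by (intro sum.cong) (auto simp: ln_mult_pos)
    finally have "t * of_real (ln (P u) / 2 - m) = t * of_real ((ln (1 + real r) + real r * ln 2) / 2 - m) + (\<Sum>j<r. t / 2 * of_real (ln (u j)))"
      by (simp only: sum_distrib_left[symmetric] of_real_sum[symmetric])
         (simp add: sum.distrib algebra_simps add_divide_distrib)
    then show ?case unfolding h_def C_def by (simp add: exp_add exp_sum)
  qed
  have hm: "(\<lambda>u. h (P u)) \<in> borel_measurable (gamma_vec d r)"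
    unfolding h_def P_def by measurable
  have pm: "(\<lambda>u. C * (\<Prod>j<r. ?\<phi> (u j))) \<in> borel_measurable (gamma_vec d r)"
    by measurable
  have C: "C \<noteq> 0" by (simp add: C_def)
  have i: "integrable (gamma_vec d r) (\<lambda>u. h (P u)) \<longleftrightarrow> integrable (gamma_vec d r) (\<lambda>u. \<Prod>j<r. ?\<phi> (u j))"
  proof -
    have "integrable (gamma_vec d r) (\<lambda>u. \<Prod>j<r. ?\<phi> (u j))"
      if "integrable (gamma_vec d r) (\<lambda>u. C * (\<Prod>j<r. ?\<phi> (u j)))"
      using integrable_mult_right[of "1 / C", OF that] C by simp
    then show ?thesis unfolding integrable_cong_AE[OF hm pm eq] by (auto intro: integrable_mult_right)
  qed
  have fin: "integrable (?G j) ?\<phi>" "(\<integral>u. ?\<phi> u \<partial>?G j) = Gamma (of_real (?a j) + t / 2) / of_real (Gamma (?a j))"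
    if "Re t > - real d - 1" for j
    using gamma_measure_moment[of "?a j" "t / 2"] that by (simp_all add: field_simps)
  have I1: "integrable (gamma_vec d r) (\<lambda>u. \<Prod>j<r. ?\<phi> (u j))" if "Re t > - real d - 1"
    unfolding gamma_vec_def by (rule G.product_integrable_prod) (use fin[OF that] in auto)
  have I2: "\<not> integrable (gamma_vec d r) (\<lambda>u. \<Prod>j<r. ?\<phi> (u j))" if "\<not> Re t > - real d - 1"
  proof
    assume "integrable (gamma_vec d r) (\<lambda>u. \<Prod>j<r. ?\<phi> (u j))"
    then have "(\<integral>\<^sup>+u. ennreal (norm (\<Prod>j<r. ?\<phi> (u j))) \<partial>gamma_vec d r) < \<infinity>"
      by (simp add: integrable_iff_bounded)
    also have "(\<integral>\<^sup>+u. ennreal (norm (\<Prod>j<r. ?\<phi> (u j))) \<partial>gamma_vec d r) =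
        (\<integral>\<^sup>+u. (\<Prod>j<r. ennreal (norm (?\<phi> (u j)))) \<partial>gamma_vec d r)"
      by (simp add: prod_norm[symmetric] prod_ennreal)
    also have "\<dots> = (\<Prod>j<r. \<integral>\<^sup>+u. ennreal (norm (?\<phi> u)) \<partial>?G j)"
      unfolding gamma_vec_def
    proof (rule G.product_nn_integral_prod)
      show "(\<lambda>u. ennreal (norm (?\<phi> u))) \<in> borel_measurable (?G j)" for j
        unfolding measurable_cong_sets[OF sets_gamma_measure refl] by measurable
    qed simp
    also have "\<dots> = \<infinity>"
    proof -
      \<comment> \<open>Index 0 carries the smallest shape parameter (d + 1) / 2 and thus decides
        about convergence: its moment of order t / 2 is infinite as soon as Re t \<le> -d -
        1.\<close>
      have "\<exists>j\<in>{..<r}. (\<integral>\<^sup>+u. ennreal (norm (?\<phi> u)) \<partial>?G j) = top"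
        using r unfolding infinity_ennreal_def[symmetric]
        by (intro bexI[of _ 0] gamma_measure_moment_infinite) (use that in \<open>auto simp: field_simps\<close>)
      moreover have "\<forall>j\<in>{..<r}. (\<integral>\<^sup>+u. ennreal (norm (?\<phi> u)) \<partial>?G j) \<noteq> 0"
        by (intro ballI gamma_measure_moment_nonzero) simp
      ultimately show ?thesis unfolding infinity_ennreal_def ennreal_prod_eq_top by blast
    qed
    finally show False by simp
  qed
  show "integrable (gamma_vec d r) (\<lambda>u. h (P u)) \<longleftrightarrow> Re t > - real d - 1"
    using i I1 I2 by blast
  assume t: "Re t > - real d - 1"
  have "(\<integral>u. h (P u) \<partial>gamma_vec d r) = (\<integral>u. C * (\<Prod>j<r. ?\<phi> (u j)) \<partial>gamma_vec d r)"
    by (rule integral_cong_AE[OF hm pm eq])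
  also have "\<dots> = C * (\<Prod>j<r. \<integral>u. ?\<phi> u \<partial>?G j)"
    unfolding gamma_vec_def using G.product_integral_prod[of "{..<r}" "\<lambda>_. ?\<phi>"] fin(1)[OF t] by simp
  finally show "(\<integral>u. h (P u) \<partial>gamma_vec d r) = volume_mgf d r m t"
    by (simp only: fin(2)[OF t] volume_mgf_def C_def)
qed

text \<open>The identity theorem for the difference, after removal of its singularities, gives
  equality in a punctured neighbourhood of every point. At the point itself, poles are common and
  carry the value 0, and any other value is the common limit.\<close>

lemma nicely_meromorphic_eqI:
  assumes f: "f nicely_meromorphic_on UNIV" and g: "g nicely_meromorphic_on UNIV"
    and U: "open U" "w \<in> U" and eq: "\<And>z. z \<in> U \<Longrightarrow> f z = g z"
  shows "f = g"
proof
  fix z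
  define D where "D = (\<lambda>z. f z - g z)"
  have D: "D meromorphic_on UNIV"
    unfolding D_def using f g by (intro meromorphic_intros) (auto simp: nicely_meromorphic_on_def)
  have ev: "eventually (\<lambda>z. remove_sings D z = D z) (at z)" for z
    using eventually_remove_sings_eq[OF D] by (simp add: eventually_cosparse_open_eq)
  have "eventually (\<lambda>z. z \<in> U) (at w)" using U by (intro eventually_at_in_open')
  then have "eventually (\<lambda>z. remove_sings D z = 0) (at w)"
    using ev[of w] by eventually_elim (simp add: D_def eq)
  then have "frequently (\<lambda>z. remove_sings D z = 0) (at w)"
    by (intro eventually_frequently) auto
  from frequently_eq_meromorphic_imp_constant[OF this remove_sings_nicely_meromorphic[OF D]]
  have zero: "remove_sings D z = 0" for z by auto
  have fg: "eventually (\<lambda>z. f z = g z) (at z)"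
    using ev[of z] by eventually_elim (use zero in \<open>simp add: D_def\<close>)
  have pole: "is_pole f z \<longleftrightarrow> is_pole g z" by (rule is_pole_cong[OF fg refl])
  show "f z = g z"
  proof (cases "is_pole f z")
    case True
    then have "\<not> f \<midarrow>z\<rightarrow> f z" "\<not> g \<midarrow>z\<rightarrow> g z"
      using pole not_tendsto_and_filterlim_at_infinity[of "at z"] by (auto simp: is_pole_def)
    then have "f z = 0" "g z = 0" using f g unfolding nicely_meromorphic_on_def by blast+
    then show ?thesis by simp
  next
    case False
    then have "f \<midarrow>z\<rightarrow> f z" "g \<midarrow>z\<rightarrow> g z" using f g pole by (auto simp: nicely_meromorphic_on_def)
    moreover have "f \<midarrow>z\<rightarrow> g z" using \<open>g \<midarrow>z\<rightarrow> g z\<close> tendsto_cong[OF fg] by simp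
    ultimately show ?thesis by (intro LIM_unique)
  qed
qed

text \<open>The function is the reciprocal of an entire function formed with \<open>rGamma\<close>.
  The convention that the inverse of 0 is 0 matches the value 0 of \<open>Gamma\<close> at its
  poles.\<close>

lemma volume_mgf_nicely_meromorphic: "volume_mgf d r m nicely_meromorphic_on UNIV"
proof -
  define E where "E t = exp (- (t * of_real ((ln (1 + real r) + real r * ln 2) / 2 - m))) *
     (\<Prod>j<r. rGamma (of_real (real (Suc (d + j)) / 2) + t / 2) * of_real (Gamma (real (Suc (d + j)) / 2)))"
    for t :: complex
  have "E holomorphic_on UNIV"
    unfolding E_def by (intro holomorphic_intros) auto
  then have "E nicely_meromorphic_on UNIV"
    by (intro analytic_on_imp_nicely_meromorphic_on) (simp add: analytic_on_open)
  then have "(\<lambda>t. inverse (E t)) nicely_meromorphic_on UNIV" by (rule nicely_meromorphic_on_inverse)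
  also have "(\<lambda>t. inverse (E t)) = volume_mgf d r m"
  proof
    fix t :: complex
    have "(\<Prod>j<r. rGamma (of_real (real (Suc (d + j)) / 2) + t / 2) * of_real (Gamma (real (Suc (d + j)) / 2))) =
      (\<Prod>j<r. inverse (Gamma (of_real (real (Suc (d + j)) / 2) + t / 2) / of_real (Gamma (real (Suc (d + j)) / 2))))"
      by (intro prod.cong refl) (simp only: rGamma_inverse_Gamma inverse_mult_distrib inverse_inverse_eq divide_inverse)
    also have "\<dots> = inverse (\<Prod>j<r. Gamma (of_real (real (Suc (d + j)) / 2) + t / 2) / of_real (Gamma (real (Suc (d + j)) / 2)))"
      using prod_inversef[of "\<lambda>j. Gamma (of_real (real (Suc (d + j)) / 2) + t / 2) / of_real (Gamma (real (Suc (d + j)) / 2))" "{..<r}"]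
      by (simp only: comp_def)
    finally show "inverse (E t) = volume_mgf d r m t"
      by (simp only: E_def volume_mgf_def inverse_mult_distrib exp_minus inverse_inverse_eq)
  qed
  finally show ?thesis .
qed

text \<open>Expectations pass to the law of the Gram determinant and from there to the independent
  Gamma variables. The half-plane of convergence contains 0 and is open, so a continuation is
  determined by its values there; both cases in \<open>cmgf\<close> then yield the same explicit
  function.\<close>

lemma
  fixes X :: "nat \<Rightarrow> 'a \<Rightarrow> nat \<Rightarrow> real" and d r :: nat and m :: real
  assumes pts: "gaussian_points M n r X" and n: "n = d + r" and r: "r > 0"
  defines "Y \<equiv> (\<lambda>\<omega>. log_simplex_volume n r (\<lambda>i. X i \<omega>) - m)"
  shows log_volume_measurable: "Y \<in> borel_measurable M"
    and mgf_continuation_volume: "\<exists>!F. mgf_continuation M Y F"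
    and cmgf_volume: "cmgf M Y t = volume_mgf d r m t"
proof -
  let ?D = "\<lambda>\<omega>. gram_det n (edges r (\<lambda>i. X i \<omega>))"
  have D[measurable]: "?D \<in> borel_measurable M" by (rule edge_det_measurable[OF pts n])
  have Y: "Y \<omega> = ln (?D \<omega>) / 2 - m" if "\<omega> \<in> space M" for \<omega>
    unfolding Y_def using log_volume_eq_edge_det[OF pts n that] by simp
  show "Y \<in> borel_measurable M"
    by (subst measurable_cong[OF Y]) measurable
  define h where "h t y = exp (t * of_real (ln y / 2 - m))" for t :: complex and y :: real
  have h[measurable]: "h t \<in> borel_measurable borel" for t unfolding h_def by measurable
  have eh: "exp (t * of_real (Y \<omega>)) = h t (?D \<omega>)" if "\<omega> \<in> space M" for t \<omega>
    using Y[OF that] by (simp add: h_def)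
  let ?P = "\<lambda>u. (1 + real r) * (\<Prod>j<r. 2 * u j)"
  have law: "distr M borel ?D = distr (gamma_vec d r) borel ?P"
    using distr_edge_det[OF pts n] by simp
  have P[measurable]: "?P \<in> borel_measurable (gamma_vec d r)" by (rule gamma_vec_measurable)
  have int_iff: "integrable M (\<lambda>\<omega>. exp (t * of_real (Y \<omega>))) \<longleftrightarrow> Re t > - real d - 1" for t
  proof -
    have "integrable M (\<lambda>\<omega>. exp (t * of_real (Y \<omega>))) \<longleftrightarrow> integrable M (\<lambda>\<omega>. h t (?D \<omega>))"
      by (rule Bochner_Integration.integrable_cong) (auto simp: eh)
    also have "\<dots> \<longleftrightarrow> integrable (distr M borel ?D) (h t)" by (rule integrable_distr_eq[symmetric]) auto
    also have "\<dots> \<longleftrightarrow> integrable (gamma_vec d r) (\<lambda>u. h t (?P u))"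
      unfolding law by (rule integrable_distr_eq) auto
    also have "\<dots> \<longleftrightarrow> Re t > - real d - 1"
      unfolding h_def by (rule gamma_vec_mgf(1)[OF r])
    finally show ?thesis .
  qed
  have int: "(\<integral>\<omega>. exp (t * of_real (Y \<omega>)) \<partial>M) = volume_mgf d r m t" if "Re t > - real d - 1" for t
  proof -
    have "(\<integral>\<omega>. exp (t * of_real (Y \<omega>)) \<partial>M) = (\<integral>\<omega>. h t (?D \<omega>) \<partial>M)"
      by (rule Bochner_Integration.integral_cong) (auto simp: eh)
    also have "\<dots> = (\<integral>y. h t y \<partial>distr M borel ?D)" by (rule integral_distr[symmetric]) auto
    also have "\<dots> = (\<integral>u. h t (?P u) \<partial>gamma_vec d r)" unfolding law by (rule integral_distr) auto
    also have "\<dots> = volume_mgf d r m t" unfolding h_def by (rule gamma_vec_mgf(2)[OF r that])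
    finally show ?thesis .
  qed
  have cont: "mgf_continuation M Y (volume_mgf d r m)"
    unfolding mgf_continuation_def using volume_mgf_nicely_meromorphic int_iff int by auto
  have uniq: "F = volume_mgf d r m" if "mgf_continuation M Y F" for F
  proof (rule nicely_meromorphic_eqI[where U="{t. Re t > - real d - 1}" and w=0])
    show "F nicely_meromorphic_on UNIV" using that by (simp add: mgf_continuation_def)
    show "open {t. Re t > - real d - 1}" by (rule open_halfspace_Re_gt)
    show "F z = volume_mgf d r m z" if "z \<in> {t. Re t > - real d - 1}" for z
      using \<open>mgf_continuation M Y F\<close> that int_iff[of z] int[of z] by (simp add: mgf_continuation_def)
  qed (auto simp: volume_mgf_nicely_meromorphic)
  show "\<exists>!F. mgf_continuation M Y F" using cont uniq by blast
  have "(THE F. mgf_continuation M Y F) = volume_mgf d r m" using cont uniq by blast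
  then show "cmgf M Y t = volume_mgf d r m t"
    unfolding cmgf_def using int_iff[of t] int[of t] by auto
qed

section \<open>The Barnes G-function\<close>

text \<open>The logarithmic series from its cubic term on is dominated by |z|^3 times a geometric
  series with ratio 1/2.\<close>

lemma Ln_approx_quadratic:
  fixes z :: complex
  assumes "norm z \<le> 1 / 2"
  shows "norm (Ln (1 + z) - z + z\<^sup>2 / 2) \<le> 2 * norm z ^ 3"
proof -
  define f where "f n = - ((- z) ^ n) / of_nat n" for n :: nat
  have "f sums Ln (1 + z)" unfolding f_def by (rule Ln_series') (use assms in simp)
  then have "(\<lambda>n. f (n + 3)) sums (Ln (1 + z) - (\<Sum>n<3. f n))" by (simp add: sums_iff_shift)
  also have "(\<Sum>n<3. f n) = z - z\<^sup>2 / 2" by (simp add: f_def numeral_3_eq_3 power2_eq_square)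
  finally have s: "(\<lambda>n. f (n + 3)) sums (Ln (1 + z) - z + z\<^sup>2 / 2)" by (simp add: algebra_simps)
  have g: "(\<lambda>n. norm z ^ 3 * (1 / 2) ^ n) sums (norm z ^ 3 * 2)"
    using sums_mult[OF geometric_sums[of "1 / 2 :: real"], of "norm z ^ 3"] by simp
  have "norm (f (n + 3)) \<le> norm z ^ 3 * (1 / 2) ^ n" for n
  proof -
    have "norm (f (n + 3)) = norm z ^ (n + 3) / real (n + 3)"
      unfolding f_def norm_divide norm_minus_cancel norm_power norm_of_nat ..
    also have "\<dots> \<le> norm z ^ (n + 3) / 1" by (intro divide_left_mono) auto
    also have "\<dots> = norm z ^ 3 * norm z ^ n" by (simp add: power_add)
    also have "\<dots> \<le> norm z ^ 3 * (1 / 2) ^ n" using assms by (intro mult_left_mono power_mono) auto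
    finally show ?thesis .
  qed
  from norm_sums_le[OF s g this] show ?thesis by simp
qed

definition barnes_factor :: "nat \<Rightarrow> complex \<Rightarrow> complex" where
  "barnes_factor k w = (1 + w / of_nat (Suc k)) ^ Suc k * exp (w\<^sup>2 / (2 * of_nat (Suc k)) - w)"

text \<open>With K = k + 1, the exponential in the factor cancels the first two terms of K Ln (1 + w
  / K), and the remainder is of order R^3 / K^2, hence summable. The threshold 4 R^2 keeps w / K
  small enough for the logarithmic estimate and the exponent \<open>y\<close> small enough for the
  estimate of exp y - 1.\<close>

lemma barnes_factor_bound:
  assumes w: "norm w \<le> R" and R: "R \<ge> 1" and k: "real (Suc k) \<ge> 4 * R\<^sup>2"
  shows "norm (barnes_factor k w - 1) \<le> 3 * R ^ 3 / real (Suc k) ^ 2"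
proof -
  define K where "K = real (Suc k)"
  define x where "x = w / of_real K"
  define y where "y = of_real K * (Ln (1 + x) - x + x\<^sup>2 / 2)"
  have K: "K > 0" "K \<ge> 4 * R\<^sup>2" "complex_of_real K = of_nat (Suc k)" using k by (auto simp: K_def)
  have RR: "R \<le> R\<^sup>2" using R by (simp add: power2_eq_square)
  have nx: "norm x = norm w / K" using K(1) by (simp only: x_def norm_divide norm_of_real abs_of_pos)
  have "norm x \<le> R / K" using w K by (simp add: nx divide_right_mono)
  also have "\<dots> \<le> 1 / 4" using K RR R by (simp add: field_simps)
  finally have x: "norm x \<le> 1 / 4" .
  have "x \<noteq> -1" using x by auto
  then have x1: "1 + x \<noteq> 0" by (metis add_eq_0_iff)
  have "norm y = K * norm (Ln (1 + x) - x + x\<^sup>2 / 2)" using K(1) by (simp only: y_def norm_mult norm_of_real abs_of_pos)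
  also have "\<dots> \<le> K * (2 * norm x ^ 3)"
    using x K by (intro mult_left_mono Ln_approx_quadratic) auto
  also have "\<dots> \<le> K * (2 * (R / K) ^ 3)"
    using w K by (intro mult_left_mono power_mono) (auto simp: nx divide_right_mono)
  also have "\<dots> = 2 * R ^ 3 / K\<^sup>2" using K by (simp add: field_simps power2_eq_square power3_eq_cube)
  finally have y: "norm y \<le> 2 * R ^ 3 / K\<^sup>2" .
  have "2 * R ^ 3 / K\<^sup>2 \<le> 2 * R ^ 3 / (4 * R\<^sup>2)\<^sup>2"
    using K R by (intro divide_left_mono power_mono) auto
  also have "\<dots> \<le> 1 / 2" using R by (simp add: field_simps power2_eq_square power3_eq_cube)
  finally have y2: "norm y \<le> 1 / 2" using y by linarith
  have "exp (of_nat (Suc k) * Ln (1 + x)) = (1 + x) ^ Suc k"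
    unfolding exp_of_nat_mult exp_Ln[OF x1] ..
  moreover have "of_nat (Suc k) * Ln (1 + x) + (w\<^sup>2 / (2 * of_nat (Suc k)) - w) = y"
    using K unfolding y_def x_def K(3) by (simp add: field_simps power2_eq_square del: of_nat_Suc)
  ultimately have "barnes_factor k w = exp y"
    unfolding barnes_factor_def x_def K(3) by (metis exp_add)
  then have "norm (barnes_factor k w - 1) \<le> 3 / 2 * norm y" using norm_exp_bounds(2)[OF y2] by simp
  also have "\<dots> \<le> 3 / 2 * (2 * R ^ 3 / K\<^sup>2)" using y by simp
  finally show ?thesis by (simp add: K_def)
qed

definition barnes_prod :: "complex \<Rightarrow> complex" where
  "barnes_prod w = (\<Prod>k. barnes_factor k w)"

lemma barnes_G_eq:
  "barnes_G (w + 1) = exp (w / 2 * of_real (ln (2 * pi)) - (w + (1 + euler_mascheroni) * w\<^sup>2) / 2) * barnes_prod w"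
proof -
  have "complex_of_real (2 * pi) powr (w / 2) = exp (w / 2 * of_real (ln (2 * pi)))"
    unfolding powr_def using Ln_of_real[of "2 * pi"] by simp
  moreover have "exp (w / 2 * of_real (ln (2 * pi))) * exp (- (w + (1 + euler_mascheroni) * w\<^sup>2) / 2) =
      exp (w / 2 * of_real (ln (2 * pi)) - (w + (1 + euler_mascheroni) * w\<^sup>2) / 2)"
    unfolding exp_add[symmetric] by (rule arg_cong[where f=exp]) (simp only: diff_conv_add_uminus minus_divide_left)
  ultimately show ?thesis
    unfolding barnes_G_def Let_def barnes_prod_def barnes_factor_def add_diff_cancel_right' by (simp only:)
qed

lemma barnes_factor_bound_ev:
  assumes "R \<ge> 1"
  shows "\<forall>\<^sub>F k in sequentially. \<forall>w\<in>cball 0 R. norm (barnes_factor k w - 1) \<le> 3 * R ^ 3 / real (Suc k) ^ 2"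
proof -
  have "filterlim (\<lambda>k. real (Suc k)) at_top sequentially" by (rule filterlim_compose[OF filterlim_real_sequentially filterlim_Suc])
  then have "\<forall>\<^sub>F k in sequentially. real (Suc k) \<ge> 4 * R\<^sup>2" by (simp add: filterlim_at_top)
  then show ?thesis by eventually_elim (use barnes_factor_bound assms in auto)
qed

lemma summable_inverse_squares_Suc: "summable (\<lambda>k. c / real (Suc k) ^ 2)"
  using summable_mult[OF iffD2[OF summable_Suc_iff inverse_power_summable[of 2]], of c]
  by (simp add: divide_inverse)

lemma convergent_prod_barnes_factor: "convergent_prod (\<lambda>k. barnes_factor k w)"
proof (rule abs_convergent_prod_imp_convergent_prod, rule summable_imp_abs_convergent_prod)
  let ?R = "max 1 (norm w)"
  show "summable (\<lambda>k. norm (barnes_factor k w - 1))"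
  proof (rule summable_comparison_test_ev[OF _ summable_inverse_squares_Suc])
    show "\<forall>\<^sub>F k in sequentially. norm (norm (barnes_factor k w - 1)) \<le> (3 * ?R ^ 3) / real (Suc k) ^ 2"
      using barnes_factor_bound_ev[of ?R] by (rule eventually_mono) auto
  qed
qed

lemma barnes_prod_uniform_limit:
  assumes "compact K"
  shows "uniform_limit K (\<lambda>N w. \<Prod>k<N. barnes_factor k w) barnes_prod sequentially"
proof -
  obtain R where R: "R \<ge> 1" "K \<subseteq> cball 0 R"
  proof -
    from assms obtain B where "\<forall>x\<in>K. norm x \<le> B" using compact_imp_bounded bounded_iff by metis
    then show thesis by (intro that[of "max 1 B"]) (auto simp: max.coboundedI2)
  qed
  have "uniformly_convergent_on (cball 0 R) (\<lambda>N w. \<Prod>k<N. barnes_factor k w)"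
  proof (rule uniformly_convergent_on_prod')
    show "continuous_on (cball 0 R) (barnes_factor n)" for n
      unfolding barnes_factor_def by (intro continuous_intros) (auto simp del: of_nat_Suc)
    have "uniform_limit (cball 0 R) (\<lambda>N w. \<Sum>k<N. norm (barnes_factor k w - 1)) (\<lambda>w. \<Sum>k. norm (barnes_factor k w - 1)) sequentially"
      by (rule Weierstrass_m_test_ev[OF _ summable_inverse_squares_Suc[of "3 * R ^ 3"]])
         (use barnes_factor_bound_ev[OF R(1)] in simp)
    then show "uniformly_convergent_on (cball 0 R) (\<lambda>N w. \<Sum>k<N. norm (barnes_factor k w - 1))"
      unfolding uniformly_convergent_on_def by blast
  qed simp
  then obtain l where l: "uniform_limit (cball 0 R) (\<lambda>N w. \<Prod>k<N. barnes_factor k w) l sequentially"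
    unfolding uniformly_convergent_on_def by blast
  have "l w = barnes_prod w" if "w \<in> cball 0 R" for w
  proof (rule LIMSEQ_unique)
    show "(\<lambda>N. \<Prod>k<N. barnes_factor k w) \<longlonglongrightarrow> l w" by (rule tendsto_uniform_limitI[OF l that])
    show "(\<lambda>N. \<Prod>k<N. barnes_factor k w) \<longlonglongrightarrow> barnes_prod w"
      unfolding barnes_prod_def by (intro has_prod_imp_tendsto' convergent_prod_has_prod convergent_prod_barnes_factor)
  qed
  then have "uniform_limit (cball 0 R) (\<lambda>N w. \<Prod>k<N. barnes_factor k w) barnes_prod sequentially"
    using uniform_limit_cong'[of "cball 0 R" "\<lambda>N w. \<Prod>k<N. barnes_factor k w" "\<lambda>N w. \<Prod>k<N. barnes_factor k w" l barnes_prod] l by simp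
  then show ?thesis using R(2) by (rule uniform_limit_on_subset)
qed

lemma barnes_prod_holomorphic: "barnes_prod holomorphic_on UNIV"
proof (rule holomorphic_uniform_sequence[of UNIV "\<lambda>N w. \<Prod>k<N. barnes_factor k w"])
  show "(\<lambda>w. \<Prod>k<N. barnes_factor k w) holomorphic_on UNIV" for N
    unfolding barnes_factor_def by (intro holomorphic_intros) (auto simp del: of_nat_Suc)
  show "\<exists>d>0. cball x d \<subseteq> UNIV \<and> uniform_limit (cball x d) (\<lambda>N w. \<Prod>k<N. barnes_factor k w) barnes_prod sequentially" for x
    by (intro exI[of _ 1]) (auto intro: barnes_prod_uniform_limit)
qed simp

text \<open>The excluded points are the zeros of the Barnes factors and at the same time the poles
  of \<Gamma>(w + 1), so on this set both the Gamma products and 1 / G(w + 1) are finite.\<close>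

definition barnes_regular :: "complex set" where
  "barnes_regular = {w. \<forall>k. w \<noteq> - of_nat (Suc k)}"

lemma barnes_factor_nonzero:
  assumes "w \<in> barnes_regular"
  shows "barnes_factor k w \<noteq> 0"
proof -
  have "w \<noteq> - of_nat (Suc k)" using assms unfolding barnes_regular_def by blast
  moreover have "w = - of_nat (Suc k)" if "1 + w / of_nat (Suc k) = 0"
  proof -
    have "w / of_nat (Suc k) = - 1" using that by (simp only: add_eq_0_iff)
    then show ?thesis by (simp add: divide_eq_eq del: of_nat_Suc)
  qed
  ultimately have "1 + w / of_nat (Suc k) \<noteq> 0" by blast
  then show ?thesis by (simp add: barnes_factor_def del: of_nat_Suc)
qed

lemma barnes_prod_nonzero: "w \<in> barnes_regular \<Longrightarrow> barnes_prod w \<noteq> 0"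
  unfolding barnes_prod_def
  by (intro prodinf_nonzero convergent_prod_barnes_factor barnes_factor_nonzero)

lemma barnes_G_nonzero: "w \<in> barnes_regular \<Longrightarrow> barnes_G (w + 1) \<noteq> 0"
  by (simp add: barnes_G_eq barnes_prod_nonzero)

lemma barnes_G_holomorphic: "barnes_G holomorphic_on UNIV"
proof -
  have "(\<lambda>z. exp ((z - 1) / 2 * of_real (ln (2 * pi)) - ((z - 1) + (1 + euler_mascheroni) * (z - 1)\<^sup>2) / 2) * barnes_prod (z - 1)) holomorphic_on UNIV"
    by (intro holomorphic_intros holomorphic_on_compose_gen[OF _ barnes_prod_holomorphic, unfolded comp_def]) auto
  moreover have "barnes_G z = exp ((z - 1) / 2 * of_real (ln (2 * pi)) - ((z - 1) + (1 + euler_mascheroni) * (z - 1)\<^sup>2) / 2) * barnes_prod (z - 1)" for z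
    using barnes_G_eq[of "z - 1"] by simp
  ultimately show ?thesis by (simp cong: holomorphic_cong)
qed

section \<open>Asymptotics of products of gamma functions\<close>

text \<open>The logarithm of the quotient of consecutive terms of \<open>\<Gamma>(w + n + 1) / (n! n\<^sup>w)\<close>, a sequence which
  tends to 1, after division by its expansion \<open>exp ((w\<^sup>2 + w) / (2 n))\<close> to first order.\<close>

definition gamma_log_error :: "complex \<Rightarrow> nat \<Rightarrow> complex" where
  "gamma_log_error w n = Ln (1 + w / of_nat (Suc n)) - w * of_real (ln (1 + 1 / real n))
     + (w\<^sup>2 + w) / 2 * (1 / of_nat n - 1 / of_nat (Suc n))"

text \<open>In terms of Y = 1 / (n + 1) one has ln (1 + 1/n) = - ln (1 - Y) and 1/n - 1/(n + 1) =
  Y^2 + Y^2 / n. All terms up to order Y^2 cancel; what remains are the cubic remainders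
  \<open>A\<close> and \<open>B\<close> of the two logarithms and the excess \<open>C\<close> = Y^2
  / n.\<close>

lemma gamma_log_error_bound:
  assumes w: "norm w \<le> R" and R: "R \<ge> 1" and n: "real n \<ge> 2 * R"
  shows "norm (gamma_log_error w n) \<le> 6 * R ^ 3 / real n ^ 3"
proof -
  define y where "y = 1 / real (Suc n)"
  define Y where "Y = complex_of_real y"
  have n0: "real n > 0" using n R by linarith
  have y: "0 < y" "y \<le> 1 / 2" "y \<le> 1 / real n" using n R n0 by (auto simp: y_def field_simps)
  have Yn: "Y = 1 / of_nat (Suc n)" by (simp add: Y_def y_def)
  define A where "A = Ln (1 + w * Y) - w * Y + (w * Y)\<^sup>2 / 2"
  define B where "B = Ln (1 + (- Y)) - (- Y) + (- Y)\<^sup>2 / 2"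
  define C where "C = 1 / (complex_of_nat n) * Y\<^sup>2"
  have "1 + 1 / real n = 1 / (1 - y)" using n0 by (simp add: y_def field_simps)
  then have "ln (1 + 1 / real n) = - ln (1 - y)" using y by (simp add: ln_div)
  moreover have "Ln (1 + (- Y)) = of_real (ln (1 - y))" using Ln_of_real[of "1 - y"] y by (simp add: Y_def)
  ultimately have e1: "of_real (ln (1 + 1 / real n)) = - (B - Y - Y\<^sup>2 / 2)" by (simp add: B_def)
  have e2: "1 / complex_of_nat n - 1 / of_nat (Suc n) = C + Y\<^sup>2"
  proof -
    have frac: "1 / a - 1 / b = 1 / a * (1 / b)\<^sup>2 + (1 / b)\<^sup>2" if "a \<noteq> 0" "b \<noteq> 0" "b = a + 1" for a b :: complex
    proof -
      have "1 / a * (1 / b)\<^sup>2 + (1 / b)\<^sup>2 = (1 + a) / (a * b\<^sup>2)" using that(1,2) by (simp add: field_simps)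
      also have "\<dots> = 1 / (a * b)" using that(2,3) by (simp add: power2_eq_square add.commute)
      also have "\<dots> = 1 / a - 1 / b" using that by (simp add: field_simps)
      finally show ?thesis by simp
    qed
    show ?thesis unfolding C_def Yn by (rule frac) (use n0 in \<open>simp_all only: of_nat_eq_0_iff of_nat_0_less_iff, simp_all add: add.commute\<close>)
  qed
  have e3: "Ln (1 + w / of_nat (Suc n)) = A + w * Y - (w * Y)\<^sup>2 / 2"
    by (simp add: A_def Yn)
  have e: "gamma_log_error w n = A + w * B + (w\<^sup>2 + w) / 2 * C"
    unfolding gamma_log_error_def e1 e2 e3 by (simp add: field_simps power2_eq_square)
  have nY: "norm Y = y" using y by (simp add: Y_def)
  have wY: "norm (w * Y) \<le> R / real n"
  proof -
    have "norm w * y \<le> R * (1 / real n)" using w y R by (intro mult_mono) auto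
    then show ?thesis by (simp add: norm_mult nY)
  qed
  also have "\<dots> \<le> 1 / 2" using n n0 by (simp add: field_simps)
  finally have "norm A \<le> 2 * norm (w * Y) ^ 3" unfolding A_def by (rule Ln_approx_quadratic)
  also have "\<dots> \<le> 2 * (R / real n) ^ 3" using wY by (intro mult_left_mono power_mono) auto
  finally have A: "norm A \<le> 2 * R ^ 3 / real n ^ 3" by (simp add: power_divide)
  have "norm B \<le> 2 * norm (- Y) ^ 3" unfolding B_def by (rule Ln_approx_quadratic) (use y nY in simp)
  also have "\<dots> \<le> 2 * (1 / real n) ^ 3" using y nY by (intro mult_left_mono power_mono) auto
  finally have "norm B \<le> 2 / real n ^ 3" by (simp add: power_divide)
  then have "norm w * norm B \<le> R ^ 3 * (2 / real n ^ 3)"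
    using w R self_le_power[of R 3] by (intro mult_mono) auto
  then have B: "norm (w * B) \<le> 2 * R ^ 3 / real n ^ 3" by (simp add: norm_mult mult.commute)
  have "norm C = 1 / real n * y\<^sup>2" by (simp add: C_def norm_mult norm_power nY norm_divide)
  also have "\<dots> \<le> 1 / real n * (1 / real n)\<^sup>2" using y n0 by (intro mult_left_mono power_mono) auto
  finally have "norm C \<le> 1 / real n ^ 3" by (simp add: power_divide power2_eq_square power3_eq_cube)
  moreover have "norm ((w\<^sup>2 + w) / 2) \<le> R ^ 3"
  proof -
    have "norm (w\<^sup>2 + w) \<le> norm w ^ 2 + norm w" by (metis norm_power norm_triangle_ineq)
    also have "\<dots> \<le> R ^ 2 + R" using w by (intro add_mono power_mono) auto
    also have "\<dots> \<le> R ^ 3 + R ^ 3" using R self_le_power[of R 3] power_increasing[of 2 3 R] by (intro add_mono) auto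
    finally show ?thesis by (simp add: norm_divide)
  qed
  ultimately have "norm ((w\<^sup>2 + w) / 2) * norm C \<le> R ^ 3 * (1 / real n ^ 3)"
    by (intro mult_mono) (use R in auto)
  then have C: "norm ((w\<^sup>2 + w) / 2 * C) \<le> R ^ 3 / real n ^ 3" by (simp add: norm_mult)
  have "norm (gamma_log_error w n) \<le> norm A + norm (w * B) + norm ((w\<^sup>2 + w) / 2 * C)"
    unfolding e by (intro norm_triangle_le add_right_mono norm_triangle_ineq)
  also have "\<dots> \<le> 2 * R ^ 3 / real n ^ 3 + 2 * R ^ 3 / real n ^ 3 + R ^ 3 / real n ^ 3" using A B C by linarith
  also have "\<dots> = 5 * (R ^ 3 / real n ^ 3)" by simp
  also have "\<dots> \<le> 6 * (R ^ 3 / real n ^ 3)" using R by (intro mult_right_mono) auto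
  finally show ?thesis by simp
qed

definition gamma_shift_ratio :: "complex \<Rightarrow> nat \<Rightarrow> complex" where
  "gamma_shift_ratio w n = Gamma (w + of_nat n + 1) / (fact n * exp (w * of_real (ln (real n))))"

lemma barnes_regular_nonpos: "w \<in> barnes_regular \<Longrightarrow> w + of_nat n + 1 \<notin> \<int>\<^sub>\<le>\<^sub>0"
proof
  assume w: "w \<in> barnes_regular" and "w + of_nat n + 1 \<in> \<int>\<^sub>\<le>\<^sub>0"
  then obtain m where "w + of_nat n + 1 = - of_nat m" by (auto elim!: nonpos_Ints_cases')
  then have "w = - of_nat (Suc (n + m))" by (simp add: algebra_simps eq_neg_iff_add_eq_0)
  then show False using w unfolding barnes_regular_def by blast
qed

text \<open>Gauss's limit formula for the Gamma function: up to finitely many indices, the ratio is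
  \<Gamma>(w + 1) divided by its n-th approximant.\<close>

lemma gamma_shift_ratio_LIMSEQ:
  assumes w: "w \<in> barnes_regular"
  shows "gamma_shift_ratio w \<longlonglongrightarrow> 1"
proof -
  have z: "w + 1 \<notin> \<int>\<^sub>\<le>\<^sub>0" using barnes_regular_nonpos[OF w, of 0] by simp
  have G: "Gamma (w + 1) \<noteq> 0" by (rule Gamma_nonzero[OF z])
  have "(\<lambda>n. Gamma (w + 1) / Gamma_series' (w + 1) n) \<longlonglongrightarrow> Gamma (w + 1) / Gamma (w + 1)"
    using G z by (intro tendsto_intros Gamma_series'_LIMSEQ) auto
  moreover have "\<forall>\<^sub>F n in sequentially. Gamma (w + 1) / Gamma_series' (w + 1) n = gamma_shift_ratio w n"
    using eventually_gt_at_top[of 0]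
  proof eventually_elim
    case (elim n)
    have f: "(fact n :: complex) = of_nat n * fact (n - 1)" using elim by (simp add: fact_reduce)
    have e: "exp ((w + 1) * complex_of_real (ln (real n))) = exp (w * of_real (ln (real n))) * of_nat n"
      using elim by (simp add: distrib_right exp_add exp_of_real)
    have p: "pochhammer (w + 1) n = Gamma (w + of_nat n + 1) / Gamma (w + 1)"
      using pochhammer_Gamma[OF z, of n] by (simp add: add_ac)
    show ?case using G elim unfolding Gamma_series'_def gamma_shift_ratio_def f e p by simp
  qed
  ultimately show ?thesis using G by (simp add: tendsto_cong)
qed

lemma gamma_shift_quotient:
  assumes w: "w \<in> barnes_regular"
  shows "Gamma (w + of_nat (Suc n) + 1) / fact (Suc n) = (1 + w / of_nat (Suc n)) * (Gamma (w + of_nat n + 1) / fact n)"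
proof -
  have "Gamma (w + of_nat (Suc n) + 1) = (w + of_nat n + 1) * Gamma (w + of_nat n + 1)"
    using Gamma_plus1[OF barnes_regular_nonpos[OF w, of n]] by (simp add: add_ac)
  moreover have "w + of_nat n + 1 = of_nat (Suc n) * (1 + w / of_nat (Suc n))"
  proof -
    have "of_nat (Suc n) * (1 + w / of_nat (Suc n)) = of_nat (Suc n) + w"
      by (simp add: distrib_left del: of_nat_Suc)
    then show ?thesis by simp
  qed
  ultimately have "Gamma (w + of_nat (Suc n) + 1) = of_nat (Suc n) * (1 + w / of_nat (Suc n)) * Gamma (w + of_nat n + 1)"
    by metis
  then show ?thesis by (simp add: fact_Suc del: of_nat_Suc)
qed

lemma gamma_shift_ratio_Suc:
  assumes w: "w \<in> barnes_regular" and n: "n > 0" and small: "norm w < real (Suc n)"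
  shows "gamma_shift_ratio w (Suc n) * exp (- (w\<^sup>2 + w) / 2 / of_nat (Suc n)) =
    gamma_shift_ratio w n * exp (- (w\<^sup>2 + w) / 2 / of_nat n) * exp (gamma_log_error w n)"
proof -
  have nz: "1 + w / of_nat (Suc n) \<noteq> 0"
  proof
    assume "1 + w / of_nat (Suc n) = 0"
    then have "w / of_nat (Suc n) = - 1" by (simp only: add_eq_0_iff)
    then have "norm w / real (Suc n) = 1" by (metis norm_divide norm_minus_cancel norm_of_nat norm_one)
    then show False using small by simp
  qed
  note G = gamma_shift_quotient[OF w, of n]
  have "ln (real (Suc n)) = ln (real n) + ln (1 + 1 / real n)"
  proof -
    have "real (Suc n) = real n * (1 + 1 / real n)" using n by (simp add: distrib_left)
    then show ?thesis using n by (simp only:) (subst ln_mult_pos, auto intro: add_pos_nonneg)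
  qed
  then have e: "exp (w * of_real (ln (real (Suc n)))) = exp (w * of_real (ln (real n))) * exp (w * of_real (ln (1 + 1 / real n)))"
    by (simp add: distrib_left exp_add)
  have "gamma_shift_ratio w (Suc n) = Gamma (w + of_nat (Suc n) + 1) / fact (Suc n) / exp (w * of_real (ln (real (Suc n))))"
    by (simp add: gamma_shift_ratio_def)
  also have "\<dots> = gamma_shift_ratio w n * ((1 + w / of_nat (Suc n)) * exp (- (w * of_real (ln (1 + 1 / real n)))))"
    unfolding G e by (simp add: gamma_shift_ratio_def exp_minus divide_inverse mult_ac)
  also have "(1 + w / of_nat (Suc n)) * exp (- (w * of_real (ln (1 + 1 / real n)))) =
      exp (Ln (1 + w / of_nat (Suc n)) - w * of_real (ln (1 + 1 / real n)))"
    using exp_Ln[OF nz] by (simp only: exp_diff exp_minus divide_inverse)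
  finally have "gamma_shift_ratio w (Suc n) * exp (- (w\<^sup>2 + w) / 2 / of_nat (Suc n)) = gamma_shift_ratio w n *
     (exp (Ln (1 + w / of_nat (Suc n)) - w * of_real (ln (1 + 1 / real n))) * exp (- (w\<^sup>2 + w) / 2 / of_nat (Suc n)))"
    by (simp only: mult.assoc)
  also have "exp (Ln (1 + w / of_nat (Suc n)) - w * of_real (ln (1 + 1 / real n))) * exp (- (w\<^sup>2 + w) / 2 / of_nat (Suc n)) =
     exp (- (w\<^sup>2 + w) / 2 / of_nat n) * exp (gamma_log_error w n)"
  proof -
    have "Ln (1 + w / of_nat (Suc n)) - w * of_real (ln (1 + 1 / real n)) + - (w\<^sup>2 + w) / 2 / of_nat (Suc n) =
      - (w\<^sup>2 + w) / 2 / of_nat n + gamma_log_error w n"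
    proof -
      have "- (w\<^sup>2 + w) / 2 / q = - ((w\<^sup>2 + w) / 2 * (1 / q))" for q by (simp only: minus_divide_left times_divide_eq_right mult_1_right mult_minus_left)
      moreover have "L + - \<beta> = - \<alpha> + (L + (\<alpha> - \<beta>))" for L \<alpha> \<beta> :: complex by simp
      ultimately show ?thesis unfolding gamma_log_error_def right_diff_distrib by (simp only:)
    qed
    then show ?thesis by (simp only: exp_add[symmetric])
  qed
  finally show ?thesis by (simp only: mult.assoc)
qed

definition gamma_log_remainder :: "complex \<Rightarrow> nat \<Rightarrow> complex" where
  "gamma_log_remainder w n = (\<Sum>i. gamma_log_error w (i + n))"

text \<open>The errors are cubic, so the extra factor n leaves a tail of the convergent series of
  inverse squares. The bound depends on R but not on w, and it tends to 0; the factor is the N-th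
  power in \<open>gamma_prod_identity\<close>.\<close>

lemma
  assumes w: "norm w \<le> R" and R: "R \<ge> 1" and n: "real n \<ge> 2 * R"
  shows gamma_log_error_summable: "summable (\<lambda>i. gamma_log_error w (i + n))"
    and gamma_log_remainder_bound: "real n * norm (gamma_log_remainder w n) \<le> (\<Sum>i. 6 * R ^ 3 / real (i + n) ^ 2)"
proof -
  have n0: "real n > 0" using n R by linarith
  have S: "summable (\<lambda>i. 6 * R ^ 3 / real (i + n) ^ 2)"
    using summable_mult[OF summable_ignore_initial_segment[OF inverse_power_summable[of 2], of n], of "6 * R ^ 3"]
    by (simp add: divide_inverse)
  have b: "real n * norm (gamma_log_error w (i + n)) \<le> 6 * R ^ 3 / real (i + n) ^ 2" for i
  proof -
    have "real n * norm (gamma_log_error w (i + n)) \<le> real (i + n) * (6 * R ^ 3 / real (i + n) ^ 3)"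
      using n w R by (intro mult_mono gamma_log_error_bound) auto
    also have "\<dots> = 6 * R ^ 3 / real (i + n) ^ 2" using n0 by (simp add: power2_eq_square power3_eq_cube)
    finally show ?thesis .
  qed
  have S1: "summable (\<lambda>i. real n * norm (gamma_log_error w (i + n)))"
    by (rule summable_comparison_test[OF _ S]) (use b in auto)
  then have S2: "summable (\<lambda>i. norm (gamma_log_error w (i + n)))" using n0 summable_mult[OF S1, of "1 / real n"] by simp
  then show "summable (\<lambda>i. gamma_log_error w (i + n))" by (rule summable_norm_cancel)
  have "norm (gamma_log_remainder w n) \<le> (\<Sum>i. norm (gamma_log_error w (i + n)))"
    unfolding gamma_log_remainder_def by (rule summable_norm[OF S2])
  then have "real n * norm (gamma_log_remainder w n) \<le> real n * (\<Sum>i. norm (gamma_log_error w (i + n)))"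
    using n0 by simp
  also have "\<dots> = (\<Sum>i. real n * norm (gamma_log_error w (i + n)))" by (rule suminf_mult[OF S2, symmetric])
  also have "\<dots> \<le> (\<Sum>i. 6 * R ^ 3 / real (i + n) ^ 2)" by (rule suminf_le[OF b S1 S])
  finally show "real n * norm (gamma_log_remainder w n) \<le> (\<Sum>i. 6 * R ^ 3 / real (i + n) ^ 2)" .
qed

text \<open>Telescoping from n to infinity, where the corrected ratio tends to 1, expresses it
  exactly through the sum of all later errors.\<close>

lemma gamma_shift_ratio_eq:
  assumes w: "w \<in> barnes_regular" "norm w \<le> R" and R: "R \<ge> 1" and n: "real n \<ge> 2 * R"
  shows "gamma_shift_ratio w n = exp ((w\<^sup>2 + w) / 2 / of_nat n - gamma_log_remainder w n)"
proof -
  have n0: "real n > 0" using n R by linarith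
  let ?g = "\<lambda>n. gamma_shift_ratio w n * exp (- (w\<^sup>2 + w) / 2 / of_nat n)"
  have step: "?g (j + n) = ?g n * exp (\<Sum>i<j. gamma_log_error w (i + n))" for j
  proof (induction j)
    case (Suc j)
    have "norm w < real (Suc (j + n))" using w n R by simp
    from gamma_shift_ratio_Suc[OF w(1) _ this] n0
    have "?g (Suc (j + n)) = ?g (j + n) * exp (gamma_log_error w (j + n))" by simp
    then show ?case using Suc.IH by (simp add: exp_add mult.assoc del: of_nat_Suc of_nat_add)
  qed simp
  have "(\<lambda>j. ?g n * exp (\<Sum>i<j. gamma_log_error w (i + n))) \<longlonglongrightarrow> ?g n * exp (gamma_log_remainder w n)"
    unfolding gamma_log_remainder_def
    by (intro tendsto_intros summable_LIMSEQ gamma_log_error_summable[OF w(2) R n])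
  moreover have "(\<lambda>j. ?g (j + n)) \<longlonglongrightarrow> 1 * exp 0"
  proof (intro tendsto_mult tendsto_exp)
    show "(\<lambda>j. gamma_shift_ratio w (j + n)) \<longlonglongrightarrow> 1"
      by (rule LIMSEQ_ignore_initial_segment[OF gamma_shift_ratio_LIMSEQ[OF w(1)]])
    have "(\<lambda>j. - (w\<^sup>2 + w) / 2 * (1 / of_nat j)) \<longlonglongrightarrow> - (w\<^sup>2 + w) / 2 * 0"
      by (intro tendsto_intros lim_1_over_n)
    then show "(\<lambda>j. - (w\<^sup>2 + w) / 2 / of_nat (j + n)) \<longlonglongrightarrow> 0"
      by (intro LIMSEQ_ignore_initial_segment) simp
  qed
  ultimately have "?g n * exp (gamma_log_remainder w n) = 1"
    unfolding step using LIMSEQ_unique by fastforce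
  then have "gamma_shift_ratio w n * exp (- (w\<^sup>2 + w) / 2 / of_nat n + gamma_log_remainder w n) = 1"
    by (simp add: exp_add mult.assoc)
  moreover have "exp (- (w\<^sup>2 + w) / 2 / of_nat n + gamma_log_remainder w n) *
      exp ((w\<^sup>2 + w) / 2 / of_nat n - gamma_log_remainder w n) = 1"
  proof -
    have "- (w\<^sup>2 + w) / 2 / of_nat n + gamma_log_remainder w n + ((w\<^sup>2 + w) / 2 / of_nat n - gamma_log_remainder w n) = 0"
    proof -
      have "- (w\<^sup>2 + w) / 2 / q = - ((w\<^sup>2 + w) / 2 / q)" for q by (simp only: minus_divide_left times_divide_eq_right mult_1_right mult_minus_left)
      moreover have "- \<alpha> + L + (\<alpha> - L) = 0" for L \<alpha> :: complex by simp
      ultimately show ?thesis by (simp only:)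
    qed
    then show ?thesis by (simp only: exp_add[symmetric] exp_zero)
  qed
  moreover have "a = c" if "a * b = 1" "b * c = 1" for a b c :: complex
    using that by (metis mult.assoc mult_1_left mult_1_right)
  ultimately show ?thesis by blast
qed

section \<open>Products of Gamma values over consecutive arguments\<close>

definition gamma_prod :: "complex \<Rightarrow> nat \<Rightarrow> complex" where
  "gamma_prod w N = (\<Prod>k<N. Gamma (w + of_nat k + 1) / fact k)"

text \<open>The asymptotics of ln (G(N + w + 1) / G(N + 1)) up to o(1). By the functional equation
  of G, the product \<open>gamma_prod w N\<close> is this quotient of G-values divided by G(w +
  1).\<close>

definition gamma_prod_exponent :: "complex \<Rightarrow> nat \<Rightarrow> complex" where
  "gamma_prod_exponent w N = w * of_real (real N * ln (real N) - real N) + w\<^sup>2 / 2 * of_real (ln (real N)) +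
     w / 2 * of_real (ln (2 * pi))"

text \<open>Multiplicative summation by parts. One more factor a_N turns a_N^N into a_N^(N + 1), and
  the new power of 1 + w / (N + 1) turns this into the power N + 1 of the next term.\<close>

lemma gamma_prod_identity:
  assumes w: "w \<in> barnes_regular"
  shows "gamma_prod w N * (\<Prod>k<N. (1 + w / of_nat (Suc k)) ^ Suc k) = (Gamma (w + of_nat N + 1) / fact N) ^ N"
proof (induction N)
  case (Suc N)
  let ?G = "Gamma (w + of_nat N + 1) / fact N"
  have "gamma_prod w (Suc N) * (\<Prod>k<Suc N. (1 + w / of_nat (Suc k)) ^ Suc k) =
    (gamma_prod w N * (\<Prod>k<N. (1 + w / of_nat (Suc k)) ^ Suc k)) * ?G * (1 + w / of_nat (Suc N)) ^ Suc N"
    unfolding gamma_prod_def prod.lessThan_Suc by (simp only: mult_ac)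
  also have "\<dots> = ((1 + w / of_nat (Suc N)) * ?G) ^ Suc N"
    unfolding Suc.IH by (simp only: power_mult_distrib power_Suc mult_ac)
  also have "(1 + w / of_nat (Suc N)) * ?G = Gamma (w + of_nat (Suc N) + 1) / fact (Suc N)"
    by (rule gamma_shift_quotient[OF w, symmetric])
  finally show ?case .
qed (simp add: gamma_prod_def)

text \<open>The exponential parts of the Barnes factors add up to w^2 / 2 times the harmonic number
  minus N w. The terms growing like N ln N and N then cancel against the exponent, and the
  difference of the harmonic number and ln N is left, from which Euler's constant arises.\<close>

lemma gamma_prod_eq:
  assumes w: "w \<in> barnes_regular" "norm w \<le> R" and R: "R \<ge> 1" and N: "real N \<ge> 2 * R"
  shows "gamma_prod w N * exp (- gamma_prod_exponent w N) =
    exp ((w\<^sup>2 + w) / 2 - of_nat N * gamma_log_remainder w N + w\<^sup>2 / 2 * of_real (harm N - ln (real N))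
      - w / 2 * of_real (ln (2 * pi))) / (\<Prod>k<N. barnes_factor k w)"
proof -
  have N0: "real N > 0" using N R by linarith
  let ?P = "\<Prod>k<N. (1 + w / of_nat (Suc k)) ^ Suc k"
  let ?B = "\<Prod>k<N. barnes_factor k w"
  let ?r = "gamma_log_remainder w N"
  define l where "l = complex_of_real (ln (real N))"
  define h where "h = complex_of_real (harm N)"
  have B0: "?B \<noteq> 0" using barnes_factor_nonzero[OF w(1)] by simp
  have "(\<Sum>k<N. w\<^sup>2 / (2 * of_nat (Suc k)) - w) = w\<^sup>2 / 2 * h - of_nat N * w"
  proof -
    have h: "h = (\<Sum>k<N. inverse (of_nat (Suc k)))"
      by (simp add: h_def harm_def sum.atLeast1_atMost_eq)
    have "w\<^sup>2 / (2 * c) = w\<^sup>2 / 2 * inverse c" for c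
      by (simp only: divide_inverse inverse_mult_distrib mult.assoc)
    then show ?thesis
      by (simp only: h sum_subtractf sum_distrib_left sum_constant card_lessThan)
  qed
  then have B: "?B = ?P * exp (w\<^sup>2 / 2 * h - of_nat N * w)"
    unfolding barnes_factor_def prod.distrib by (simp only: exp_sum[symmetric] finite_lessThan)
  have G: "Gamma (w + of_nat N + 1) / fact N = exp ((w\<^sup>2 + w) / 2 / of_nat N - ?r + w * l)"
    using gamma_shift_ratio_eq[OF w R N] unfolding gamma_shift_ratio_def l_def
    by (simp add: exp_add divide_eq_eq divide_divide_eq_left[symmetric] mult_ac del: divide_divide_eq_left)
  have "gamma_prod w N * ?P = exp (of_nat N * ((w\<^sup>2 + w) / 2 / of_nat N - ?r + w * l))"
    unfolding gamma_prod_identity[OF w(1)] G exp_of_nat_mult ..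
  also have "of_nat N * ((w\<^sup>2 + w) / 2 / of_nat N - ?r + w * l) = (w\<^sup>2 + w) / 2 - of_nat N * ?r + of_nat N * w * l"
  proof -
    have "c * (a / c - b + w * l) = a - c * b + c * w * l" if "c \<noteq> 0" for a b c :: complex
      using that by (simp add: distrib_left right_diff_distrib)
    from this[of "of_nat N"] show ?thesis using N0 by (simp only: of_nat_eq_0_iff of_nat_0_less_iff)
  qed
  finally have "gamma_prod w N * ?B = exp ((w\<^sup>2 + w) / 2 - of_nat N * ?r + of_nat N * w * l + (w\<^sup>2 / 2 * h - of_nat N * w))"
    unfolding B by (simp only: exp_add mult.assoc[symmetric])
  then have "(gamma_prod w N * exp (- gamma_prod_exponent w N)) * ?B =
      exp ((w\<^sup>2 + w) / 2 - of_nat N * ?r + of_nat N * w * l + (w\<^sup>2 / 2 * h - of_nat N * w) + - gamma_prod_exponent w N)"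
    unfolding exp_add[of _ "- gamma_prod_exponent w N"] by (metis mult.commute mult.left_commute)
  also have "(w\<^sup>2 + w) / 2 - of_nat N * ?r + of_nat N * w * l + (w\<^sup>2 / 2 * h - of_nat N * w) + - gamma_prod_exponent w N =
     (w\<^sup>2 + w) / 2 - of_nat N * ?r + w\<^sup>2 / 2 * of_real (harm N - ln (real N)) - w / 2 * of_real (ln (2 * pi))"
  proof -
    have "A - b + n * w * l + (q * h - n * w) + - (w * (n * l - n) + q * l + p) = A - b + q * (h - l) - p"
      for A b n q p :: complex by (simp add: algebra_simps)
    then show ?thesis
      unfolding gamma_prod_exponent_def of_real_diff of_real_mult of_real_of_nat_eq l_def[symmetric] h_def[symmetric] .
  qed
  finally show ?thesis using B0 by (simp add: field_simps)
qed

text \<open>The exponential is uniformly continuous on bounded sets only; the bound on the limit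
  keeps the approximants eventually in the ball of radius \<open>b + 1\<close>.\<close>

lemma uniform_limit_exp:
  fixes f :: "'a \<Rightarrow> 'b \<Rightarrow> complex"
  assumes f: "uniform_limit S f l F" and b: "\<And>x. x \<in> S \<Longrightarrow> norm (l x) \<le> b"
  shows "uniform_limit S (\<lambda>n x. exp (f n x)) (\<lambda>x. exp (l x)) F"
proof (rule uniform_limit_compose_uniformly_continuous_on[OF f])
  show "uniformly_continuous_on (cball 0 (b + 1)) (exp :: complex \<Rightarrow> complex)"
    by (intro compact_uniformly_continuous continuous_intros compact_cball)
  from uniform_limitD[OF f, of 1] have "\<forall>\<^sub>F n in F. \<forall>x\<in>S. dist (f n x) (l x) < 1" by simp
  then show "\<forall>\<^sub>F n in F. \<forall>x\<in>S. f n x \<in> cball 0 (b + 1)"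
  proof eventually_elim
    case (elim n)
    show ?case
    proof
      fix x assume x: "x \<in> S"
      have "norm (f n x) \<le> norm (l x) + dist (f n x) (l x)"
        by (metis dist_norm norm_triangle_sub)
      with elim x b[OF x] show "f n x \<in> cball 0 (b + 1)" by (auto simp: dist_norm)
    qed
  qed
qed simp

theorem gamma_prod_asymptotics:
  assumes K: "compact K" "K \<subseteq> barnes_regular"
  shows "uniform_limit K (\<lambda>N w. gamma_prod w N * exp (- gamma_prod_exponent w N)) (\<lambda>w. 1 / barnes_G (w + 1)) sequentially"
proof -
  obtain R where R: "R \<ge> 1" "\<And>w. w \<in> K \<Longrightarrow> norm w \<le> R"
  proof -
    from K(1) obtain B where "\<forall>x\<in>K. norm x \<le> B" using compact_imp_bounded bounded_iff by metis
    then show thesis by (intro that[of "max 1 B"]) (auto simp: max.coboundedI2)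
  qed
  define X where "X N w = (w\<^sup>2 + w) / 2 - of_nat N * gamma_log_remainder w N + w\<^sup>2 / 2 * of_real (harm N - ln (real N))
      - w / 2 * of_real (ln (2 * pi))" for N and w :: complex
  \<comment> \<open>The limit of the exponents in \<open>gamma_prod_eq\<close>. The prefactor of the
    Weierstrass product in \<open>barnes_G_eq\<close> is exp (- L).\<close>
  define L where "L w = (w\<^sup>2 + w) / 2 + w\<^sup>2 / 2 * of_real euler_mascheroni - w / 2 * of_real (ln (2 * pi))" for w :: complex
  have ev: "\<forall>\<^sub>F N in sequentially. real N \<ge> 2 * R"
    using filterlim_real_sequentially by (simp add: filterlim_at_top)
  define T where "T N = (\<Sum>i. 6 * R ^ 3 / real (i + N) ^ 2)" for N
  have T: "T \<longlonglongrightarrow> 0"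
  proof -
    have S: "summable (\<lambda>i. 6 * R ^ 3 / real i ^ 2)"
      using summable_mult[OF inverse_power_summable[of 2], of "6 * R ^ 3"] by (simp add: divide_inverse)
    have "T = (\<lambda>N. (\<Sum>i. 6 * R ^ 3 / real i ^ 2) - (\<Sum>i<N. 6 * R ^ 3 / real i ^ 2))"
      unfolding T_def by (rule ext) (rule suminf_minus_initial_segment[OF S])
    moreover have "(\<lambda>N. (\<Sum>i. 6 * R ^ 3 / real i ^ 2) - (\<Sum>i<N. 6 * R ^ 3 / real i ^ 2)) \<longlonglongrightarrow>
      (\<Sum>i. 6 * R ^ 3 / real i ^ 2) - (\<Sum>i. 6 * R ^ 3 / real i ^ 2)"
      by (intro tendsto_intros summable_LIMSEQ[OF S])
    ultimately show ?thesis by simp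
  qed
  define D where "D N = T N + R\<^sup>2 / 2 * \<bar>harm N - ln (real N) - euler_mascheroni\<bar>" for N
  have "D \<longlonglongrightarrow> 0 + R\<^sup>2 / 2 * \<bar>euler_mascheroni - euler_mascheroni\<bar>"
    unfolding D_def by (intro tendsto_intros T euler_mascheroni_LIMSEQ)
  then have D: "D \<longlonglongrightarrow> 0" by simp
  have XL: "uniform_limit K X L sequentially"
  proof (rule uniform_limitI)
    fix e :: real assume "e > 0"
    then have "\<forall>\<^sub>F N in sequentially. D N < e" using order_tendstoD(2)[OF D] by simp
    then show "\<forall>\<^sub>F N in sequentially. \<forall>w\<in>K. dist (X N w) (L w) < e"
      using ev
    proof eventually_elim
      case (elim N)
      show ?case
      proof
        fix w assume w: "w \<in> K"
        have "X N w - L w = - (of_nat N * gamma_log_remainder w N) + w\<^sup>2 / 2 * of_real (harm N - ln (real N) - euler_mascheroni)"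
          by (simp only: X_def L_def of_real_diff right_diff_distrib) simp
        then have "dist (X N w) (L w) \<le> norm (- (of_nat N * gamma_log_remainder w N)) + norm (w\<^sup>2 / 2 * of_real (harm N - ln (real N) - euler_mascheroni))"
          unfolding dist_norm by (simp only: norm_triangle_ineq)
        also have "norm (- (of_nat N * gamma_log_remainder w N)) \<le> T N"
          unfolding T_def using gamma_log_remainder_bound[OF R(2)[OF w] R(1) elim(2)] by (simp add: norm_mult)
        also have "norm (w\<^sup>2 / 2 * of_real (harm N - ln (real N) - euler_mascheroni)) = (norm w)\<^sup>2 / 2 * \<bar>harm N - ln (real N) - euler_mascheroni\<bar>"
          by (simp only: norm_mult norm_of_real norm_divide norm_power norm_numeral)
        also have "\<dots> \<le> R\<^sup>2 / 2 * \<bar>harm N - ln (real N) - euler_mascheroni\<bar>"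
          using R(2)[OF w] by (intro mult_right_mono divide_right_mono power_mono) auto
        finally have "dist (X N w) (L w) \<le> D N" by (simp add: D_def)
        then show "dist (X N w) (L w) < e" using elim(1) by simp
      qed
    qed
  qed
  have cL: "continuous_on K L" unfolding L_def by (intro continuous_intros) auto
  then obtain b where b: "\<And>w. w \<in> K \<Longrightarrow> norm (L w) \<le> b"
    using compact_imp_bounded[OF compact_continuous_image[OF _ K(1)]] by (force simp: bounded_iff)
  have eL: "uniform_limit K (\<lambda>N w. exp (X N w)) (\<lambda>w. exp (L w)) sequentially"
    by (rule uniform_limit_exp[OF XL b])
  have cB: "continuous_on K barnes_prod"
    by (rule continuous_on_subset[OF holomorphic_on_imp_continuous_on[OF barnes_prod_holomorphic]]) simp
  \<comment> \<open>The uniform limit of a quotient requires a denominator bounded away from 0; on a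
    compact set without zeros the minimum of its modulus serves.\<close>
  obtain c where c: "c > 0" "\<And>w. w \<in> K \<Longrightarrow> c \<le> norm (barnes_prod w)"
  proof (cases "K = {}")
    case True
    then show thesis using that[of 1] by simp
  next
    case False
    obtain z where "z \<in> K" "\<And>w. w \<in> K \<Longrightarrow> norm (barnes_prod z) \<le> norm (barnes_prod w)"
      using continuous_attains_inf[OF K(1) False continuous_on_norm[OF cB]] by blast
    then show thesis using that[of "norm (barnes_prod z)"] barnes_prod_nonzero K(2) by auto
  qed
  have "uniform_limit K (\<lambda>N w. exp (X N w) / (\<Prod>k<N. barnes_factor k w)) (\<lambda>w. exp (L w) / barnes_prod w) sequentially"
  proof (rule uniform_lim_divide[OF eL barnes_prod_uniform_limit[OF K(1)] _ c(2) c(1)])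
    show "bounded ((\<lambda>w. exp (L w)) ` K)"
      by (intro compact_imp_bounded compact_continuous_image K continuous_intros cL)
  qed
  also have "?this \<longleftrightarrow> ?thesis"
  proof (rule uniform_limit_cong)
    show "\<forall>\<^sub>F N in sequentially. \<forall>w\<in>K. exp (X N w) / (\<Prod>k<N. barnes_factor k w) = gamma_prod w N * exp (- gamma_prod_exponent w N)"
      using ev
    proof eventually_elim
      case (elim N)
      show ?case using gamma_prod_eq[OF _ R(2) R(1) elim] K(2) by (auto simp: X_def)
    qed
    fix w assume w: "w \<in> K"
    have "barnes_G (w + 1) = exp (- L w) * barnes_prod w"
      unfolding barnes_G_eq L_def by (rule arg_cong2[where f=times]) (auto simp: algebra_simps add_divide_distrib)
    then show "exp (L w) / barnes_prod w = 1 / barnes_G (w + 1)" by (simp only: exp_minus) (simp add: divide_simps)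
  qed
  finally show ?thesis .
qed

section \<open>The mod-Gaussian limit\<close>

text \<open>The coefficients of \<open>t\<close> and \<open>t\<^sup>2\<close> that remain in the exponent after both products of gamma functions
  have been divided by their asymptotics.\<close>

definition linear_coeff :: "nat \<Rightarrow> nat \<Rightarrow> real" where
  "linear_coeff d r = (ln (1 + real r) + real r * ln 2) / 2 - log_volume_centering (d + r)
     + (real ((r + 1) div 2) * ln (real ((r + 1) div 2)) - real ((r + 1) div 2)) / 2
     + (real d - 1) / 4 * ln (real ((r + 1) div 2))
     + (real (r div 2) * ln (real (r div 2)) - real (r div 2)) / 2
     + real d / 4 * ln (real (r div 2)) + ln (2 * pi) / 2"

definition quadratic_coeff :: "nat \<Rightarrow> nat \<Rightarrow> real" where
  "quadratic_coeff d r = (ln (real ((r + 1) div 2)) + ln (real (r div 2))) / 8 - ln (real (d + r) / 2) / 4"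

text \<open>Along each parity class the terms with \<open>div 2\<close> become linear in the index,
  and an explicit asymptotic expansion applies.\<close>

lemma LIMSEQ_parity:
  fixes f :: "nat \<Rightarrow> 'a :: topological_space"
  assumes "(\<lambda>k. f (2 * k)) \<longlonglongrightarrow> L" "(\<lambda>k. f (2 * k + 1)) \<longlonglongrightarrow> L"
  shows "f \<longlonglongrightarrow> L"
proof (rule topological_tendstoI)
  fix S assume S: "open S" "L \<in> S"
  obtain A where A: "\<And>k. k \<ge> A \<Longrightarrow> f (2 * k) \<in> S"
    using topological_tendstoD[OF assms(1) S] by (auto simp: eventually_sequentially)
  obtain B where B: "\<And>k. k \<ge> B \<Longrightarrow> f (2 * k + 1) \<in> S"
    using topological_tendstoD[OF assms(2) S] by (auto simp: eventually_sequentially)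
  have "f n \<in> S" if "n \<ge> 2 * max A B + 1" for n
  proof (cases "even n")
    case True
    then show ?thesis using A[of "n div 2"] that by auto
  next
    case False
    then have "n = 2 * (n div 2) + 1" by presburger
    then show ?thesis using B[of "n div 2"] that by (metis add_le_cancel_right le_max_iff_disj mult_le_cancel1 zero_less_numeral max.bounded_iff)
  qed
  then show "\<forall>\<^sub>F n in sequentially. f n \<in> S" by (auto simp: eventually_sequentially)
qed

lemma log_volume_centering_alt:
  "log_volume_centering n = (real n * ln (real n) - real n + ln (real n) / 2 + (3 / 2 * ln 2 + ln pi)) / 2"
proof -
  have "ln (2 powr (3/2) * pi) = 3 / 2 * ln 2 + ln pi"
    by (subst ln_mult_pos) (auto simp: ln_powr)
  then show ?thesis by (simp add: log_volume_centering_def)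
qed

lemma ln_2_pi: "ln (2 * pi) = ln 2 + ln pi"
  by (rule ln_mult_pos) auto

text \<open>The centering of the log-volume is confirmed here: all growing terms and the constants
  with \<pi> cancel. The remaining constant is the origin of the power of 2 in the denominator of
  the limit.\<close>

lemma linear_coeff_LIMSEQ: "linear_coeff d \<longlonglongrightarrow> - (real d / 2) * ln 2"
proof (rule LIMSEQ_parity)
  have "(\<lambda>k::nat. (ln (1 + 2 * real k) + 2 * real k * ln 2) / 2 -
     ((real d + 2 * real k) * ln (real d + 2 * real k) - (real d + 2 * real k) + ln (real d + 2 * real k) / 2 + (3 / 2 * ln 2 + ln pi)) / 2
     + (real k * ln (real k) - real k) / 2 + (real d - 1) / 4 * ln (real k)
     + (real k * ln (real k) - real k) / 2 + real d / 4 * ln (real k) + (ln 2 + ln pi) / 2) \<longlonglongrightarrow> - (real d / 2) * ln 2"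
    by (real_asymp simp: field_simps)
  then show "(\<lambda>k. linear_coeff d (2 * k)) \<longlonglongrightarrow> - (real d / 2) * ln 2"
    by (simp add: linear_coeff_def log_volume_centering_alt ln_2_pi)
  have "(\<lambda>k::nat. (ln (2 + 2 * real k) + (2 * real k + 1) * ln 2) / 2 -
     ((real d + 2 * real k + 1) * ln (real d + 2 * real k + 1) - (real d + 2 * real k + 1) + ln (real d + 2 * real k + 1) / 2 + (3 / 2 * ln 2 + ln pi)) / 2
     + ((real k + 1) * ln (real k + 1) - (real k + 1)) / 2 + (real d - 1) / 4 * ln (real k + 1)
     + (real k * ln (real k) - real k) / 2 + real d / 4 * ln (real k) + (ln 2 + ln pi) / 2) \<longlonglongrightarrow> - (real d / 2) * ln 2"
    by (real_asymp simp: field_simps)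
  then show "(\<lambda>k. linear_coeff d (2 * k + 1)) \<longlonglongrightarrow> - (real d / 2) * ln 2"
    by (simp add: linear_coeff_def log_volume_centering_alt ln_2_pi add_ac)
qed

text \<open>Each of the two Gamma products has about n / 2 factors and contributes ln (n / 2) / 8;
  together this is ln (n / 2) / 4, the coefficient prescribed by the parameters of the mod-Gaussian
  convergence.\<close>

lemma quadratic_coeff_LIMSEQ: "quadratic_coeff d \<longlonglongrightarrow> 0"
proof (rule LIMSEQ_parity)
  have "(\<lambda>k::nat. (ln (real k) + ln (real k)) / 8 - ln ((real d + 2 * real k) / 2) / 4) \<longlonglongrightarrow> 0" by real_asymp
  then show "(\<lambda>k. quadratic_coeff d (2 * k)) \<longlonglongrightarrow> 0" by (simp add: quadratic_coeff_def)
  have "(\<lambda>k::nat. (ln (real k + 1) + ln (real k)) / 8 - ln ((real d + 2 * real k + 1) / 2) / 4) \<longlonglongrightarrow> 0" by real_asymp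
  then show "(\<lambda>k. quadratic_coeff d (2 * k + 1)) \<longlonglongrightarrow> 0" by (simp add: quadratic_coeff_def add_ac)
qed

lemma prod_parity_split:
  fixes f :: "nat \<Rightarrow> 'a :: comm_monoid_mult"
  shows "(\<Prod>j<r. f j) = (\<Prod>k<(r + 1) div 2. f (2 * k)) * (\<Prod>k<r div 2. f (2 * k + 1))"
proof (induction r)
  case (Suc r)
  show ?case
  proof (cases "even r")
    case True
    then obtain q where "r = 2 * q" by auto
    then show ?thesis using Suc.IH by (simp add: mult_ac)
  next
    case False
    then obtain q where "r = 2 * q + 1" by (auto elim: oddE)
    then show ?thesis using Suc.IH by (simp add: mult_ac)
  qed
qed simp

section \<open>The moment generating function in terms of normalised Gamma products\<close>

definition shifted :: "real \<Rightarrow> complex \<Rightarrow> complex" where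
  "shifted c t = of_real c + t / 2"

definition normalized_gamma_prod :: "complex \<Rightarrow> nat \<Rightarrow> complex" where
  "normalized_gamma_prod w N = gamma_prod w N * exp (- gamma_prod_exponent w N)"

lemma of_real_barnes_regular: "c > - 1 \<Longrightarrow> complex_of_real c \<in> barnes_regular"
proof -
  assume c: "c > - 1"
  have False if "complex_of_real c = - of_nat (Suc k)" for k
    using arg_cong[OF that, of Re] c by simp
  then show ?thesis unfolding barnes_regular_def by blast
qed

lemma gamma_prod_nonzero: "w \<in> barnes_regular \<Longrightarrow> gamma_prod w N \<noteq> 0"
  unfolding gamma_prod_def using barnes_regular_nonpos[of w] by (auto simp: Gamma_eq_zero_iff)

text \<open>The exponent is quadratic in w. At w = c + t / 2 its term w^2 / 2 contributes c t / 2 +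
  t^2 / 8 beyond the value at c, which is where the dependence on t^2 comes from.\<close>

lemma normalized_gamma_prod_quotient:
  assumes "c > - 1"
  shows "gamma_prod (shifted c t) N / gamma_prod (of_real c) N =
    normalized_gamma_prod (shifted c t) N / normalized_gamma_prod (of_real c) N *
    exp (t * of_real ((real N * ln (real N) - real N) / 2 + c / 2 * ln (real N) + ln (2 * pi) / 4) +
      t\<^sup>2 * of_real (ln (real N) / 8))"
proof -
  have nz: "gamma_prod (of_real c) N \<noteq> 0" by (rule gamma_prod_nonzero[OF of_real_barnes_regular[OF assms]])
  have "gamma_prod_exponent (shifted c t) N = gamma_prod_exponent (of_real c) N +
     (t * of_real ((real N * ln (real N) - real N) / 2 + c / 2 * ln (real N) + ln (2 * pi) / 4) + t\<^sup>2 * of_real (ln (real N) / 8))"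
    unfolding gamma_prod_exponent_def shifted_def
    by (simp add: field_simps power2_eq_square)
  then have "exp (- gamma_prod_exponent (of_real c) N) = exp (- gamma_prod_exponent (shifted c t) N) *
    exp (t * of_real ((real N * ln (real N) - real N) / 2 + c / 2 * ln (real N) + ln (2 * pi) / 4) + t\<^sup>2 * of_real (ln (real N) / 8))"
    by (simp add: exp_add[symmetric])
  then show ?thesis unfolding normalized_gamma_prod_def using nz by (simp add: field_simps)
qed

lemma gamma_prod_quotient:
  "(\<Prod>k<N. Gamma (of_real (c + real (Suc k)) + t / 2) / of_real (Gamma (c + real (Suc k)))) =
    gamma_prod (shifted c t) N / gamma_prod (of_real c) N"
proof -
  have "Gamma (of_real (c + real (Suc k)) + t / 2) / of_real (Gamma (c + real (Suc k))) =
    (Gamma (shifted c t + of_nat k + 1) / fact k) / (Gamma (of_real c + of_nat k + 1) / fact k)" for k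
    by (simp add: shifted_def Gamma_complex_of_real[symmetric] add_ac)
  then show ?thesis unfolding gamma_prod_def by (simp only: prod_dividef)
qed

text \<open>\<open>A\<close> and \<open>B\<close> are chosen such that the shape parameter (d + j +
  1) / 2 equals A + k + 1 for j = 2 k and B + k + 1 for j = 2 k + 1. Both exceed -1 even for d = 0,
  so the denominators are regular.\<close>

lemma volume_mgf_eq:
  fixes t :: complex and d r :: nat
  defines "A \<equiv> (real d - 1) / 2" and "B \<equiv> real d / 2"
  shows "volume_mgf d r (log_volume_centering (d + r)) t / exp ((1/4) * t\<^sup>2 * of_real (ln (real (d + r) / 2))) =
    normalized_gamma_prod (shifted A t) ((r + 1) div 2) / normalized_gamma_prod (of_real A) ((r + 1) div 2) *
    (normalized_gamma_prod (shifted B t) (r div 2) / normalized_gamma_prod (of_real B) (r div 2)) *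
    exp (t * of_real (linear_coeff d r) + t\<^sup>2 * of_real (quadratic_coeff d r))"
proof -
  let ?N = "(r + 1) div 2" and ?M = "r div 2" and ?m = "log_volume_centering (d + r)"
  define f where "f j = Gamma (of_real (real (Suc (d + j)) / 2) + t / 2) / of_real (Gamma (real (Suc (d + j)) / 2))" for j
  let ?E = "\<lambda>c N. t * of_real ((real N * ln (real N) - real N) / 2 + c / 2 * ln (real N) + ln (2 * pi) / 4) + t\<^sup>2 * of_real (ln (real N) / 8)"
  have AB: "A > - 1" "B > - 1" by (auto simp: A_def B_def)
  have "f (2 * k) = Gamma (of_real (A + real (Suc k)) + t / 2) / of_real (Gamma (A + real (Suc k)))" for k
  proof -
    have "real (Suc (d + 2 * k)) / 2 = A + real (Suc k)" by (simp add: A_def field_simps)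
    then show ?thesis unfolding f_def by (simp only:)
  qed
  then have fA: "(\<Prod>k<?N. f (2 * k)) = gamma_prod (shifted A t) ?N / gamma_prod (of_real A) ?N"
    using gamma_prod_quotient[where c=A and t=t and N="?N"] by (simp only:)
  have "f (2 * k + 1) = Gamma (of_real (B + real (Suc k)) + t / 2) / of_real (Gamma (B + real (Suc k)))" for k
  proof -
    have "real (Suc (d + (2 * k + 1))) / 2 = B + real (Suc k)" by (simp add: B_def field_simps)
    then show ?thesis unfolding f_def by (simp only:)
  qed
  then have fB: "(\<Prod>k<?M. f (2 * k + 1)) = gamma_prod (shifted B t) ?M / gamma_prod (of_real B) ?M"
    using gamma_prod_quotient[where c=B and t=t and N="?M"] by (simp only:)
  let ?X = "t * of_real ((ln (1 + real r) + real r * ln 2) / 2 - ?m)"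
  let ?Q = "(1/4) * t\<^sup>2 * of_real (ln (real (d + r) / 2))"
  let ?U = "normalized_gamma_prod (shifted A t) ?N / normalized_gamma_prod (of_real A) ?N"
  let ?V = "normalized_gamma_prod (shifted B t) ?M / normalized_gamma_prod (of_real B) ?M"
  have "volume_mgf d r ?m t / exp ?Q = exp ?X * ((?U * exp (?E A ?N)) * (?V * exp (?E B ?M))) / exp ?Q"
    unfolding volume_mgf_def f_def[symmetric] prod_parity_split[of f r] fA fB
      normalized_gamma_prod_quotient[OF AB(1)] normalized_gamma_prod_quotient[OF AB(2)] ..
  also have "\<dots> = ?U * ?V * (exp ?X * exp (?E A ?N) * exp (?E B ?M) / exp ?Q)"
    by (simp only: divide_inverse mult_ac)
  also have "exp ?X * exp (?E A ?N) * exp (?E B ?M) / exp ?Q = exp (?X + ?E A ?N + ?E B ?M - ?Q)"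
    by (simp only: exp_add exp_diff)
  also have "?X + ?E A ?N + ?E B ?M - ?Q = t * of_real (linear_coeff d r) + t\<^sup>2 * of_real (quadratic_coeff d r)"
  proof -
    define nA where "nA = real ?N * ln (real ?N) - real ?N"
    define nB where "nB = real ?M * ln (real ?M) - real ?M"
    define lA where "lA = ln (real ?N)"
    define lB where "lB = ln (real ?M)"
    define q where "q = ln (real (d + r) / 2)"
    define p where "p = ln (2 * pi)"
    define z where "z = (ln (1 + real r) + real r * ln 2) / 2 - ?m"
    have 1: "linear_coeff d r = z + (nA / 2 + A / 2 * lA + p / 4) + (nB / 2 + B / 2 * lB + p / 4)"
      unfolding linear_coeff_def nA_def nB_def lA_def lB_def p_def z_def A_def B_def by simp
    have 2: "quadratic_coeff d r = lA / 8 + lB / 8 - q / 4"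
      unfolding quadratic_coeff_def lA_def lB_def q_def by simp
    show ?thesis unfolding 1 2
      unfolding nA_def[symmetric] nB_def[symmetric]
      unfolding lA_def[symmetric] lB_def[symmetric] q_def[symmetric] p_def[symmetric] z_def[symmetric]
      by (simp add: algebra_simps)
  qed
  finally show ?thesis .
qed

lemma uniform_limit_const_fun:
  "(a \<longlongrightarrow> l) F \<Longrightarrow> uniform_limit S (\<lambda>n _. a n) (\<lambda>_. l) F"
  by (intro uniform_limitI) (auto dest: tendstoD)

lemma gaussian_volume_limit_eq:
  "gaussian_volume_limit d t =
    (1 / barnes_G (shifted ((real d - 1) / 2) t + 1)) / (1 / barnes_G (of_real ((real d - 1) / 2) + 1)) *
    ((1 / barnes_G (shifted (real d / 2) t + 1)) / (1 / barnes_G (of_real (real d / 2) + 1))) *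
    exp (t * of_real (- (real d / 2) * ln 2))"
proof -
  have p: "2 powr (t * of_nat d / 2) = exp (- (t * of_real (- (real d / 2) * ln 2)))"
    unfolding powr_def using Ln_of_real[of 2] by (simp add: mult.assoc)
  have a: "(of_nat d + 1) / 2 = complex_of_real ((real d - 1) / 2) + 1"
    "(of_nat d + 2) / 2 = complex_of_real (real d / 2) + 1" by (simp_all add: field_simps)
  then have b: "(of_nat d + 1) / 2 + t / 2 = shifted ((real d - 1) / 2) t + 1"
    "(of_nat d + 2) / 2 + t / 2 = shifted (real d / 2) t + 1" by (simp_all add: shifted_def)
  have c: "x * y / (inverse z * u * v) = (1 / u) / (1 / x) * ((1 / v) / (1 / y)) * z" for x y z u v :: complex
    by (simp only: divide_inverse inverse_mult_distrib inverse_inverse_eq mult_1_left mult_ac)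
  show ?thesis unfolding gaussian_volume_limit_def p exp_minus b unfolding a by (rule c)
qed

text \<open>The first shift is singular at t = -d - 1, -d - 3, ... and the second at t = -d - 2, -d
  - 4, ..., so the excluded points are exactly the union of both sequences.\<close>

lemma shifted_barnes_regular:
  assumes "t \<notin> {- of_nat (d + j) | j. j \<ge> 1}"
  shows "shifted ((real d - 1) / 2) t \<in> barnes_regular" "shifted (real d / 2) t \<in> barnes_regular"
proof -
  have False if "shifted ((real d - 1) / 2) t = - of_nat (Suc k)" for k
  proof -
    have "t = - of_nat (d + (2 * k + 1))" using that by (simp add: shifted_def field_simps eq_neg_iff_add_eq_0)
    then show False using assms by fastforce
  qed
  moreover have False if "shifted (real d / 2) t = - of_nat (Suc k)" for k
  proof -
    have "t = - of_nat (d + (2 * k + 2))" using that by (simp add: shifted_def field_simps eq_neg_iff_add_eq_0)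
    then show False using assms by fastforce
  qed
  ultimately show "shifted ((real d - 1) / 2) t \<in> barnes_regular" "shifted (real d / 2) t \<in> barnes_regular"
    unfolding barnes_regular_def by blast+
qed

lemma uniform_limit_normalized_gamma_prod:
  assumes K: "compact K" and c: "c > - 1" "\<And>t. t \<in> K \<Longrightarrow> shifted c t \<in> barnes_regular"
    and N: "filterlim N sequentially sequentially"
  shows "uniform_limit K (\<lambda>n t. normalized_gamma_prod (shifted c t) (N n) / normalized_gamma_prod (of_real c) (N n))
      (\<lambda>t. (1 / barnes_G (shifted c t + 1)) / (1 / barnes_G (of_real c + 1))) sequentially"
    and "bounded ((\<lambda>t. (1 / barnes_G (shifted c t + 1)) / (1 / barnes_G (of_real c + 1))) ` K)"
proof -
  have reg: "complex_of_real c \<in> barnes_regular" by (rule of_real_barnes_regular[OF c(1)])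
  have cs: "continuous_on K (shifted c)" unfolding shifted_def by (intro continuous_intros) auto
  have nz: "barnes_G (shifted c t + 1) \<noteq> 0" if "t \<in> K" for t by (rule barnes_G_nonzero[OF c(2)[OF that]])
  have cG: "continuous_on K (\<lambda>t. barnes_G (shifted c t + 1))"
    by (rule continuous_on_compose2[OF holomorphic_on_imp_continuous_on[OF barnes_G_holomorphic]])
       (auto intro!: continuous_intros cs)
  have bd: "bounded ((\<lambda>t. 1 / barnes_G (shifted c t + 1)) ` K)"
    using nz by (intro compact_imp_bounded compact_continuous_image K continuous_intros cG) auto
  then have "bounded ((\<lambda>x. barnes_G (of_real c + 1) * x) ` ((\<lambda>t. 1 / barnes_G (shifted c t + 1)) ` K))"
    by (rule bounded_linear_image) (rule bounded_linear_mult_right)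
  then show "bounded ((\<lambda>t. (1 / barnes_G (shifted c t + 1)) / (1 / barnes_G (of_real c + 1))) ` K)"
    by (simp add: image_image mult.commute)
  have "uniform_limit (shifted c ` K) (\<lambda>N w. normalized_gamma_prod w N) (\<lambda>w. 1 / barnes_G (w + 1)) sequentially"
    unfolding normalized_gamma_prod_def
    by (rule gamma_prod_asymptotics) (use c(2) in \<open>auto intro!: compact_continuous_image cs K\<close>)
  then have "uniform_limit K (\<lambda>N t. normalized_gamma_prod (shifted c t) N) (\<lambda>t. 1 / barnes_G (shifted c t + 1)) sequentially"
    by (rule uniform_limit_compose') auto
  then have 1: "uniform_limit K (\<lambda>n t. normalized_gamma_prod (shifted c t) (N n)) (\<lambda>t. 1 / barnes_G (shifted c t + 1)) sequentially"
    by (rule filterlim_compose) (rule N)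
  have "(\<lambda>N. normalized_gamma_prod (of_real c) N) \<longlonglongrightarrow> 1 / barnes_G (of_real c + 1)"
    using tendsto_uniform_limitI[OF gamma_prod_asymptotics[of "{of_real c}"], of "of_real c"] reg
    by (simp add: normalized_gamma_prod_def)
  then have 2: "(\<lambda>n. normalized_gamma_prod (of_real c) (N n)) \<longlonglongrightarrow> 1 / barnes_G (of_real c + 1)"
    by (rule filterlim_compose[OF _ N])
  show "uniform_limit K (\<lambda>n t. normalized_gamma_prod (shifted c t) (N n) / normalized_gamma_prod (of_real c) (N n))
      (\<lambda>t. (1 / barnes_G (shifted c t + 1)) / (1 / barnes_G (of_real c + 1))) sequentially"
    by (rule uniform_lim_divide[OF 1 uniform_limit_const_fun[OF 2] bd, of "norm (1 / barnes_G (of_real c + 1))"])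
       (use barnes_G_nonzero[OF reg] in auto)
qed

text \<open>By \<open>volume_mgf_eq\<close> the quotient is a product of three uniformly convergent
  families: one normalised Gamma product for each parity, and an exponential whose coefficients of t
  and t^2 converge. Boundedness of the limits on \<open>K\<close> lets the uniform limits be
  multiplied.\<close>

theorem volume_mgf_uniform_limit:
  assumes K: "compact K" "K \<subseteq> UNIV - {- of_nat (d + j) | j. j \<ge> 1}"
  shows "uniform_limit K (\<lambda>r t. volume_mgf d r (log_volume_centering (d + r)) t /
      exp ((1/4) * t\<^sup>2 * of_real (ln (real (d + r) / 2)))) (gaussian_volume_limit d) sequentially"
proof -
  obtain R where R: "R \<ge> 1" "\<And>w. w \<in> K \<Longrightarrow> norm w \<le> R"
  proof -
    from K(1) obtain B where "\<forall>x\<in>K. norm x \<le> B" using compact_imp_bounded bounded_iff by metis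
    then show thesis by (intro that[of "max 1 B"]) (auto simp: max.coboundedI2)
  qed
  have N1: "filterlim (\<lambda>r::nat. (r + 1) div 2) sequentially sequentially"
    unfolding filterlim_at_top eventually_sequentially by (intro allI, rule_tac x="2 * Z" in exI) auto
  have N2: "filterlim (\<lambda>r::nat. r div 2) sequentially sequentially"
    unfolding filterlim_at_top eventually_sequentially by (intro allI, rule_tac x="2 * Z" in exI) auto
  let ?A = "(real d - 1) / 2" and ?B = "real d / 2"
  have reg: "shifted ?A t \<in> barnes_regular" "shifted ?B t \<in> barnes_regular" if "t \<in> K" for t
    using shifted_barnes_regular[of t d] K(2) that by auto
  note U = uniform_limit_normalized_gamma_prod[OF K(1) _ reg(1) N1]
  note V = uniform_limit_normalized_gamma_prod[OF K(1) _ reg(2) N2]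
  let ?a = "- (real d / 2) * ln 2"
  define D where "D r = R * \<bar>linear_coeff d r - ?a\<bar> + R\<^sup>2 * \<bar>quadratic_coeff d r\<bar>" for r
  have "D \<longlonglongrightarrow> R * \<bar>?a - ?a\<bar> + R\<^sup>2 * \<bar>0\<bar>"
    unfolding D_def by (intro tendsto_intros linear_coeff_LIMSEQ quadratic_coeff_LIMSEQ)
  then have D: "D \<longlonglongrightarrow> 0" by simp
  have "uniform_limit K (\<lambda>r t. t * of_real (linear_coeff d r) + t\<^sup>2 * of_real (quadratic_coeff d r)) (\<lambda>t. t * of_real ?a) sequentially"
  proof (rule uniform_limitI)
    fix e :: real assume "e > 0"
    then have "\<forall>\<^sub>F r in sequentially. D r < e" using order_tendstoD(2)[OF D] by simp
    then show "\<forall>\<^sub>F r in sequentially. \<forall>t\<in>K. dist (t * of_real (linear_coeff d r) + t\<^sup>2 * of_real (quadratic_coeff d r)) (t * of_real ?a) < e"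
    proof eventually_elim
      case (elim r)
      show ?case
      proof
        fix t assume t: "t \<in> K"
        have "dist (t * of_real (linear_coeff d r) + t\<^sup>2 * of_real (quadratic_coeff d r)) (t * of_real ?a) =
          norm (t * of_real (linear_coeff d r - ?a) + t\<^sup>2 * of_real (quadratic_coeff d r))"
          unfolding dist_norm of_real_diff right_diff_distrib by (simp only: add_diff_eq diff_add_eq)
        also have "\<dots> \<le> norm (t * of_real (linear_coeff d r - ?a)) + norm (t\<^sup>2 * of_real (quadratic_coeff d r))"
          by (rule norm_triangle_ineq)
        also have "\<dots> = norm t * \<bar>linear_coeff d r - ?a\<bar> + (norm t)\<^sup>2 * \<bar>quadratic_coeff d r\<bar>"
          by (simp only: norm_mult norm_of_real norm_power)
        also have "\<dots> \<le> D r" unfolding D_def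
          using R(2)[OF t] by (intro add_mono mult_right_mono power_mono) auto
        finally show "dist (t * of_real (linear_coeff d r) + t\<^sup>2 * of_real (quadratic_coeff d r)) (t * of_real ?a) < e"
          using elim by simp
      qed
    qed
  qed
  then have W: "uniform_limit K (\<lambda>r t. exp (t * of_real (linear_coeff d r) + t\<^sup>2 * of_real (quadratic_coeff d r)))
      (\<lambda>t. exp (t * of_real ?a)) sequentially"
    by (rule uniform_limit_exp[where b="R * \<bar>?a\<bar>"])
       (use R(2) in \<open>auto simp only: norm_mult norm_of_real intro!: mult_right_mono\<close>)
  have bW: "bounded ((\<lambda>t. exp (t * complex_of_real ?a)) ` K)"
    by (intro compact_imp_bounded compact_continuous_image K continuous_intros)
  have AB: "?A > - 1" "?B > - 1" by auto
  have bUV: "bounded ((\<lambda>t. f t * g t) ` K)" if f: "bounded (f ` K)" and g: "bounded (g ` K)" for f g :: "complex \<Rightarrow> complex"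
  proof -
    obtain a b where "\<And>t. t \<in> K \<Longrightarrow> norm (f t) \<le> a" "\<And>t. t \<in> K \<Longrightarrow> norm (g t) \<le> b"
      using f g by (force simp: bounded_iff)
    then have "norm (f t * g t) \<le> \<bar>a\<bar> * \<bar>b\<bar>" if "t \<in> K" for t
      unfolding norm_mult using that by (intro mult_mono) (force intro: order_trans)+
    then show ?thesis by (auto simp: bounded_iff)
  qed
  show ?thesis
    unfolding volume_mgf_eq gaussian_volume_limit_eq[abs_def]
    by (intro uniform_lim_mult U(1) V(1) W U(2) V(2) bW bUV AB)
qed

section \<open>The standard normal law as reference law, and the final statement\<close>

lemma std_normal_complex_mgf:
  fixes t :: complex
  shows "integrable std_normal_distribution (\<lambda>x. exp (t * of_real x))"
    and "(\<integral>x. exp (t * of_real x) \<partial>std_normal_distribution) = exp (t\<^sup>2 / 2)"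
proof -
  define a where "a = Re t"
  define b where "b = Im t"
  have t: "t = of_real a + \<i> * of_real b" by (simp add: a_def b_def complex_eq_iff)
  interpret prob_space std_normal_distribution by (rule prob_space_normal_density) simp
  define h where "h x = std_normal_density x *\<^sub>R exp (\<i> * of_real (b * x))" for x
  have "integrable std_normal_distribution (\<lambda>x. exp (\<i> * of_real (b * x)))"
    by (rule integrable_const_bound[where B=1]) auto
  then have ih: "integrable lborel h"
    unfolding h_def by (subst (asm) integrable_density) auto
  have "char std_normal_distribution b = (\<integral>x. h x \<partial>lborel)"
    unfolding char_def h_def by (subst integral_density) (auto simp: mult_ac)
  then have Lh: "(\<integral>x. h x \<partial>lborel) = of_real (exp (- b\<^sup>2 / 2))"
    by (simp add: char_std_normal_distribution)
  \<comment> \<open>Completing the square absorbs the real part a of t into a translation by a. The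
    imaginary part b is left to the characteristic function, and the translation adds the phase exp
    (i a b).\<close>
  define c where "c = exp (of_real (a\<^sup>2 / 2) + \<i> * of_real (a * b))"
  have eq: "std_normal_density x *\<^sub>R exp (t * of_real x) = c * h (- a + 1 * x)" for x
  proof -
    have "- x\<^sup>2 / 2 + a * x = a\<^sup>2 / 2 - (- a + x)\<^sup>2 / 2" by (simp add: field_simps power2_eq_square)
    then have "std_normal_density x * exp (a * x) = exp (a\<^sup>2 / 2) * std_normal_density (- a + x)"
      unfolding std_normal_density_def by (simp add: exp_add[symmetric] mult_ac)
    then have "of_real (std_normal_density x) * exp (of_real (a * x)) = exp (of_real (a\<^sup>2 / 2)) * complex_of_real (std_normal_density (- a + x))"
      by (metis exp_of_real of_real_mult)
    moreover have "exp (t * of_real x) = exp (of_real (a * x)) * exp (\<i> * of_real (b * x))"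
      unfolding exp_add[symmetric] by (rule arg_cong[where f=exp]) (simp add: t algebra_simps)
    moreover have "exp (\<i> * of_real (a * b)) * exp (\<i> * of_real (b * (- a + x))) = exp (\<i> * of_real (b * x))"
      by (simp add: exp_add[symmetric] algebra_simps)
    ultimately show ?thesis
      unfolding c_def h_def exp_add scaleR_conv_of_real mult_1 by (metis mult.assoc mult.left_commute)
  qed
  have "integrable lborel (\<lambda>x. std_normal_density x *\<^sub>R exp (t * of_real x))"
    unfolding eq by (intro integrable_mult_right lborel_integrable_real_affine ih) simp
  then show "integrable std_normal_distribution (\<lambda>x. exp (t * of_real x))"
    by (subst integrable_density) auto
  have "(\<integral>x. exp (t * of_real x) \<partial>std_normal_distribution) = (\<integral>x. c * h (- a + 1 * x) \<partial>lborel)"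
    unfolding eq[symmetric] by (rule integral_density) auto
  also have "\<dots> = c * (\<integral>x. h (- a + 1 * x) \<partial>lborel)" by simp
  also have "(\<integral>x. h (- a + 1 * x) \<partial>lborel) = (\<integral>x. h x \<partial>lborel)"
    using lborel_integral_real_affine[of 1 h "- a"] by simp
  also have "c * \<dots> = exp (of_real (a\<^sup>2 / 2) + \<i> * of_real (a * b) + of_real (- b\<^sup>2 / 2))"
    unfolding Lh c_def exp_add exp_of_real ..
  also have "of_real (a\<^sup>2 / 2) + \<i> * of_real (a * b) + of_real (- b\<^sup>2 / 2) = t\<^sup>2 / 2"
    by (simp add: t power2_eq_square field_simps)
  finally show "(\<integral>x. exp (t * of_real x) \<partial>std_normal_distribution) = exp (t\<^sup>2 / 2)" .
qed

lemma infinitely_divisible_std_normal: "infinitely_divisible std_normal_distribution"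
  unfolding infinitely_divisible_def
proof (intro conjI allI impI)
  show "real_distribution std_normal_distribution" by (rule real_dist_normal_dist)
  fix k :: nat assume k: "k \<ge> 1"
  \<comment> \<open>The standard deviation for which k independent summands have total variance
    1.\<close>
  define s where "s = 1 / sqrt (real k)"
  define \<nu> where "\<nu> = density lborel (\<lambda>x. ennreal (normal_density 0 s x))"
  have s: "s > 0" "real k * s\<^sup>2 = 1" using k by (auto simp: s_def power_divide)
  interpret \<nu>: prob_space \<nu> unfolding \<nu>_def by (rule prob_space_normal_density[OF s(1)])
  have sets: "sets \<nu> = sets borel" by (simp add: \<nu>_def)
  have rd: "real_distribution \<nu>"
    by (intro real_distribution.intro real_distribution_axioms.intro \<nu>.prob_space_axioms sets)
  let ?P = "PiM {..<k} (\<lambda>_. \<nu>)"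
  interpret P: prob_space ?P by (intro prob_space_PiM \<nu>.prob_space_axioms)
  interpret product_prob_space "\<lambda>_. \<nu>" "{..<k}" by standard
  have comp: "(\<lambda>x. x i) \<in> borel_measurable ?P" if "i \<in> {..<k}" for i
    using measurable_component_singleton[OF that, of "\<lambda>_. \<nu>"] by (simp cong: measurable_cong_sets add: sets)
  have law: "distr ?P borel (\<lambda>x. x i) = \<nu>" if "i \<in> {..<k}" for i
  proof -
    have "distr ?P borel (\<lambda>x. x i) = distr ?P \<nu> (\<lambda>x. x i)" by (rule distr_cong) (auto simp: sets)
    then show ?thesis using PiM_component[OF that] by simp
  qed
  have indep: "P.indep_vars (\<lambda>i. borel) (\<lambda>i x. x i) {..<k}"
  proof (subst P.indep_vars_iff_distr_eq_PiM')
    show "{..<k} \<noteq> {}" using k by (auto simp: lessThan_empty_iff)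
    show "distr ?P (PiM {..<k} (\<lambda>_. borel)) (\<lambda>x. \<lambda>i\<in>{..<k}. x i) = PiM {..<k} (\<lambda>i. distr ?P borel (\<lambda>x. x i))"
    proof -
      have "distr ?P (PiM {..<k} (\<lambda>_. borel)) (\<lambda>x. \<lambda>i\<in>{..<k}. x i) = distr ?P ?P (\<lambda>x. x)"
        by (rule distr_cong) (auto intro!: sets_PiM_cong simp: sets space_PiM PiE_restrict)
      also have "\<dots> = PiM {..<k} (\<lambda>i. distr ?P borel (\<lambda>x. x i))"
        by simp (rule PiM_cong, simp_all add: law)
      finally show ?thesis .
    qed
  qed (rule comp)
  have normal: "distributed ?P lborel (\<lambda>x. x i) (normal_density 0 s)" if "i \<in> {..<k}" for i
  proof -
    have "distr ?P lborel (\<lambda>x. x i) = distr ?P borel (\<lambda>x. x i)" by (rule distr_cong) auto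
    then show ?thesis unfolding distributed_def law[OF that] using comp[OF that] by (simp add: \<nu>_def)
  qed
  have "distributed ?P lborel (\<lambda>x. \<Sum>i<k. x i) (normal_density (\<Sum>i<k. 0) (sqrt (\<Sum>i<k. s\<^sup>2)))"
    using k s(1) indep normal by (intro P.sum_indep_normal) (auto simp: lessThan_empty_iff)
  then have "distr ?P lborel (\<lambda>x. \<Sum>i<k. x i) = std_normal_distribution" using s(2) by (simp add: distributed_def)
  moreover have "distr ?P lborel (\<lambda>x. \<Sum>i<k. x i) = distr ?P borel (\<lambda>x. \<Sum>i<k. x i)" by (rule distr_cong) auto
  ultimately show "\<exists>\<nu>. real_distribution \<nu> \<and> std_normal_distribution = distr (PiM {..<k} (\<lambda>_. \<nu>)) borel (\<lambda>x. \<Sum>i<k. x i)"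
    using rd by metis
qed

lemma gaussian_volume_limit_analytic:
  "gaussian_volume_limit d analytic_on {t. Re t > - real d - 1}"
proof -
  have "gaussian_volume_limit d holomorphic_on {t. Re t > - real d - 1}"
    unfolding gaussian_volume_limit_def
  proof (intro holomorphic_intros)
    note hG = holomorphic_on_compose_gen[OF _ barnes_G_holomorphic, unfolded comp_def]
    show "(\<lambda>t. barnes_G ((of_nat d + 1) / 2 + t / 2)) holomorphic_on {t. Re t > - real d - 1}"
      by (rule hG) (auto intro!: holomorphic_intros)
    show "(\<lambda>t. barnes_G ((of_nat d + 2) / 2 + t / 2)) holomorphic_on {t. Re t > - real d - 1}"
      by (rule hG) (auto intro!: holomorphic_intros)
    fix t assume "t \<in> {t. Re t > - real d - 1}"
    then have "t \<notin> {- of_nat (d + j) | j. j \<ge> 1}" by auto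
    note reg = shifted_barnes_regular[OF this]
    have "(of_nat d + 1) / 2 + t / 2 = shifted ((real d - 1) / 2) t + 1"
      "(of_nat d + 2) / 2 + t / 2 = shifted (real d / 2) t + 1"
      by (simp_all add: shifted_def field_simps)
    then show "2 powr (t * of_nat d / 2) * barnes_G ((of_nat d + 1) / 2 + t / 2) * barnes_G ((of_nat d + 2) / 2 + t / 2) \<noteq> 0"
      using barnes_G_nonzero[OF reg(1)] barnes_G_nonzero[OF reg(2)] by simp
  qed auto
  then show ?thesis by (simp add: analytic_on_open open_halfspace_Re_gt)
qed

text \<open>The first clause ensures that the definite description in \<open>cmgf\<close> denotes.
  The strip of the second clause is the exact domain of convergence of the expectation, and w_n
  \<eta>(t) equals t^2 / 4 times ln (n / 2). The third clause goes beyond the strip, where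
  \<open>cmgf\<close> is the meromorphic continuation.\<close>

theorem proposition4p10:
  fixes d :: nat
    and M :: "nat \<Rightarrow> 'a measure"
    and X :: "nat \<Rightarrow> nat \<Rightarrow> 'a \<Rightarrow> nat \<Rightarrow> real"
  assumes gaussian: "\<And>n. n > d \<Longrightarrow> gaussian_points (M n) n (n - d) (X n)"
  shows "let Y = (\<lambda>n \<omega>. log_simplex_volume n (n - d) (\<lambda>i. X n i \<omega>) - log_volume_centering n) in
     (\<forall>n>d. \<exists>!F. mgf_continuation (M n) (Y n) F) \<and>
     mod_phi_convergent M Y std_normal_distribution (\<lambda>t. t\<^sup>2 / 2)
       (\<lambda>n. (1/2) * ln (real n / 2)) (ereal (- real d - 1)) \<infinity> (gaussian_volume_limit d) \<and>
     (\<forall>K. compact K \<and> K \<subseteq> UNIV - {- of_nat (d + j) | j. j \<ge> 1} \<longrightarrow>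
        uniform_limit K
          (\<lambda>n t. cmgf (M n) (Y n) t / exp ((1/4) * t\<^sup>2 * of_real (ln (real n / 2))))
          (gaussian_volume_limit d) sequentially)"
proof -
  define Y where "Y = (\<lambda>n \<omega>. log_simplex_volume n (n - d) (\<lambda>i. X n i \<omega>) - log_volume_centering n)"
  have split: "n = d + (n - d)" "n - d > 0" if "n > d" for n using that by auto
  have Ymeas: "Y n \<in> borel_measurable (M n)" if "n > d" for n
    unfolding Y_def by (rule log_volume_measurable[OF gaussian split]) (use that in auto)
  have unique: "\<exists>!F. mgf_continuation (M n) (Y n) F" if "n > d" for n
    unfolding Y_def by (rule mgf_continuation_volume[OF gaussian split]) (use that in auto)
  have cmgf: "cmgf (M n) (Y n) t = volume_mgf d (n - d) (log_volume_centering n) t" if "n > d" for n t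
    unfolding Y_def by (rule cmgf_volume[OF gaussian split]) (use that in auto)
  have lim: "uniform_limit K (\<lambda>n t. cmgf (M n) (Y n) t / exp ((1/4) * t\<^sup>2 * of_real (ln (real n / 2))))
      (gaussian_volume_limit d) sequentially"
    if K: "compact K" "K \<subseteq> UNIV - {- of_nat (d + j) | j. j \<ge> 1}" for K
  proof -
    have "filterlim (\<lambda>n. n - d) sequentially sequentially"
      by (rule filterlim_minus_const_nat_at_top)
    with volume_mgf_uniform_limit[OF K]
    have "uniform_limit K (\<lambda>n t. volume_mgf d (n - d) (log_volume_centering (d + (n - d))) t /
      exp ((1/4) * t\<^sup>2 * of_real (ln (real (d + (n - d)) / 2)))) (gaussian_volume_limit d) sequentially"
      by (rule filterlim_compose)
    then show ?thesis
      by (rule uniform_limit_cong[THEN iffD1, rotated 2])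
         (auto intro!: eventually_mono[OF eventually_gt_at_top[of d]] simp: cmgf)
  qed
  have "mod_phi_convergent M Y std_normal_distribution (\<lambda>t. t\<^sup>2 / 2)
       (\<lambda>n. (1/2) * ln (real n / 2)) (ereal (- real d - 1)) \<infinity> (gaussian_volume_limit d)"
    unfolding mod_phi_convergent_def Let_def
  proof (intro conjI ballI allI impI)
    have S: "{t. ereal (- real d - 1) < ereal (Re t) \<and> ereal (Re t) < \<infinity>} = {t. Re t > - real d - 1}" by auto
    show "\<forall>\<^sub>F n in sequentially. prob_space (M n) \<and> Y n \<in> borel_measurable (M n)"
      using eventually_gt_at_top[of d] by eventually_elim (use gaussian Ymeas in \<open>auto simp: gaussian_points_def\<close>)
    show "filterlim (\<lambda>n. (1/2) * ln (real n / 2)) at_top sequentially" by real_asymp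
    show "gaussian_volume_limit d analytic_on {t. ereal (- real d - 1) < ereal (Re t) \<and> ereal (Re t) < \<infinity>}"
      unfolding S by (rule gaussian_volume_limit_analytic)
    fix K assume K: "compact K \<and> K \<subseteq> {t. ereal (- real d - 1) < ereal (Re t) \<and> ereal (Re t) < \<infinity>}"
    \<comment> \<open>All excluded points have real part at most -d - 1, so the convergence in the
      strip is an instance of the one on compact sets away from the poles.\<close>
    then have "K \<subseteq> UNIV - {- of_nat (d + j) | j. j \<ge> 1}" unfolding S by fastforce
    moreover have "complex_of_real ((1/2) * ln (real n / 2)) * (t\<^sup>2 / 2) = (1/4) * t\<^sup>2 * of_real (ln (real n / 2))" for n t
      by (simp add: mult.commute)
    ultimately show "uniform_limit K (\<lambda>n t. cmgf (M n) (Y n) t / exp (complex_of_real ((1/2) * ln (real n / 2)) * (t\<^sup>2 / 2)))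
        (gaussian_volume_limit d) sequentially"
      using lim[of K] K by (simp only:)
  qed (auto simp: std_normal_complex_mgf infinitely_divisible_std_normal)
  then show ?thesis unfolding Let_def Y_def[symmetric] using unique lim by blast
qed

end
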